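(* There exist a scattering filter bank $(\chi,\Psi)$ on $\mathbb{R}$, with $\Psi=(\psi_\lambda)_{\lambda\in\Lambda}$, such that $\chi$ and all $\psi_\lambda$ ($\lambda\in\Lambda$) are band-limited Schwartz functions, and a band-limited Schwartz function $f\in\mathcal{S}(\mathbb{R})$ such that $$\widehat\chi(\xi)=1$$ for all $\xi$ in a neighborhood of the origin, while $$\limsup_{N\to\infty}\|U_Nf\|_{\ell^2(\Lambda^N;L^2(\mathbb{R}))}^{1/N}=1.$$
   Context: Functions are complex-valued. The Fourier transform is $\widehat h(\xi)=\int_{\mathbb{R}}h(x)e^{-2\pi i\xi x}\,dx$ for $h\in L^1(\mathbb{R})$, extended to a unitary map on $L^2(\mathbb{R})$. A function is band-limited if its Fourier transform has compact support. $\mathcal{S}(\mathbb{R})$ is the Schwartz space. A scattering filter bank on $\mathbb{R}$ is a pair $(\chi,\Psi)$, where $\Psi=(\psi_\lambda)_{\lambda\in\Lambda}$ is indexed by a countable set $\Lambda$, and $\chi,\psi_\lambda\in L^1(\mathbb{R})\cap L^2(\mathbb{R})$ for every $\lambda\in\Lambda$, such that $$|\widehat\chi(\xi)|^2+\sum_{\lambda\in\Lambda}|\widehat\psi_\lambda(\xi)|^2=1\quad\text{for almost every }\xi\in\mathbb{R},$$ and such that $\widehat\chi(0)\neq0$. For $n\ge1$, $\Lambda^n$ is the set of $n$-tuples $p=(\lambda_1,\dots,\lambda_n)$ of elements of $\Lambda$. For $f\in L^2(\mathbb{R})$ set $U[\lambda]f=|f*\psi_\lambda|$ for $\lambda\in\Lambda$,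 and $U[p]f=U[\lambda_n]\cdots U[\lambda_1]f$ for $p=(\lambda_1,\dots,\lambda_n)$ (so $U[\lambda_1]$ is applied first). Set $U_Nf=(U[p]f)_{p\in\Lambda^N}$ and $$\|U_Nf\|_{\ell^2(\Lambda^N;L^2(\mathbb{R}))}^2=\sum_{p\in\Lambda^N}\|U[p]f\|_2^2.$$ *)

theory Defs
  imports "HOL-Analysis.Analysis"
begin

definition fourier :: "(real \<Rightarrow> complex) \<Rightarrow> real \<Rightarrow> complex" where
  "fourier h \<xi> = (LINT x|lborel. h x * cis (- 2 * pi * \<xi> * x))"

text \<open>The Fourier transform above is the integral one, so the following notion is meaningful only
  for integrable functions; it is applied below only to Schwartz functions.\<close>

definition band_limited :: "(real \<Rightarrow> complex) \<Rightarrow> bool" where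
  "band_limited h \<longleftrightarrow> compact (closure {\<xi>. fourier h \<xi> \<noteq> 0})"

definition higher_vderiv :: "nat \<Rightarrow> (real \<Rightarrow> complex) \<Rightarrow> real \<Rightarrow> complex" where
  "higher_vderiv n f = ((\<lambda>g x. vector_derivative g (at x)) ^^ n) f"

definition schwartz :: "(real \<Rightarrow> complex) \<Rightarrow> bool" where
  "schwartz f \<longleftrightarrow>
     (\<forall>n x. higher_vderiv n f differentiable at x) \<and>
     (\<forall>m n. bounded (range (\<lambda>x. x ^ m *\<^sub>R higher_vderiv n f x)))"

definition in_L1 :: "(real \<Rightarrow> complex) \<Rightarrow> bool" where
  "in_L1 h \<longleftrightarrow> integrable lborel h"

definition in_L2 :: "(real \<Rightarrow> complex) \<Rightarrow> bool" where
  "in_L2 h \<longleftrightarrow> h \<in> borel_measurable lborel \<and> integrable lborel (\<lambda>x. (cmod (h x))\<^sup>2)"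

definition scattering_filter_bank ::
  "(real \<Rightarrow> complex) \<Rightarrow> 'i set \<Rightarrow> ('i \<Rightarrow> real \<Rightarrow> complex) \<Rightarrow> bool" where
  "scattering_filter_bank chi \<Lambda> \<psi> \<longleftrightarrow>
     countable \<Lambda> \<and>
     in_L1 chi \<and> in_L2 chi \<and>
     (\<forall>l\<in>\<Lambda>. in_L1 (\<psi> l) \<and> in_L2 (\<psi> l)) \<and>
     (AE \<xi> in lborel.
        (\<lambda>l. (cmod (fourier (\<psi> l) \<xi>))\<^sup>2) summable_on \<Lambda> \<and>
        (cmod (fourier chi \<xi>))\<^sup>2 + (\<Sum>\<^sub>\<infinity>l\<in>\<Lambda>. (cmod (fourier (\<psi> l) \<xi>))\<^sup>2) = 1) \<and>
     fourier chi 0 \<noteq> 0"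

definition convolution :: "(real \<Rightarrow> complex) \<Rightarrow> (real \<Rightarrow> complex) \<Rightarrow> real \<Rightarrow> complex" where
  "convolution f g x = (LINT y|lborel. f y * g (x - y))"

definition U1 :: "('i \<Rightarrow> real \<Rightarrow> complex) \<Rightarrow> 'i \<Rightarrow> (real \<Rightarrow> complex) \<Rightarrow> real \<Rightarrow> complex" where
  "U1 \<psi> l f = (\<lambda>x. complex_of_real (cmod (convolution f (\<psi> l) x)))"

text \<open>The head of the list is the first filter applied.\<close>

primrec U_path :: "('i \<Rightarrow> real \<Rightarrow> complex) \<Rightarrow> 'i list \<Rightarrow> (real \<Rightarrow> complex) \<Rightarrow> real \<Rightarrow> complex" where
  "U_path \<psi> [] f = f"
| "U_path \<psi> (l # p) f = U_path \<psi> p (U1 \<psi> l f)"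

text \<open>Norms take values in \<^typ>\<open>ennreal\<close>, so that a divergent integral or sum yields \<open>\<infinity>\<close> and not
  the default value \<open>0\<close>. The exponent \<open>a\<close> below is meant to be positive.\<close>

definition ennreal_powr :: "ennreal \<Rightarrow> real \<Rightarrow> ennreal" where
  "ennreal_powr t a = (if t = \<infinity> then \<infinity> else ennreal (enn2real t powr a))"

definition L2_norm_sq :: "(real \<Rightarrow> complex) \<Rightarrow> ennreal" where
  "L2_norm_sq h = (\<integral>\<^sup>+ x. ennreal ((cmod (h x))\<^sup>2) \<partial>lborel)"

definition U_norm ::
  "'i set \<Rightarrow> ('i \<Rightarrow> real \<Rightarrow> complex) \<Rightarrow> nat \<Rightarrow> (real \<Rightarrow> complex) \<Rightarrow> ennreal" where
  "U_norm \<Lambda> \<psi> N f =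
     ennreal_powr (\<Sum>\<^sub>\<infinity>p\<in>{p. set p \<subseteq> \<Lambda> \<and> length p = N}. L2_norm_sq (U_path \<psi> p f)) (1 / 2)"

end

theory Submission
  imports
    "HOL-Probability.Characteristic_Functions"
    "HOL-Probability.Sinc_Integral"
    "HOL-Real_Asymp.Real_Asymp"
    Defs
begin

text \<open>A filter that vanishes near the origin destroys the low frequencies of the nonnegative function
produced by the preceding modulus, so some energy is lost at every step. The loss per step can be made
small, however. If the function is a single bump of width \<open>1 / W\<close>, its spectrum is spread over
frequencies of order \<open>W\<close>, and a filter whose transform is \<open>1\<close> for \<open>R \<le> \<bar>\<xi>\<bar> \<le> S\<close>, with \<open>R\<close>
much smaller and \<open>S\<close> much larger than \<open>W\<close>, hardly changes it (\<open>l2_wide_step\<close>). Since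
every step is nonexpansive in \<open>L\<^sup>2\<close> (\<open>l2_U1_nonexpansive\<close>), \<open>N\<close> repetitions of this filter move the
bump by at most \<open>N\<close> times the error of one step (\<open>l2_iterate\<close>). The filter bank below has infinitely
many bands; the \<open>j\<close>-th one reproduces a bump, \<open>profile j\<close>, up to a relative error \<open>O(2\<^sup>-\<^sup>j)\<close>, so that
\<open>j\<^sup>3\<close> repetitions cost a vanishing fraction of its norm.

These bumps, at arbitrarily high frequencies, must all come from one band-limited input. This is the
work of the kink that the modulus creates at a zero. The modulus of
\<open>signal x = x \<kappa>(x)\<^sup>2 exp (12 \<pi> i x)\<close>, with \<open>\<kappa> = lp_kernel\<close> real, is \<open>\<bar>x\<bar> \<kappa>(x)\<^sup>2\<close>; its transform is
\<open>- c / \<xi>\<^sup>2 + O(\<bar>\<xi>\<bar>\<^sup>-\<^sup>3)\<close> with \<open>c > 0\<close> (\<open>fourier_modulus_signal\<close>). A filter of width \<open>W\<close> centred at \<open>S\<close>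
sees it as the constant \<open>- c / S\<^sup>2\<close> and returns a bump of width \<open>1 / W\<close> modulated at frequency \<open>S\<close>; the
modulus removes the modulation and leaves \<open>(c W / S\<^sup>2) \<bar>\<kappa>(W x)\<bar>\<close> (\<open>l2_narrow_step\<close>). In band \<open>j\<close> both
\<open>W\<close> and \<open>S\<close> are \<open>2\<close> to a power of order \<open>j\<^sup>2\<close>, hence the norm of the bump is at least \<open>2\<close> to a power
\<open>- O(j\<^sup>2)\<close>, and its root of order \<open>j\<^sup>3\<close> tends to \<open>1\<close>.

The bump is not concentrated at high frequencies after the modulus because taking the modulus does not
increase the \<open>L\<^sup>2\<close> norm of the derivative (\<open>modulus_derivative_bound\<close>). The upper bound \<open>1\<close> for the limit superior is conservation of energy (\<open>U_norm_le\<close>). Both rest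
on the Plancherel identity, proved here for bounded continuous integrable functions by Gaussian
regularisation; this class contains all functions that occur along a path.\<close>

section \<open>The Fourier transform on bounded continuous integrable functions\<close>

lemma integrable_lborel_affine:
  fixes h :: "real \<Rightarrow> complex"
  assumes "integrable lborel h" "c \<noteq> 0"
  shows "integrable lborel (\<lambda>x. h (t + c * x))"
  using lborel_integrable_real_affine[OF assms] .

text \<open>The class is stable under convolution, modulus, modulation and affine substitution, so it
contains every function met along a path; on it the Fourier integral converges, and the Plancherel
identity holds for this integral without an abstract extension to \<open>L\<^sup>2\<close>.\<close>

definition tame :: "(real \<Rightarrow> complex) \<Rightarrow> bool" where
  "tame h \<longleftrightarrow> continuous_on UNIV h \<and> bounded (range h) \<and> integrable lborel h"

lemma tame_measurable: "tame h \<Longrightarrow> h \<in> borel_measurable borel"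
  unfolding tame_def by (intro borel_measurable_continuous_onI) auto

lemma tame_bound: "tame h \<Longrightarrow> \<exists>B\<ge>0. \<forall>x. cmod (h x) \<le> B"
  unfolding tame_def bounded_iff by (metis norm_ge_zero order_trans rangeI)

lemma integrable_times_cis:
  fixes h :: "real \<Rightarrow> complex"
  assumes "integrable lborel h" 
  shows "integrable lborel (\<lambda>x. h x * cis (a * x + b))"
proof (rule Bochner_Integration.integrable_bound[OF assms])
  show "(\<lambda>x. h x * cis (a * x + b)) \<in> borel_measurable lborel"
    by (intro borel_measurable_times borel_measurable_integrable[OF assms])
      (auto intro!: borel_measurable_continuous_onI continuous_intros)
qed (auto simp: norm_mult)

lemma integrable_fourier_kernel:
  fixes h :: "real \<Rightarrow> complex"
  assumes "integrable lborel h" 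
  shows "integrable lborel (\<lambda>x. h x * cis (- 2 * pi * \<xi> * x))"
  using integrable_times_cis[OF assms, of "- 2 * pi * \<xi>" 0] by simp

lemma cmod_fourier_le: "cmod (fourier h \<xi>) \<le> (LINT x|lborel. cmod (h x))"
proof -
  have "cmod (fourier h \<xi>) \<le> (LINT x|lborel. cmod (h x * cis (- 2 * pi * \<xi> * x)))"
    unfolding fourier_def by (rule integral_norm_bound)
  then show ?thesis by (simp add: norm_mult)
qed

lemma measurable_fourier [measurable]:
  assumes [measurable]: "h \<in> borel_measurable borel"
  shows "fourier h \<in> borel_measurable borel"
proof -
  have [measurable]: "cis \<in> borel_measurable borel"
    by (intro borel_measurable_continuous_onI continuous_intros)
  show ?thesis unfolding fourier_def[abs_def] by measurable
qed

text \<open>Both sides are the integral of \<open>a(x) b(\<xi>) e\<^sup>-\<^sup>2\<^sup>\<pi>\<^sup>i\<^sup>x\<^sup>\<xi>\<close> over the plane, in the two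
orders of integration.\<close>

lemma multiplication_formula:
  assumes a: "integrable lborel a" and b: "integrable lborel b"
  shows "(LINT \<xi>|lborel. fourier a \<xi> * b \<xi>) = (LINT x|lborel. a x * fourier b x)"
proof -
  have [measurable]: "cis \<in> borel_measurable borel"
    by (intro borel_measurable_continuous_onI continuous_intros)
  have [measurable]: "a \<in> borel_measurable borel" "b \<in> borel_measurable borel"
    using a b by auto
  let ?F = "\<lambda>(x, \<xi>). a x * b \<xi> * cis (- 2 * pi * \<xi> * x)"
  have I: "integrable (lborel \<Otimes>\<^sub>M lborel) ?F"
  proof (rule lborel_pair.Fubini_integrable)
    show "?F \<in> borel_measurable (lborel \<Otimes>\<^sub>M lborel)" by measurable
    show "integrable lborel (\<lambda>x. LINT \<xi>|lborel. norm (?F (x, \<xi>)))"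
      using a by (simp add: norm_mult)
    show "AE x in lborel. integrable lborel (\<lambda>\<xi>. ?F (x, \<xi>))"
    proof (intro AE_I2)
      fix x show "integrable lborel (\<lambda>\<xi>. ?F (x, \<xi>))"
        using integrable_times_cis[OF integrable_mult_right[OF b, of "a x"], of "-2 * pi * x" 0]
        by (simp add: mult_ac)
    qed
  qed
  have "(LINT \<xi>|lborel. LINT x|lborel. ?F (x, \<xi>)) = (LINT x|lborel. LINT \<xi>|lborel. ?F (x, \<xi>))"
    using lborel_pair.Fubini_integral[of "\<lambda>x \<xi>. ?F (x, \<xi>)"] I by (simp add: case_prod_unfold)
  moreover have "(LINT x|lborel. ?F (x, \<xi>)) = fourier a \<xi> * b \<xi>" for \<xi>
    unfolding fourier_def integral_mult_left_zero[symmetric]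
    by (intro Bochner_Integration.integral_cong) (simp_all add: mult_ac)
  moreover have "(LINT \<xi>|lborel. ?F (x, \<xi>)) = a x * fourier b x" for x
    unfolding fourier_def integral_mult_right_zero[symmetric]
    by (intro Bochner_Integration.integral_cong) (simp_all add: mult_ac)
  ultimately show ?thesis by simp
qed

section \<open>Gaussian regularisation, inversion and the Plancherel identity\<close>

text \<open>The Gaussian approximate identity of scale \<open>\<delta>\<close>.\<close>

definition gauss :: "real \<Rightarrow> real \<Rightarrow> real" where
  "gauss \<delta> x = exp (- pi * (x / \<delta>)\<^sup>2) / \<delta>"

lemma std_normal_eq: "std_normal_density x = exp (- x\<^sup>2 / 2) / sqrt (2 * pi)"
  by (simp add: normal_density_def)

lemma gaussian_integrable:
  assumes "\<delta> > 0" shows "integrable lborel (\<lambda>x. complex_of_real (exp (- pi * (\<delta> * x)\<^sup>2)))"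
proof -
  have "integrable lborel (\<lambda>x. complex_of_real (std_normal_density x))"
    by (intro integrable_of_real) (simp add: integrable_normal_density)
  from lborel_integrable_real_affine[OF this, of "sqrt (2 * pi) * \<delta>" 0]
  have "integrable lborel (\<lambda>x. complex_of_real (std_normal_density (sqrt (2 * pi) * \<delta> * x)))"
    using assms by simp
  from integrable_mult_right[OF this, of "sqrt (2 * pi)"]
  have "integrable lborel (\<lambda>x. complex_of_real (sqrt (2 * pi) * std_normal_density (sqrt (2 * pi) * \<delta> * x)))"
    by simp
  moreover have "sqrt (2 * pi) * std_normal_density (sqrt (2 * pi) * \<delta> * x) = exp (- pi * (\<delta> * x)\<^sup>2)" for x
    by (simp add: std_normal_eq power_mult_distrib)
  ultimately show ?thesis by simp
qed

text \<open>A rescaling of the characteristic function of the standard normal distribution.\<close>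

lemma fourier_gaussian:
  assumes "\<delta> > 0"
  shows "fourier (\<lambda>x. complex_of_real (exp (- pi * (\<delta> * x)\<^sup>2))) t = gauss \<delta> t"
proof -
  define c where "c = sqrt (2 * pi)"
  have c: "c > 0" "c\<^sup>2 = 2 * pi" by (auto simp: c_def)
  define s where "s = - c * t / \<delta>"
  have eq: "complex_of_real (std_normal_density (0 + c * \<delta> * x)) * iexp (s * (0 + c * \<delta> * x)) 
     = complex_of_real (exp (- pi * (\<delta> * x)\<^sup>2)) * cis (- 2 * pi * t * x) / c" for x
  proof -
    have "s * (c * \<delta> * x) = - (c\<^sup>2 * t * x)"
      using assms by (simp add: s_def power2_eq_square)
    also have "\<dots> = - 2 * pi * t * x" by (simp add: c)
    finally have 1: "s * (c * \<delta> * x) = - 2 * pi * t * x" .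
    have 2: "- (c * \<delta> * x)\<^sup>2 / 2 = - pi * (\<delta> * x)\<^sup>2"
      by (simp add: power_mult_distrib c)
    show ?thesis unfolding std_normal_eq add_0_left 1 2
      by (simp add: cis_conv_exp c_def)
  qed
  have "complex_of_real (exp (- s\<^sup>2 / 2)) = char std_normal_distribution s"
    by (simp add: char_std_normal_distribution)
  also have "\<dots> = (LINT x|lborel. std_normal_density x *\<^sub>R iexp (s * x))"
    unfolding char_def by (subst integral_density) (auto)
  also have "\<dots> = (LINT x|lborel. complex_of_real (std_normal_density x) * iexp (s * x))"
    by (simp add: scaleR_conv_of_real)
  also have "\<dots> = \<bar>c * \<delta>\<bar> *\<^sub>R (LINT x|lborel. complex_of_real (std_normal_density (0 + c * \<delta> * x)) * iexp (s * (0 + c * \<delta> * x)))"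
    by (rule lborel_integral_real_affine) (use c assms in auto)
  also have "\<dots> = \<bar>c * \<delta>\<bar> *\<^sub>R (fourier (\<lambda>x. complex_of_real (exp (- pi * (\<delta> * x)\<^sup>2))) t / c)"
    unfolding eq fourier_def by simp
  also have "\<dots> = \<delta> * fourier (\<lambda>x. complex_of_real (exp (- pi * (\<delta> * x)\<^sup>2))) t"
    using c assms by (simp add: scaleR_conv_of_real abs_mult)
  finally have *: "\<delta> * fourier (\<lambda>x. complex_of_real (exp (- pi * (\<delta> * x)\<^sup>2))) t = exp (- s\<^sup>2 / 2)" ..
  have "- s\<^sup>2 / 2 = - pi * (t / \<delta>)\<^sup>2" by (simp add: s_def power_mult_distrib power_divide c)
  with * show ?thesis using assms
    unfolding gauss_def by (simp add: field_simps)
qed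

lemma integrable_gauss1: "integrable lborel (\<lambda>x. complex_of_real (gauss 1 x))"
  using gaussian_integrable[of 1] by (simp add: gauss_def)

lemma integral_gauss1: "(LINT x|lborel. complex_of_real (gauss 1 x)) = 1"
  using fourier_gaussian[of 1 0] by (simp add: gauss_def fourier_def)

text \<open>The Gaussian factor makes the inversion integral converge for every integrable
function; by the multiplication formula it turns the value of \<open>h\<close> at \<open>x\<close> into an average of \<open>h\<close> around
\<open>x\<close>.\<close>

lemma regularised_inversion:
  assumes h: "integrable lborel h" and \<delta>: "\<delta> > 0"
  shows "(LINT \<xi>|lborel. fourier h \<xi> * (complex_of_real (exp (- pi * (\<delta> * \<xi>)\<^sup>2)) * cis (2 * pi * x * \<xi>)))
    = (LINT u|lborel. h (x - \<delta> * u) * gauss 1 u)"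
proof -
  let ?E = "\<lambda>\<xi>. complex_of_real (exp (- pi * (\<delta> * \<xi>)\<^sup>2))"
  have i: "integrable lborel (\<lambda>\<xi>. ?E \<xi> * cis (2 * pi * x * \<xi>))"
    using integrable_times_cis[OF gaussian_integrable[OF \<delta>], of "2 * pi * x" 0] by simp
  have "fourier (\<lambda>\<xi>. ?E \<xi> * cis (2 * pi * x * \<xi>)) y = fourier ?E (y - x)" for y
    unfolding fourier_def mult.assoc cis_mult by (simp add: algebra_simps)
  then have f: "fourier (\<lambda>\<xi>. ?E \<xi> * cis (2 * pi * x * \<xi>)) y = gauss \<delta> (x - y)" for y
    using fourier_gaussian[OF \<delta>] by (simp add: gauss_def power_divide power2_commute)
  have "(LINT \<xi>|lborel. fourier h \<xi> * (?E \<xi> * cis (2 * pi * x * \<xi>))) = (LINT y|lborel. h y * gauss \<delta> (x - y))"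
    using multiplication_formula[OF h i] f by simp
  also have "\<dots> = \<bar>-\<delta>\<bar> *\<^sub>R (LINT u|lborel. h (x + (-\<delta>) * u) * gauss \<delta> (x - (x + (-\<delta>) * u)))"
    by (rule lborel_integral_real_affine) (use \<delta> in auto)
  also have "\<dots> = (LINT u|lborel. \<delta> * (h (x + (-\<delta>) * u) * gauss \<delta> (x - (x + (-\<delta>) * u))))"
    using \<delta> by (simp add: scaleR_conv_of_real flip: integral_mult_right_zero)
  also have "\<dots> = (LINT u|lborel. h (x - \<delta> * u) * gauss 1 u)"
    using \<delta> by (intro Bochner_Integration.integral_cong refl) (simp add: gauss_def)
  finally show ?thesis .
qed

lemma gauss_average_tendsto:
  assumes h: "tame h"
  shows "(\<lambda>n. LINT u|lborel. h (x - inverse (real (Suc n)) * u) * gauss 1 u) \<longlonglongrightarrow> h x"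
proof -
  obtain B where B: "B \<ge> 0" "\<And>x. cmod (h x) \<le> B" using tame_bound[OF h] by auto
  have [measurable]: "h \<in> borel_measurable borel" using tame_measurable[OF h] .
  have cont: "isCont h y" for y using h by (simp add: tame_def continuous_on_eq_continuous_at)
  have "(\<lambda>n. LINT u|lborel. h (x - inverse (real (Suc n)) * u) * gauss 1 u) \<longlonglongrightarrow>
      (LINT u|lborel. h x * gauss 1 u)"
  proof (rule integral_dominated_convergence[where w="\<lambda>u. B * gauss 1 u"])
    show "integrable lborel (\<lambda>u. B * gauss 1 u)"
      using integrable_gauss1 by (intro integrable_mult_right) (simp only: complex_of_real_integrable_eq)
    show "AE u in lborel. (\<lambda>n. h (x - inverse (real (Suc n)) * u) * gauss 1 u) \<longlonglongrightarrow> h x * gauss 1 u"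
    proof (intro AE_I2 tendsto_mult tendsto_const)
      fix u
      have "(\<lambda>n. x - inverse (real (Suc n)) * u) \<longlonglongrightarrow> x - 0 * u"
        by (intro tendsto_intros LIMSEQ_inverse_real_of_nat)
      then show "(\<lambda>n. h (x - inverse (real (Suc n)) * u)) \<longlonglongrightarrow> h x"
        using isCont_tendsto_compose[OF cont] by simp
    qed
    have [measurable]: "gauss 1 \<in> borel_measurable borel" unfolding gauss_def[abs_def] by measurable
    show "(\<lambda>u. h (x - inverse (real (Suc n)) * u) * gauss 1 u) \<in> borel_measurable lborel" for n by measurable
    show "(\<lambda>u. h x * gauss 1 u) \<in> borel_measurable lborel" by measurable
    show "AE u in lborel. cmod (h (x - inverse (real (Suc n)) * u) * gauss 1 u) \<le> B * gauss 1 u" for n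
      using B by (intro AE_I2) (auto simp: norm_mult gauss_def intro!: mult_right_mono)
  qed
  then show ?thesis using integral_gauss1 by simp
qed

lemma gauss_average_bound:
  assumes h: "tame h" and B: "\<And>x. cmod (h x) \<le> B"
  shows "cmod (LINT u|lborel. h (x - \<delta> * u) * gauss 1 u) \<le> B"
proof -
  have ig: "integrable lborel (gauss 1)"
    using integrable_gauss1 by (simp add: complex_of_real_integrable_eq)
  have 1: "(LINT x|lborel. gauss 1 x) = 1" 
    using integral_gauss1 by (metis integral_complex_of_real of_real_eq_1_iff)
  have [measurable]: "h \<in> borel_measurable borel" using tame_measurable[OF h] .
  have [measurable]: "gauss 1 \<in> borel_measurable borel" unfolding gauss_def[abs_def] by measurable
  have nn: "gauss 1 u \<ge> 0" for u by (simp add: gauss_def)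
  have le: "cmod (h (x - \<delta> * u) * gauss 1 u) \<le> B * gauss 1 u" for u
    using B nn by (auto simp: norm_mult intro!: mult_right_mono)
  have "cmod (LINT u|lborel. h (x - \<delta> * u) * gauss 1 u) \<le> (LINT u|lborel. cmod (h (x - \<delta> * u) * gauss 1 u))"
    by (rule integral_norm_bound)
  also have "\<dots> \<le> (LINT u|lborel. B * gauss 1 u)"
    using ig by (intro integral_mono' integrable_mult_right le) (auto intro: order_trans[OF norm_ge_zero le])
  also have "\<dots> = B" using 1 by simp
  finally show ?thesis .
qed

text \<open>Remove the damping in the regularised formula: the averages converge by continuity,
the inversion integrals by domination.\<close>

lemma fourier_inversion:
  assumes h: "tame h" and i: "integrable lborel (fourier h)"
  shows "(LINT \<xi>|lborel. fourier h \<xi> * cis (2 * pi * x * \<xi>)) = h x"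
proof -
  have [measurable]: "h \<in> borel_measurable borel" using tame_measurable[OF h] .
  have [measurable]: "cis \<in> borel_measurable borel"
    by (intro borel_measurable_continuous_onI continuous_intros)
  have ih: "integrable lborel h" using h by (simp add: tame_def)
  let ?d = "\<lambda>n. inverse (real (Suc n))"
  have "(\<lambda>n. LINT \<xi>|lborel. fourier h \<xi> * (complex_of_real (exp (- pi * (?d n * \<xi>)\<^sup>2)) * cis (2 * pi * x * \<xi>)))
     \<longlonglongrightarrow> (LINT \<xi>|lborel. fourier h \<xi> * (complex_of_real (exp (- pi * (0 * \<xi>)\<^sup>2)) * cis (2 * pi * x * \<xi>)))"
  proof (rule integral_dominated_convergence[where w="\<lambda>\<xi>. cmod (fourier h \<xi>)"])
    show "AE \<xi> in lborel. (\<lambda>n. fourier h \<xi> * (complex_of_real (exp (- pi * (?d n * \<xi>)\<^sup>2)) * cis (2 * pi * x * \<xi>)))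
      \<longlonglongrightarrow> fourier h \<xi> * (complex_of_real (exp (- pi * (0 * \<xi>)\<^sup>2)) * cis (2 * pi * x * \<xi>))"
      by (intro AE_I2 tendsto_intros LIMSEQ_inverse_real_of_nat)
    show "integrable lborel (\<lambda>\<xi>. cmod (fourier h \<xi>))" using i by simp
  qed (auto simp: norm_mult intro!: AE_I2 mult_left_le)
  moreover have "(\<lambda>n. LINT \<xi>|lborel. fourier h \<xi> * (complex_of_real (exp (- pi * (?d n * \<xi>)\<^sup>2)) * cis (2 * pi * x * \<xi>))) \<longlonglongrightarrow> h x"
    unfolding regularised_inversion[OF ih positive_imp_inverse_positive[OF of_nat_0_less_iff[THEN iffD2, OF zero_less_Suc]]]
    by (rule gauss_average_tendsto[OF h])
  ultimately show ?thesis by (auto dest: LIMSEQ_unique)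
qed

lemma tame_square_integrable:
  assumes h: "tame h" shows "integrable lborel (\<lambda>x. (cmod (h x))\<^sup>2)"
proof -
  obtain B where B: "B \<ge> 0" "\<And>x. cmod (h x) \<le> B" using tame_bound[OF h] by auto
  have [measurable]: "h \<in> borel_measurable borel" using tame_measurable[OF h] .
  have "integrable lborel (\<lambda>x. B * cmod (h x))" using h by (simp add: tame_def)
  then show ?thesis
    by (rule Bochner_Integration.integrable_bound) (use B in \<open>auto simp: power2_eq_square mult_right_mono\<close>)
qed

text \<open>Apply the multiplication formula to \<open>h\<close> and the damped conjugate of its transform. The
transform of the latter is the conjugate of a Gaussian average of \<open>h\<close>. When the damping is removed, one
side increases to the integral of \<open>\<bar>h^\<bar>\<^sup>2\<close> and the other tends to that of \<open>\<bar>h\<bar>\<^sup>2\<close> by domination.\<close>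

lemma plancherel:
  assumes h: "tame h"
  shows "(\<integral>\<^sup>+\<xi>. ennreal ((cmod (fourier h \<xi>))\<^sup>2) \<partial>lborel) = ennreal (LINT x|lborel. (cmod (h x))\<^sup>2)"
proof -
  have [measurable]: "h \<in> borel_measurable borel" using tame_measurable[OF h] .
  have [measurable]: "cis \<in> borel_measurable borel"
    by (intro borel_measurable_continuous_onI continuous_intros)
  have ih: "integrable lborel h" using h by (simp add: tame_def)
  obtain B where B: "B \<ge> 0" "\<And>x. cmod (h x) \<le> B" using tame_bound[OF h] by auto
  have [measurable]: "cnj \<in> borel_measurable borel"
    by (intro borel_measurable_continuous_onI continuous_intros)
  let ?d = "\<lambda>n. inverse (real (Suc n))"
  let ?A = "\<lambda>n x. LINT u|lborel. h (x - ?d n * u) * gauss 1 u"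
  let ?E = "\<lambda>n \<xi>. exp (- pi * (?d n * \<xi>)\<^sup>2)"
  define I where "I = (LINT x|lborel. cmod (h x))"
  have fb: "cmod (fourier h \<xi>) \<le> I" for \<xi> unfolding I_def by (rule cmod_fourier_le)
  have I0: "I \<ge> 0" by (simp add: I_def)
  have dpos: "?d n > 0" for n by simp
  have iE: "integrable lborel (\<lambda>\<xi>. ?E n \<xi> * (cmod (fourier h \<xi>))\<^sup>2)" for n
  proof (rule Bochner_Integration.integrable_bound)
    show "integrable lborel (\<lambda>\<xi>. I\<^sup>2 * ?E n \<xi>)"
      using gaussian_integrable[OF dpos, of n] by (intro integrable_mult_right) (simp only: complex_of_real_integrable_eq)
    show "AE \<xi> in lborel. norm (?E n \<xi> * (cmod (fourier h \<xi>))\<^sup>2) \<le> norm (I\<^sup>2 * ?E n \<xi>)"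
      using fb I0 by (auto simp: mult.commute intro!: mult_right_mono power_mono)
  qed measurable
  have key: "complex_of_real (LINT \<xi>|lborel. ?E n \<xi> * (cmod (fourier h \<xi>))\<^sup>2) = (LINT x|lborel. h x * cnj (?A n x))" for n
  proof -
    let ?b = "\<lambda>\<xi>. complex_of_real (?E n \<xi>) * cnj (fourier h \<xi>)"
    have b: "integrable lborel ?b"
    proof (rule Bochner_Integration.integrable_bound)
      show "integrable lborel (\<lambda>\<xi>. I * ?E n \<xi>)"
        using gaussian_integrable[OF dpos, of n] by (intro integrable_mult_right) (simp only: complex_of_real_integrable_eq)
      show "AE \<xi> in lborel. norm (?b \<xi>) \<le> norm (I * ?E n \<xi>)"
        using fb I0 by (auto simp: norm_mult mult.commute intro!: mult_left_mono)
    qed measurable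
    have fb: "fourier ?b x = cnj (?A n x)" for x
    proof -
      have "fourier ?b x = (LINT \<xi>|lborel. cnj (fourier h \<xi> * (complex_of_real (?E n \<xi>) * cis (2 * pi * x * \<xi>))))"
        unfolding fourier_def[of ?b] by (simp add: cis_cnj mult_ac)
      also have "\<dots> = cnj (?A n x)" 
        by (subst Bochner_Integration.integral_cnj) (simp only: regularised_inversion[OF ih dpos])
      finally show ?thesis .
    qed
    have "complex_of_real (LINT \<xi>|lborel. ?E n \<xi> * (cmod (fourier h \<xi>))\<^sup>2) = (LINT \<xi>|lborel. fourier h \<xi> * ?b \<xi>)"
      unfolding integral_complex_of_real[symmetric]
    by (intro Bochner_Integration.integral_cong refl)
      (simp add: complex_norm_square mult_ac del: of_real_power)
    also have "\<dots> = (LINT x|lborel. h x * fourier ?b x)" by (rule multiplication_formula[OF ih b])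
    finally show ?thesis unfolding fb .
  qed
  have lim: "(\<lambda>n. LINT x|lborel. h x * cnj (?A n x)) \<longlonglongrightarrow> (LINT x|lborel. h x * cnj (h x))"
  proof (rule integral_dominated_convergence[where w="\<lambda>x. B * cmod (h x)"])
    have [measurable]: "gauss 1 \<in> borel_measurable borel" unfolding gauss_def[abs_def] by measurable
    show "(\<lambda>x. h x * cnj (?A n x)) \<in> borel_measurable lborel" for n by measurable
    show "integrable lborel (\<lambda>x. B * cmod (h x))" using ih by simp
    show "AE x in lborel. (\<lambda>n. h x * cnj (?A n x)) \<longlonglongrightarrow> h x * cnj (h x)"
      using gauss_average_tendsto[OF h] by (intro AE_I2 tendsto_intros) auto
    show "AE x in lborel. cmod (h x * cnj (?A n x)) \<le> B * cmod (h x)" for n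
      unfolding norm_mult complex_mod_cnj mult.commute[of B]
      by (intro AE_I2 mult_left_mono gauss_average_bound[OF h B(2)]) auto
  qed measurable
  have "(LINT x|lborel. h x * cnj (h x)) = complex_of_real (LINT x|lborel. (cmod (h x))\<^sup>2)"
    unfolding integral_complex_of_real[symmetric]
    by (simp add: complex_norm_square del: of_real_power)
  with lim key have "(\<lambda>n. complex_of_real (LINT \<xi>|lborel. ?E n \<xi> * (cmod (fourier h \<xi>))\<^sup>2)) \<longlonglongrightarrow> complex_of_real (LINT x|lborel. (cmod (h x))\<^sup>2)"
    by simp
  then have "(\<lambda>n. (LINT \<xi>|lborel. ?E n \<xi> * (cmod (fourier h \<xi>))\<^sup>2)) \<longlonglongrightarrow> (LINT x|lborel. (cmod (h x))\<^sup>2)"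
    by (simp only: tendsto_of_real_iff)
  then have 1: "(\<lambda>n. ennreal (LINT \<xi>|lborel. ?E n \<xi> * (cmod (fourier h \<xi>))\<^sup>2)) \<longlonglongrightarrow> ennreal (LINT x|lborel. (cmod (h x))\<^sup>2)"
    by (rule tendsto_ennrealI)
  have 2: "(\<lambda>n. \<integral>\<^sup>+\<xi>. ennreal (?E n \<xi> * (cmod (fourier h \<xi>))\<^sup>2) \<partial>lborel) \<longlonglongrightarrow> (\<integral>\<^sup>+\<xi>. ennreal ((cmod (fourier h \<xi>))\<^sup>2) \<partial>lborel)"
  proof (rule nn_integral_LIMSEQ)
    show "incseq (\<lambda>n \<xi>. ennreal (?E n \<xi> * (cmod (fourier h \<xi>))\<^sup>2))"
      by (auto simp: incseq_def le_fun_def power_mult_distrib intro!: ennreal_leI mult_right_mono power_mono le_imp_inverse_le)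
    show "(\<lambda>n. ennreal (?E n \<xi> * (cmod (fourier h \<xi>))\<^sup>2)) \<longlonglongrightarrow> ennreal ((cmod (fourier h \<xi>))\<^sup>2)" for \<xi>
    proof (rule tendsto_ennrealI)
      have "(\<lambda>n. ?E n \<xi> * (cmod (fourier h \<xi>))\<^sup>2) \<longlonglongrightarrow> exp (- pi * (0 * \<xi>)\<^sup>2) * (cmod (fourier h \<xi>))\<^sup>2"
        by (intro tendsto_intros LIMSEQ_inverse_real_of_nat)
      then show "(\<lambda>n. ?E n \<xi> * (cmod (fourier h \<xi>))\<^sup>2) \<longlonglongrightarrow> (cmod (fourier h \<xi>))\<^sup>2" by simp
    qed
  qed measurable
  have "(\<integral>\<^sup>+\<xi>. ennreal (?E n \<xi> * (cmod (fourier h \<xi>))\<^sup>2) \<partial>lborel) = ennreal (LINT \<xi>|lborel. ?E n \<xi> * (cmod (fourier h \<xi>))\<^sup>2)" for n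
    by (rule nn_integral_eq_integral[OF iE]) auto
  with 1 2 show ?thesis by (auto dest: LIMSEQ_unique)
qed

section \<open>The quadratic norm and convolution\<close>

definition l2 :: "(real \<Rightarrow> complex) \<Rightarrow> real" where
  "l2 h = sqrt (LINT x|lborel. (cmod (h x))\<^sup>2)"

lemma l2_nonneg [simp]: "l2 h \<ge> 0"
  by (simp add: l2_def)

lemma l2_sq: "(l2 h)\<^sup>2 = (LINT x|lborel. (cmod (h x))\<^sup>2)"
  by (simp add: l2_def)

lemma L2_norm_sq_tame: "tame h \<Longrightarrow> L2_norm_sq h = ennreal ((l2 h)\<^sup>2)"
  unfolding L2_norm_sq_def l2_sq
  by (intro nn_integral_eq_integral tame_square_integrable) auto

lemma plancherel_l2:
  "tame h \<Longrightarrow> (\<integral>\<^sup>+\<xi>. ennreal ((cmod (fourier h \<xi>))\<^sup>2) \<partial>lborel) = ennreal ((l2 h)\<^sup>2)"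
  by (simp add: plancherel l2_sq)

lemma l2_mono:
  assumes "tame f" "tame g" "\<And>x. cmod (f x) \<le> cmod (g x)"
  shows "l2 f \<le> l2 g"
  unfolding l2_def using assms
  by (intro real_sqrt_le_mono integral_mono tame_square_integrable power_mono) auto

lemma l2_cong_norm:
  assumes "\<And>x. cmod (f x) = cmod (g x)"
  shows "l2 f = l2 g"
  unfolding l2_def using assms by simp

lemma tame_cont_at: "tame f \<Longrightarrow> isCont f x"
  by (simp add: tame_def continuous_on_eq_continuous_at)

lemma tame_integrable: "tame f \<Longrightarrow> integrable lborel f"
  by (simp add: tame_def)

lemma tame_add: "tame f \<Longrightarrow> tame g \<Longrightarrow> tame (\<lambda>x. f x + g x)"
  unfolding tame_def by (auto intro!: continuous_intros bounded_plus_comp)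

lemma tame_diff: "tame f \<Longrightarrow> tame g \<Longrightarrow> tame (\<lambda>x. f x - g x)"
  unfolding tame_def by (auto intro!: continuous_intros bounded_minus_comp)

lemma tame_mult_bounded:
  assumes f: "tame f" and g: "continuous_on UNIV g" "\<And>x. cmod (g x) \<le> C"
  shows "tame (\<lambda>x. f x * g x)"
proof -
  obtain B where B: "B \<ge> 0" "\<And>x. cmod (f x) \<le> B" using tame_bound[OF f] by auto
  have [measurable]: "f \<in> borel_measurable borel" using tame_measurable[OF f] .
  have [measurable]: "g \<in> borel_measurable borel" using g(1) by (rule borel_measurable_continuous_onI)
  have C: "C \<ge> 0" using g(2)[of 0] norm_ge_zero order_trans by blast
  have "integrable lborel (\<lambda>x. f x * g x)"
  proof (rule Bochner_Integration.integrable_bound)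
    show "integrable lborel (\<lambda>x. C * cmod (f x))" using f by (simp add: tame_def)
    show "AE x in lborel. norm (f x * g x) \<le> norm (C * cmod (f x))"
      using g(2) C by (intro AE_I2) (simp add: norm_mult mult.commute[of C] mult_left_mono)
  qed measurable
  moreover have "bounded (range (\<lambda>x. f x * g x))"
    unfolding bounded_iff using B C g(2)
    by (intro exI[of _ "B * C"]) (auto simp: norm_mult intro!: mult_mono)
  ultimately show ?thesis using f g unfolding tame_def by (auto intro!: continuous_intros)
qed

lemma tame_mult: "tame f \<Longrightarrow> tame g \<Longrightarrow> tame (\<lambda>x. f x * g x)"
  using tame_mult_bounded[of f g] tame_bound[of g] unfolding tame_def[of g] by blast

lemma tame_cis: "tame f \<Longrightarrow> tame (\<lambda>x. f x * cis (a * x))"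
  by (rule tame_mult_bounded[where C=1]) (auto intro!: continuous_intros)

lemma tame_cmult: "tame f \<Longrightarrow> tame (\<lambda>x. c * f x)"
  using tame_mult_bounded[of f "\<lambda>_. c" "cmod c"] by (simp add: mult.commute)

lemma tame_modulus: "tame f \<Longrightarrow> tame (\<lambda>x. complex_of_real (cmod (f x)))"
  unfolding tame_def
  by (auto intro!: continuous_intros simp: bounded_iff)

lemma tame_affine:
  assumes f: "tame f" and c: "c \<noteq> 0"
  shows "tame (\<lambda>x. f (t + c * x))"
proof -
  have "continuous_on UNIV (\<lambda>x. f (t + c * x))"
    by (rule continuous_on_compose2[of UNIV f]) (use f in \<open>simp_all add: tame_def, intro continuous_intros\<close>)
  moreover have "bounded (range (\<lambda>x. f (t + c * x)))"
    by (rule bounded_subset[of "range f"]) (use f in \<open>auto simp: tame_def\<close>)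
  ultimately show ?thesis using f c
    unfolding tame_def by (auto intro: integrable_lborel_affine)
qed

text \<open>Minkowski's inequality, from \<open>\<bar>a + b\<bar>\<^sup>2 \<le> (1 + t) \<bar>a\<bar>\<^sup>2 + (1 + 1 / t) \<bar>b\<bar>\<^sup>2\<close> integrated and
optimised over \<open>t > 0\<close>.\<close>

lemma l2_triangle:
  assumes f: "tame f" and g: "tame g"
  shows "l2 (\<lambda>x. f x + g x) \<le> l2 f + l2 g"
proof -
  have pw: "(cmod (a + b))\<^sup>2 \<le> (1 + t) * (cmod a)\<^sup>2 + (1 + 1 / t) * (cmod b)\<^sup>2" if t: "t > 0" for a b t
  proof -
    have "(cmod (a + b))\<^sup>2 \<le> (cmod a + cmod b)\<^sup>2" by (intro power_mono norm_triangle_ineq) auto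
    also have "\<dots> \<le> (cmod a + cmod b)\<^sup>2 + (t * cmod a - cmod b)\<^sup>2 / t" using t by simp
    also have "\<dots> = (1 + t) * (cmod a)\<^sup>2 + (1 + 1 / t) * (cmod b)\<^sup>2"
      using t by (simp add: field_simps power2_eq_square)
    finally show ?thesis .
  qed
  have main: "(l2 (\<lambda>x. f x + g x))\<^sup>2 \<le> (1 + t) * (l2 f)\<^sup>2 + (1 + 1 / t) * (l2 g)\<^sup>2" if t: "t > 0" for t
  proof -
    have "(LINT x|lborel. (cmod (f x + g x))\<^sup>2) \<le> (LINT x|lborel. (1 + t) * (cmod (f x))\<^sup>2 + (1 + 1 / t) * (cmod (g x))\<^sup>2)"
      by (intro integral_mono pw t Bochner_Integration.integrable_add integrable_mult_right
          tame_square_integrable tame_add f g)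
    also have "\<dots> = (1 + t) * (l2 f)\<^sup>2 + (1 + 1 / t) * (l2 g)\<^sup>2"
      unfolding l2_sq
      by (subst Bochner_Integration.integral_add)
        (auto intro!: integrable_mult_right tame_square_integrable f g)
    finally show ?thesis by (simp add: l2_sq)
  qed
  show ?thesis
  proof (rule field_le_epsilon)
    fix e :: real assume e: "e > 0"
    \<comment> \<open>The optimal \<open>t\<close> is the quotient of the norms; enlarging both by \<open>e / 2\<close> makes it meaningful when one of them is \<open>0\<close>.\<close>
    define a b where "a = l2 f + e / 2" and "b = l2 g + e / 2"
    have ab: "a > 0" "b > 0" "l2 f \<le> a" "l2 g \<le> b" using e by (auto simp: a_def b_def add_nonneg_pos)
    have "(l2 (\<lambda>x. f x + g x))\<^sup>2 \<le> (1 + b / a) * (l2 f)\<^sup>2 + (1 + 1 / (b / a)) * (l2 g)\<^sup>2"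
      using ab by (intro main) auto
    also have "\<dots> \<le> (1 + b / a) * a\<^sup>2 + (1 + 1 / (b / a)) * b\<^sup>2"
      using ab by (intro add_mono mult_left_mono power_mono) auto
    also have "\<dots> = (a + b)\<^sup>2" using ab by (simp add: field_simps power2_eq_square)
    finally have "l2 (\<lambda>x. f x + g x) \<le> a + b"
      by (rule power2_le_imp_le) (use ab in auto)
    then show "l2 (\<lambda>x. f x + g x) \<le> l2 f + l2 g + e" by (simp add: a_def b_def)
  qed
qed

lemma l2_diff_triangle:
  assumes "tame f" "tame g" "tame h"
  shows "l2 (\<lambda>x. f x - h x) \<le> l2 (\<lambda>x. f x - g x) + l2 (\<lambda>x. g x - h x)"
  using l2_triangle[OF tame_diff[OF assms(1,2)] tame_diff[OF assms(2,3)]] by simp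

lemma l2_ge_diff:
  assumes "tame f" "tame g"
  shows "l2 g - l2 (\<lambda>x. f x - g x) \<le> l2 f"
proof -
  have "l2 (\<lambda>x. f x + (g x - f x)) \<le> l2 f + l2 (\<lambda>x. g x - f x)"
    by (intro l2_triangle tame_diff assms)
  moreover have "l2 (\<lambda>x. g x - f x) = l2 (\<lambda>x. f x - g x)"
    by (rule l2_cong_norm) (rule norm_minus_commute)
  ultimately show ?thesis by simp
qed

lemma convolution_pair_integrable:
  assumes f: "integrable lborel f" and g: "integrable lborel g"
  shows "integrable (lborel \<Otimes>\<^sub>M lborel) (\<lambda>(y, x :: real). f y * g (x - y) :: complex)"
proof -
  have [measurable]: "f \<in> borel_measurable borel" "g \<in> borel_measurable borel"
    using f g by auto
  have shift: "(LINT x|lborel. cmod (g (x - y))) = (LINT x|lborel. cmod (g x))" for y :: real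
    using lborel_integral_real_affine[of 1 "\<lambda>x. cmod (g x)" "-y"] by simp
  show ?thesis
  proof (rule lborel_pair.Fubini_integrable)
    show "integrable lborel (\<lambda>y. LINT x|lborel. norm (case (y, x) of (y, x) \<Rightarrow> f y * g (x - y)))"
      using f by (simp add: norm_mult shift)
    show "AE y in lborel. integrable lborel (\<lambda>x. case (y, x) of (y, x) \<Rightarrow> f y * g (x - y))"
      using integrable_lborel_affine[OF g, of 1 "- y" for y] by (intro AE_I2) (simp add: algebra_simps)
  qed measurable
qed

lemma tame_convolution:
  assumes f: "tame f" and g: "tame g"
  shows "tame (convolution f g)"
proof -
  have [measurable]: "f \<in> borel_measurable borel" "g \<in> borel_measurable borel"
    using f g tame_measurable by auto
  obtain B where B: "B \<ge> 0" "\<And>x. cmod (g x) \<le> B" using tame_bound[OF g] by auto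
  have dom: "integrable lborel (\<lambda>y. B * cmod (f y))" using f by (simp add: tame_def)
  have le: "cmod (f y * g (x - y)) \<le> B * cmod (f y)" for x y
    using B by (simp add: norm_mult mult.commute[of B] mult_left_mono)
  have "integrable lborel (convolution f g)"
    using lborel_pair.integrable_fst'[OF lborel_pair.integrable_product_swap[OF convolution_pair_integrable[OF tame_integrable[OF f] tame_integrable[OF g]]]]
    by (simp add: convolution_def[abs_def])
  moreover have "cmod (convolution f g x) \<le> (LINT y|lborel. B * cmod (f y))" for x
    unfolding convolution_def
    by (rule order_trans[OF integral_norm_bound]) (intro integral_mono' dom le, use B in auto)
  then have "bounded (range (convolution f g))" by (auto simp: bounded_iff)
  moreover have "isCont (convolution f g) x" for x
  proof (rule continuous_at_sequentiallyI)
    fix u assume u: "u \<longlonglongrightarrow> x"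
    show "(\<lambda>n. convolution f g (u n)) \<longlonglongrightarrow> convolution f g x"
      unfolding convolution_def
    proof (rule integral_dominated_convergence[OF _ _ dom])
      show "AE y in lborel. (\<lambda>n. f y * g (u n - y)) \<longlonglongrightarrow> f y * g (x - y)"
        by (intro AE_I2 tendsto_mult tendsto_const isCont_tendsto_compose[OF tame_cont_at[OF g]]
            tendsto_diff u)
    qed (use le in \<open>measurable, auto\<close>)
  qed
  ultimately show ?thesis unfolding tame_def by (simp add: continuous_at_imp_continuous_on)
qed

lemma fourier_convolution:
  assumes f: "integrable lborel f" and g: "integrable lborel g"
  shows "fourier (convolution f g) \<xi> = fourier f \<xi> * fourier g \<xi>"
proof -
  have [measurable]: "f \<in> borel_measurable borel" "g \<in> borel_measurable borel"
    using f g by auto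
  have [measurable]: "cis \<in> borel_measurable borel"
    by (intro borel_measurable_continuous_onI continuous_intros)
  let ?F = "\<lambda>(y, x). f y * g (x - y) * cis (- 2 * pi * \<xi> * x)"
  have I: "integrable (lborel \<Otimes>\<^sub>M lborel) ?F"
    by (rule Bochner_Integration.integrable_bound[OF convolution_pair_integrable[OF f g]])
      (measurable, auto simp: norm_mult)
  have "fourier (convolution f g) \<xi> = (LINT x|lborel. LINT y|lborel. ?F (y, x))"
    unfolding fourier_def convolution_def by (simp flip: integral_mult_left_zero)
  also have "\<dots> = (LINT y|lborel. LINT x|lborel. ?F (y, x))"
    using lborel_pair.Fubini_integral[of "\<lambda>y x. ?F (y, x)"] I by (simp add: case_prod_unfold)
  also have "\<dots> = (LINT y|lborel. f y * cis (- 2 * pi * \<xi> * y) * fourier g \<xi>)"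
  proof (intro Bochner_Integration.integral_cong refl)
    fix y
    have "(LINT x|lborel. ?F (y, x)) = (LINT z|lborel. ?F (y, y + 1 * z))"
      using lborel_integral_real_affine[of 1 "\<lambda>x. ?F (y, x)" y] by simp
    also have "\<dots> = (LINT z|lborel. f y * cis (- 2 * pi * \<xi> * y) * (g z * cis (- 2 * pi * \<xi> * z)))"
    proof (intro Bochner_Integration.integral_cong refl)
      fix z
      have "cis (- 2 * pi * \<xi> * (y + 1 * z)) = cis (- 2 * pi * \<xi> * y) * cis (- 2 * pi * \<xi> * z)"
        unfolding cis_mult by (simp add: algebra_simps)
      then show "?F (y, y + 1 * z) = f y * cis (- 2 * pi * \<xi> * y) * (g z * cis (- 2 * pi * \<xi> * z))"
        by simp
    qed
    also have "\<dots> = f y * cis (- 2 * pi * \<xi> * y) * fourier g \<xi>"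
      unfolding fourier_def by (rule integral_mult_right_zero)
    finally show "(LINT x|lborel. ?F (y, x)) = f y * cis (- 2 * pi * \<xi> * y) * fourier g \<xi>" .
  qed
  also have "\<dots> = fourier f \<xi> * fourier g \<xi>"
    unfolding fourier_def by (rule integral_mult_left_zero)
  finally show ?thesis .
qed

lemma fourier_diff:
  assumes "integrable lborel f" "integrable lborel g"
  shows "fourier (\<lambda>x. f x - g x) \<xi> = fourier f \<xi> - fourier g \<xi>"
  unfolding fourier_def left_diff_distrib
  by (rule Bochner_Integration.integral_diff) (intro integrable_fourier_kernel assms)+

lemma fourier_cmult: "fourier (\<lambda>x. c * f x) \<xi> = c * fourier f \<xi>"
  unfolding fourier_def by (simp add: mult.assoc)

lemma fourier_convolution_diff:
  assumes "tame u" "tame p" "tame h"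
  shows "fourier (\<lambda>x. convolution u p x - h x) \<xi> = fourier u \<xi> * fourier p \<xi> - fourier h \<xi>"
  using fourier_diff[OF tame_integrable[OF tame_convolution[OF assms(1,2)]] tame_integrable[OF assms(3)]]
  by (simp add: fourier_convolution tame_integrable assms)

lemma convolution_diff:
  assumes f: "tame f" and g: "tame g" and p: "tame p"
  shows "convolution (\<lambda>x. f x - g x) p x = convolution f p x - convolution g p x"
proof -
  have *: "integrable lborel (\<lambda>y. h y * p (x - y))" if "tame h" for h
  proof -
    have "tame (\<lambda>y. p (x - y))" using tame_affine[OF p, of "-1" x] by simp
    with that show ?thesis by (intro tame_integrable tame_mult)
  qed
  show ?thesis unfolding convolution_def
    by (subst Bochner_Integration.integral_diff[symmetric]) (use * f g in \<open>auto simp: algebra_simps\<close>)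
qed

lemma l2_le_fourierI:
  assumes "tame h" "c \<ge> 0" "(\<integral>\<^sup>+\<xi>. ennreal ((cmod (fourier h \<xi>))\<^sup>2) \<partial>lborel) \<le> ennreal (c\<^sup>2)"
  shows "l2 h \<le> c"
  using assms by (simp add: plancherel_l2)

section \<open>Scattering is nonexpansive\<close>

lemma tame_U1: "tame f \<Longrightarrow> tame (\<psi> l) \<Longrightarrow> tame (U1 \<psi> l f)"
  unfolding U1_def by (intro tame_modulus tame_convolution)

lemma l2_U1: "l2 (U1 \<psi> l f) = l2 (convolution f (\<psi> l))"
  by (rule l2_cong_norm) (simp add: U1_def)

lemma tame_U_path: "tame f \<Longrightarrow> (\<And>l. tame (\<psi> l)) \<Longrightarrow> tame (U_path \<psi> p f)"
  by (induction p arbitrary: f) (auto intro: tame_U1)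

lemma l2_U1_diff_le_convolution:
  assumes f: "tame f" and g: "tame g" and p: "tame (\<psi> l)"
  shows "l2 (\<lambda>x. U1 \<psi> l f x - U1 \<psi> l g x) \<le> l2 (\<lambda>x. convolution f (\<psi> l) x - convolution g (\<psi> l) x)"
proof (rule l2_mono)
  show "cmod (U1 \<psi> l f x - U1 \<psi> l g x) \<le> cmod (convolution f (\<psi> l) x - convolution g (\<psi> l) x)" for x
    unfolding U1_def of_real_diff[symmetric] norm_of_real by (rule norm_triangle_ineq3)
qed (intro tame_diff tame_convolution tame_U1 assms)+

text \<open>The modulus is \<open>1\<close>-Lipschitz, and convolution with the filter multiplies the
transform of \<open>f - g\<close> by a factor of modulus at most \<open>1\<close>.\<close>

lemma l2_U1_nonexpansive:
  assumes f: "tame f" and g: "tame g" and p: "tame (\<psi> l)" and 1: "\<And>\<xi>. cmod (fourier (\<psi> l) \<xi>) \<le> 1"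
  shows "l2 (\<lambda>x. U1 \<psi> l f x - U1 \<psi> l g x) \<le> l2 (\<lambda>x. f x - g x)"
proof -
  let ?d = "\<lambda>x. f x - g x"
  have d: "tame ?d" by (intro tame_diff f g)
  have "l2 (convolution ?d (\<psi> l)) \<le> l2 ?d"
  proof (rule l2_le_fourierI)
    have "(\<integral>\<^sup>+\<xi>. ennreal ((cmod (fourier (convolution ?d (\<psi> l)) \<xi>))\<^sup>2) \<partial>lborel) \<le> (\<integral>\<^sup>+\<xi>. ennreal ((cmod (fourier ?d \<xi>))\<^sup>2) \<partial>lborel)"
      using 1 by (intro nn_integral_mono ennreal_leI power_mono)
        (auto simp: fourier_convolution tame_integrable d p norm_mult mult_left_le)
    then show "(\<integral>\<^sup>+\<xi>. ennreal ((cmod (fourier (convolution ?d (\<psi> l)) \<xi>))\<^sup>2) \<partial>lborel) \<le> ennreal ((l2 ?d)\<^sup>2)"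
      by (simp only: plancherel_l2[OF d])
  qed (intro tame_convolution d p, simp)
  also have "convolution ?d (\<psi> l) = (\<lambda>x. convolution f (\<psi> l) x - convolution g (\<psi> l) x)"
    by (rule ext) (rule convolution_diff[OF f g p])
  finally show ?thesis using l2_U1_diff_le_convolution[of f g \<psi> l, OF f g p] by simp
qed

text \<open>The Bessel inequality of the filter bank, read off in frequency with the Plancherel
identity.\<close>

lemma sum_l2_U1_le:
  assumes f: "tame f" and p: "\<And>l. tame (\<psi> l)" and A: "finite A"
    and 1: "\<And>\<xi>. (\<Sum>l\<in>A. (cmod (fourier (\<psi> l) \<xi>))\<^sup>2) \<le> 1"
  shows "(\<Sum>l\<in>A. (l2 (U1 \<psi> l f))\<^sup>2) \<le> (l2 f)\<^sup>2"
proof -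
  have [measurable]: "f \<in> borel_measurable borel" "\<And>l. \<psi> l \<in> borel_measurable borel"
    using f p tame_measurable by auto
  have "ennreal (\<Sum>l\<in>A. (l2 (U1 \<psi> l f))\<^sup>2) = (\<Sum>l\<in>A. ennreal ((l2 (convolution f (\<psi> l)))\<^sup>2))"
    by (simp add: l2_U1 sum_ennreal)
  also have "\<dots> = (\<Sum>l\<in>A. \<integral>\<^sup>+\<xi>. ennreal ((cmod (fourier f \<xi>))\<^sup>2 * (cmod (fourier (\<psi> l) \<xi>))\<^sup>2) \<partial>lborel)"
    by (simp add: plancherel_l2[symmetric] tame_convolution f p fourier_convolution tame_integrable
      norm_mult power_mult_distrib)
  also have "\<dots> = (\<integral>\<^sup>+\<xi>. (\<Sum>l\<in>A. ennreal ((cmod (fourier f \<xi>))\<^sup>2 * (cmod (fourier (\<psi> l) \<xi>))\<^sup>2)) \<partial>lborel)"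
    by (rule nn_integral_sum[symmetric]) measurable
  also have "\<dots> \<le> (\<integral>\<^sup>+\<xi>. ennreal ((cmod (fourier f \<xi>))\<^sup>2) \<partial>lborel)"
  proof (rule nn_integral_mono)
    fix \<xi>
    have "(\<Sum>l\<in>A. ennreal ((cmod (fourier f \<xi>))\<^sup>2 * (cmod (fourier (\<psi> l) \<xi>))\<^sup>2)) 
      = ennreal ((cmod (fourier f \<xi>))\<^sup>2 * (\<Sum>l\<in>A. (cmod (fourier (\<psi> l) \<xi>))\<^sup>2))"
      by (simp add: sum_ennreal sum_distrib_left)
    also have "\<dots> \<le> ennreal ((cmod (fourier f \<xi>))\<^sup>2)"
      by (intro ennreal_leI mult_left_le 1) auto
    finally show "(\<Sum>l\<in>A. ennreal ((cmod (fourier f \<xi>))\<^sup>2 * (cmod (fourier (\<psi> l) \<xi>))\<^sup>2)) \<le> ennreal ((cmod (fourier f \<xi>))\<^sup>2)" .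
  qed
  also have "\<dots> = ennreal ((l2 f)\<^sup>2)" by (rule plancherel_l2[OF f])
  finally show ?thesis by (simp add: ennreal_le_iff)
qed

lemma sum_l2_U_path_le:
  assumes p: "\<And>l. tame (\<psi> l)" and A: "finite A"
    and 1: "\<And>\<xi>. (\<Sum>l\<in>A. (cmod (fourier (\<psi> l) \<xi>))\<^sup>2) \<le> 1"
  shows "tame f \<Longrightarrow> (\<Sum>q | set q \<subseteq> A \<and> length q = N. (l2 (U_path \<psi> q f))\<^sup>2) \<le> (l2 f)\<^sup>2"
proof (induction N arbitrary: f)
  case 0
  have "{q. set q \<subseteq> A \<and> length q = 0} = {[]}" by auto
  then show ?case by simp
next
  case (Suc N)
  let ?L = "{q. set q \<subseteq> A \<and> length q = N}"
  have inj: "inj_on (\<lambda>(q, l). l # q) (?L \<times> A)" by (auto simp: inj_on_def)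
  have "(\<Sum>q | set q \<subseteq> A \<and> length q = Suc N. (l2 (U_path \<psi> q f))\<^sup>2)
      = (\<Sum>(q, l) \<in> ?L \<times> A. (l2 (U_path \<psi> q (U1 \<psi> l f)))\<^sup>2)"
    unfolding lists_length_Suc_eq by (subst sum.reindex[OF inj]) (simp add: case_prod_unfold)
  also have "\<dots> = (\<Sum>l\<in>A. \<Sum>q\<in>?L. (l2 (U_path \<psi> q (U1 \<psi> l f)))\<^sup>2)"
    by (subst sum.cartesian_product[symmetric]) (rule sum.swap)
  also have "\<dots> \<le> (\<Sum>l\<in>A. (l2 (U1 \<psi> l f))\<^sup>2)"
    by (intro sum_mono Suc.IH tame_U1 Suc.prems p)
  also have "\<dots> \<le> (l2 f)\<^sup>2" by (rule sum_l2_U1_le[OF Suc.prems p A 1])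
  finally show ?case .
qed

lemma ennreal_powr_mono: "a \<ge> 0 \<Longrightarrow> s \<le> t \<Longrightarrow> ennreal_powr s a \<le> ennreal_powr t a"
  unfolding ennreal_powr_def
  by (auto simp: top_unique less_top intro!: ennreal_leI powr_mono2 enn2real_mono)

lemma ennreal_powr_ennreal: "x \<ge> 0 \<Longrightarrow> ennreal_powr (ennreal x) a = ennreal (x powr a)"
  unfolding ennreal_powr_def by simp

text \<open>The infinite sum over paths is a supremum of finite sums, each of which involves finitely many
filters only.\<close>

lemma U_norm_le:
  fixes \<psi> :: "nat \<Rightarrow> real \<Rightarrow> complex"
  assumes f: "tame f" and p: "\<And>l. tame (\<psi> l)"
    and 1: "\<And>n \<xi>. (\<Sum>l<n. (cmod (fourier (\<psi> l) \<xi>))\<^sup>2) \<le> 1"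
  shows "U_norm UNIV \<psi> N f \<le> ennreal (l2 f)"
proof -
  have "(\<Sum>\<^sub>\<infinity>q\<in>{q. set q \<subseteq> UNIV \<and> length q = N}. L2_norm_sq (U_path \<psi> q f)) \<le> ennreal ((l2 f)\<^sup>2)"
  proof (subst nonneg_infsum_complete)
    show "(SUP F\<in>{F. finite F \<and> F \<subseteq> {q. set q \<subseteq> UNIV \<and> length q = N}}. \<Sum>q\<in>F. L2_norm_sq (U_path \<psi> q f)) \<le> ennreal ((l2 f)\<^sup>2)"
    proof (rule SUP_least, clarify)
      fix F :: "nat list set" assume F: "finite F" "F \<subseteq> {q. set q \<subseteq> UNIV \<and> length q = N}"
      have "finite (\<Union>q\<in>F. set q)" using F by auto
      then obtain n where n: "(\<Union>q\<in>F. set q) \<subseteq> {..<n}"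
        by (meson finite_nat_iff_bounded)
      have sub: "F \<subseteq> {q. set q \<subseteq> {..<n} \<and> length q = N}" using F n by auto
      have "(\<Sum>q\<in>F. L2_norm_sq (U_path \<psi> q f)) = ennreal (\<Sum>q\<in>F. (l2 (U_path \<psi> q f))\<^sup>2)"
        by (simp add: L2_norm_sq_tame tame_U_path f p sum_ennreal)
      also have "\<dots> \<le> ennreal (\<Sum>q | set q \<subseteq> {..<n} \<and> length q = N. (l2 (U_path \<psi> q f))\<^sup>2)"
        by (intro ennreal_leI sum_mono2 sub finite_lists_length_eq) auto
      also have "\<dots> \<le> ennreal ((l2 f)\<^sup>2)"
        by (intro ennreal_leI sum_l2_U_path_le p 1 f) auto
      finally show "(\<Sum>q\<in>F. L2_norm_sq (U_path \<psi> q f)) \<le> ennreal ((l2 f)\<^sup>2)" .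
    qed
  qed simp
  then have "U_norm UNIV \<psi> N f \<le> ennreal_powr (ennreal ((l2 f)\<^sup>2)) (1 / 2)"
    unfolding U_norm_def by (intro ennreal_powr_mono) auto
  also have "\<dots> = ennreal (l2 f)"
    by (simp add: ennreal_powr_ennreal powr_half_sqrt)
  finally show ?thesis .
qed

lemma U_norm_ge:
  fixes \<psi> :: "nat \<Rightarrow> real \<Rightarrow> complex"
  assumes f: "tame f" and p: "\<And>l. tame (\<psi> l)" and q: "length q = N"
  shows "ennreal (l2 (U_path \<psi> q f)) \<le> U_norm UNIV \<psi> N f"
proof -
  have "L2_norm_sq (U_path \<psi> q f) \<le> (\<Sum>\<^sub>\<infinity>q\<in>{q. set q \<subseteq> UNIV \<and> length q = N}. L2_norm_sq (U_path \<psi> q f))"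
  proof (subst nonneg_infsum_complete)
    show "L2_norm_sq (U_path \<psi> q f) \<le> (SUP F\<in>{F. finite F \<and> F \<subseteq> {q. set q \<subseteq> UNIV \<and> length q = N}}. \<Sum>q\<in>F. L2_norm_sq (U_path \<psi> q f))"
      by (rule SUP_upper2[of "{q}"]) (use q in auto)
  qed simp
  then have "ennreal_powr (L2_norm_sq (U_path \<psi> q f)) (1 / 2) \<le> U_norm UNIV \<psi> N f"
    unfolding U_norm_def by (intro ennreal_powr_mono) auto
  moreover have "ennreal_powr (L2_norm_sq (U_path \<psi> q f)) (1 / 2) = ennreal (l2 (U_path \<psi> q f))"
    by (simp add: L2_norm_sq_tame tame_U_path f p ennreal_powr_ennreal powr_half_sqrt)
  ultimately show ?thesis by simp
qed

section \<open>Smooth functions and a smooth partition of frequencies\<close>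

text \<open>The property \<open>Q\<close> is required of the function and of its first \<open>n\<close> derivatives. With the
trivial property this expresses smoothness, with rapid decay the Schwartz condition, so that stability
under products needs a single proof.\<close>

primrec derivs_in :: "((real \<Rightarrow> 'a::real_normed_field) \<Rightarrow> bool) \<Rightarrow> nat \<Rightarrow> (real \<Rightarrow> 'a) \<Rightarrow> bool" where
  "derivs_in Q 0 f \<longleftrightarrow> Q f"
| "derivs_in Q (Suc n) f \<longleftrightarrow> Q f \<and> (\<exists>f'. (\<forall>x. (f has_vector_derivative f' x) (at x)) \<and> derivs_in Q n f')"

lemma derivs_in_SucD: "derivs_in Q (Suc n) f \<Longrightarrow> derivs_in Q n f"
  by (induction n arbitrary: f) auto

lemma derivs_in_SucI:
  "Q f \<Longrightarrow> (\<And>x. (f has_vector_derivative f' x) (at x)) \<Longrightarrow> derivs_in Q n f' \<Longrightarrow> derivs_in Q (Suc n) f"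
  by auto

lemma derivs_in_add:
  assumes Q: "\<And>f g. Q f \<Longrightarrow> Q g \<Longrightarrow> Q (\<lambda>x. f x + g x)"
  shows "derivs_in Q n f \<Longrightarrow> derivs_in Q n g \<Longrightarrow> derivs_in Q n (\<lambda>x. f x + g x)"
proof (induction n arbitrary: f g)
  case (Suc n)
  then obtain f' g' where "\<forall>x. (f has_vector_derivative f' x) (at x)" "derivs_in Q n f'"
    "\<forall>x. (g has_vector_derivative g' x) (at x)" "derivs_in Q n g'" by auto
  with Suc show ?case
    by (auto intro!: Q exI[of _ "\<lambda>x. f' x + g' x"] has_vector_derivative_add)
qed (auto intro: Q)

lemma derivs_in_mult:
  assumes add: "\<And>f g. Q f \<Longrightarrow> Q g \<Longrightarrow> Q (\<lambda>x. f x + g x)"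
    and mult: "\<And>f g. Q f \<Longrightarrow> Q g \<Longrightarrow> Q (\<lambda>x. f x * g x)"
  shows "derivs_in Q n f \<Longrightarrow> derivs_in Q n g \<Longrightarrow> derivs_in Q n (\<lambda>x. f x * g x)"
proof (induction n arbitrary: f g)
  case (Suc n)
  then obtain f' g' where f': "\<forall>x. (f has_vector_derivative f' x) (at x)" "derivs_in Q n f'"
    and g': "\<forall>x. (g has_vector_derivative g' x) (at x)" "derivs_in Q n g'" by auto
  have "derivs_in Q n (\<lambda>x. f x * g' x + f' x * g x)"
    by (intro derivs_in_add add Suc.IH f' g' Suc.prems[THEN derivs_in_SucD])
  moreover have "Q (\<lambda>x. f x * g x)" using Suc.prems by (intro mult) auto
  ultimately show ?case using f' g'
    by (auto intro!: exI[of _ "\<lambda>x. f x * g' x + f' x * g x"] has_vector_derivative_mult)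
qed (auto intro: mult)

definition smooth :: "(real \<Rightarrow> 'a::real_normed_field) \<Rightarrow> bool" where
  "smooth f \<longleftrightarrow> (\<forall>n. derivs_in (\<lambda>_. True) n f)"

text \<open>The derivatives of all orders belong to one function because a derivative is unique.\<close>

lemma smooth_deriv:
  assumes "smooth f"
  obtains f' where "\<And>x. (f has_vector_derivative f' x) (at x)" "smooth f'"
proof -
  have ex: "\<exists>f'. (\<forall>x. (f has_vector_derivative f' x) (at x)) \<and> derivs_in (\<lambda>_. True) n f'" for n
    using assms unfolding smooth_def by (metis derivs_in.simps(2))
  then obtain f' where f': "\<And>x. (f has_vector_derivative f' x) (at x)" by blast
  have "derivs_in (\<lambda>_. True) n f'" for n
  proof -
    obtain g where g: "\<forall>x. (f has_vector_derivative g x) (at x)" "derivs_in (\<lambda>_. True) n g"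
      using ex by blast
    then have "g = f'" using f' by (auto intro!: ext intro: vector_derivative_unique_at)
    with g show ?thesis by simp
  qed
  with f' show ?thesis using that unfolding smooth_def by blast
qed

lemma smooth_coinduct:
  assumes base: "P f" and step: "\<And>f. P f \<Longrightarrow> \<exists>f'. (\<forall>x. (f has_vector_derivative f' x) (at x)) \<and> P f'"
  shows "smooth f"
proof -
  have "P f \<Longrightarrow> derivs_in (\<lambda>_. True) n f" for n f
  proof (induction n arbitrary: f)
    case (Suc n)
    then show ?case using step[OF Suc.prems] by auto
  qed simp
  with base show ?thesis by (auto simp: smooth_def)
qed

lemma smooth_continuous: "smooth f \<Longrightarrow> continuous_on UNIV f"
  by (metis smooth_deriv has_vector_derivative_continuous continuous_at_imp_continuous_on)

lemma smooth_const: "smooth (\<lambda>_. c)"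
proof (rule smooth_coinduct[where P="\<lambda>f. \<exists>c. f = (\<lambda>_. c)"])
  fix f :: "real \<Rightarrow> 'a" assume "\<exists>c. f = (\<lambda>_. c)"
  then show "\<exists>f'. (\<forall>x. (f has_vector_derivative f' x) (at x)) \<and> (\<exists>c. f' = (\<lambda>_. c))"
    by (intro exI[of _ "\<lambda>_. 0"]) auto
qed auto

lemma smooth_add: "smooth f \<Longrightarrow> smooth g \<Longrightarrow> smooth (\<lambda>x. f x + g x)"
  unfolding smooth_def by (auto intro: derivs_in_add)

lemma smooth_mult: "smooth f \<Longrightarrow> smooth g \<Longrightarrow> smooth (\<lambda>x. f x * g x)"
  unfolding smooth_def by (auto intro: derivs_in_mult)

lemma smooth_of_real: "smooth (f :: real \<Rightarrow> real) \<Longrightarrow> smooth (\<lambda>x. of_real (f x) :: 'a::real_normed_field)"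
proof (rule smooth_coinduct[where P="\<lambda>h. \<exists>f::real \<Rightarrow> real. smooth f \<and> h = (\<lambda>x. of_real (f x))"])
  fix h :: "real \<Rightarrow> 'a" assume "\<exists>f::real \<Rightarrow> real. smooth f \<and> h = (\<lambda>x. of_real (f x))"
  then obtain f where f: "smooth f" "h = (\<lambda>x. of_real (f x))" by auto
  obtain f' where f': "\<And>x. (f has_vector_derivative f' x) (at x)" "smooth f'"
    using smooth_deriv[OF f(1)] by auto
  show "\<exists>h'. (\<forall>x. (h has_vector_derivative h' x) (at x)) \<and> (\<exists>f::real \<Rightarrow> real. smooth f \<and> h' = (\<lambda>x. of_real (f x)))"
    using f f' by (intro exI[of _ "\<lambda>x. of_real (f' x)"])
      (auto intro!: has_vector_derivative_of_real simp: has_real_derivative_iff_has_vector_derivative)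
qed auto

lemma smooth_ident: "smooth (\<lambda>x::real. x)"
proof -
  have "derivs_in (\<lambda>_. True) n (\<lambda>x::real. x)" for n
    using smooth_const[of "1::real"]
    by (cases n) (auto simp: smooth_def intro!: exI[of _ "\<lambda>_. 1"] has_vector_derivative_id)
  then show ?thesis by (simp add: smooth_def)
qed

lemma smooth_compose:
  fixes f g :: "real \<Rightarrow> real"
  assumes f: "smooth f" and g: "smooth g"
  shows "smooth (\<lambda>x. f (g x))"
proof -
  obtain g' where g': "\<And>x. (g has_vector_derivative g' x) (at x)" "smooth g'"
    using smooth_deriv[OF g] by auto
  have "smooth f \<Longrightarrow> derivs_in (\<lambda>_. True) n (\<lambda>x. f (g x))" for n and f :: "real \<Rightarrow> real"
  proof (induction n arbitrary: f)
    case (Suc n)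
    obtain f' where f': "\<And>x. (f has_vector_derivative f' x) (at x)" "smooth f'"
      using smooth_deriv[OF Suc.prems] by auto
    have 1: "derivs_in (\<lambda>_. True) n (\<lambda>x. f' (g x) * g' x)"
      using Suc.IH[OF f'(2)] g'(2) by (intro derivs_in_mult) (auto simp: smooth_def)
    have "((\<lambda>x. f (g x)) has_vector_derivative f' (g x) * g' x) (at x)" for x
      using f'(1)[of "g x"] g'(1)[of x]
      unfolding has_real_derivative_iff_has_vector_derivative[symmetric] by (rule DERIV_chain2)
    from derivs_in_SucI[OF TrueI this 1] show ?case .
  qed simp
  with f show ?thesis by (simp add: smooth_def)
qed

lemma smooth_affine:
  fixes f :: "real \<Rightarrow> real"
  assumes "smooth f" shows "smooth (\<lambda>x. f ((x - s) / w))"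
proof -
  have "smooth (\<lambda>x. f (inverse w * (x + - s)))"
    by (rule smooth_compose[OF assms]) (intro smooth_mult smooth_add smooth_const smooth_ident)
  then show ?thesis by (simp add: field_simps)
qed

lemma smooth_inverse:
  fixes g :: "real \<Rightarrow> real"
  assumes g: "smooth g" and pos: "\<And>x. g x \<noteq> 0"
  shows "smooth (\<lambda>x. inverse (g x))"
proof -
  obtain g' where g': "\<And>x. (g has_vector_derivative g' x) (at x)" "smooth g'"
    using smooth_deriv[OF g] by auto
  have "derivs_in (\<lambda>_. True) n (\<lambda>x. inverse (g x))" for n
  proof (induction n)
    case (Suc n)
    have 1: "derivs_in (\<lambda>_. True) n (\<lambda>x. - 1 * (inverse (g x) * g' x * inverse (g x)))"
      using Suc.IH g'(2) smooth_const[of "- 1 :: real"] by (intro derivs_in_mult) (auto simp: smooth_def)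
    have "((\<lambda>x. inverse (g x)) has_vector_derivative - 1 * (inverse (g x) * g' x * inverse (g x))) (at x)" for x
      using DERIV_inverse'[of g "g' x" x UNIV] g'(1)[of x] pos[of x]
      unfolding has_real_derivative_iff_has_vector_derivative[symmetric] by simp
    from derivs_in_SucI[OF TrueI this 1] show ?case .
  qed simp
  then show ?thesis by (simp add: smooth_def)
qed

lemma smooth_sin_cos: "smooth (sin :: real \<Rightarrow> real)" "smooth (cos :: real \<Rightarrow> real)"
proof -
  have *: "smooth (\<lambda>x::real. a * sin x + b * cos x)" for a b
  proof (rule smooth_coinduct[where P="\<lambda>f. \<exists>a b. f = (\<lambda>x. a * sin x + b * cos x)"])
    fix f :: "real \<Rightarrow> real" assume "\<exists>a b. f = (\<lambda>x. a * sin x + b * cos x)"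
    then obtain a b where f: "f = (\<lambda>x. a * sin x + b * cos x)" by auto
    have "(f has_vector_derivative ((- b) * sin x + a * cos x)) (at x)" for x
      unfolding f has_real_derivative_iff_has_vector_derivative[symmetric]
      by (auto intro!: derivative_eq_intros)
    then show "\<exists>f'. (\<forall>x. (f has_vector_derivative f' x) (at x)) \<and> (\<exists>a b. f' = (\<lambda>x. a * sin x + b * cos x))"
      by (intro exI[of _ "\<lambda>x. (- b) * sin x + a * cos x"] conjI allI exI[of _ "- b"] exI[of _ a] refl)
  qed auto
  show "smooth (sin :: real \<Rightarrow> real)" "smooth (cos :: real \<Rightarrow> real)"
    using *[of 1 0] *[of 0 1] by (simp_all add: fun_eq_iff)
qed

text \<open>The powers of \<open>1 / t\<close> occur in the derivatives of the flat function \<open>exp (- 1 / t)\<close>; with them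
the family is closed under differentiation up to linear combinations.\<close>

definition flat_exp :: "nat \<Rightarrow> real \<Rightarrow> real" where
  "flat_exp m t = (if t > 0 then exp (- 1 / t) / t ^ m else 0)"

lemma flat_exp_tendsto_0: "(flat_exp m \<longlongrightarrow> 0) (at 0)"
proof -
  have "((\<lambda>t::real. (inverse t) ^ m / exp (inverse t)) \<longlongrightarrow> 0) (at_right 0)"
    using filterlim_compose[OF tendsto_power_div_exp_0 filterlim_inverse_at_top_right] .
  then have "(flat_exp m \<longlongrightarrow> 0) (at_right 0)"
    by (rule Lim_transform_eventually)
      (auto simp: flat_exp_def eventually_at_right_less exp_minus field_simps power_inverse
        intro!: eventually_mono[OF eventually_at_right_less])
  moreover have "(flat_exp m \<longlongrightarrow> 0) (at_left 0)"
    by (rule Lim_transform_eventually[OF tendsto_const])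
      (auto simp: flat_exp_def intro!: eventually_mono[OF eventually_at_left_real[of "-1"]])
  ultimately show ?thesis by (simp add: filterlim_split_at)
qed

lemma flat_exp_has_derivative:
  "(flat_exp m has_vector_derivative flat_exp (m + 2) t - m * flat_exp (m + 1) t) (at t)"
proof -
  consider "t > 0" | "t < 0" | "t = 0" by linarith
  then have "(flat_exp m has_real_derivative flat_exp (m + 2) t - m * flat_exp (m + 1) t) (at t)"
  proof cases
    case 1
    have "((\<lambda>t. exp (- 1 / t) / t ^ m) has_real_derivative flat_exp (m + 2) t - m * flat_exp (m + 1) t) (at t)"
    proof (cases m)
      case 0
      then show ?thesis using 1
        by (auto intro!: derivative_eq_intros simp: flat_exp_def field_simps power2_eq_square)
    next
      case (Suc k)
      have "((\<lambda>t. exp (- 1 / t) / t ^ Suc k) has_real_derivative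
          (exp (- 1 / t) * (1 / t\<^sup>2) * t ^ Suc k - exp (- 1 / t) * (real (Suc k) * t ^ k)) / (t ^ Suc k * t ^ Suc k)) (at t)"
        using 1 by (auto intro!: derivative_eq_intros simp: power2_eq_square simp del: power_Suc)
      also have "(exp (- 1 / t) * (1 / t\<^sup>2) * t ^ Suc k - exp (- 1 / t) * (real (Suc k) * t ^ k)) / (t ^ Suc k * t ^ Suc k)
          = flat_exp (m + 2) t - m * flat_exp (m + 1) t"
        using 1 Suc by (simp add: flat_exp_def field_simps power2_eq_square)
      finally show ?thesis using Suc by simp
    qed
    then show ?thesis
      by (rule DERIV_cong_ev[OF refl _ refl, THEN iffD1, rotated])
        (use 1 eventually_nhds_in_open[of "{0<..}" t] in \<open>auto simp: flat_exp_def elim!: eventually_mono\<close>)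
  next
    case 2
    have "((\<lambda>t. 0) has_real_derivative flat_exp (m + 2) t - m * flat_exp (m + 1) t) (at t)"
      using 2 by (simp add: flat_exp_def)
    then show ?thesis
      by (rule DERIV_cong_ev[OF refl _ refl, THEN iffD1, rotated])
        (use 2 eventually_nhds_in_open[of "{..<0}" t] in \<open>auto simp: flat_exp_def elim!: eventually_mono\<close>)
  next
    case 3
    have "((\<lambda>h. (flat_exp m (0 + h) - flat_exp m 0) / h) \<longlongrightarrow> 0) (at 0)"
      using flat_exp_tendsto_0[of "Suc m"]
      by (rule Lim_transform_eventually) (auto simp: flat_exp_def field_simps)
    then show ?thesis unfolding DERIV_def using 3 by (simp add: flat_exp_def)
  qed
  then show ?thesis by (simp add: has_real_derivative_iff_has_vector_derivative)
qed

lemma smooth_flat_exp: "smooth (flat_exp m)"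
proof -
  have "derivs_in (\<lambda>_. True) n (flat_exp m)" for n m
  proof (induction n arbitrary: m)
    case (Suc n)
    have "derivs_in (\<lambda>_. True) n (\<lambda>t. flat_exp (m + 2) t + (- real m) * flat_exp (m + 1) t)"
      using smooth_const[of "- real m"]
      by (intro derivs_in_add derivs_in_mult Suc.IH) (auto simp: smooth_def)
    then have "derivs_in (\<lambda>_. True) n (\<lambda>t. flat_exp (m + 2) t - real m * flat_exp (m + 1) t)" by simp
    from derivs_in_SucI[OF TrueI flat_exp_has_derivative this] show ?case .
  qed simp
  then show ?thesis by (simp add: smooth_def)
qed

definition smooth_step :: "real \<Rightarrow> real" where
  "smooth_step t = flat_exp 0 t * inverse (flat_exp 0 t + flat_exp 0 (1 - t))"

lemma flat_exp_0_sum_pos: "flat_exp 0 t + flat_exp 0 (1 - t) > 0"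
  by (auto simp: flat_exp_def add_pos_pos)

lemma smooth_smooth_step: "smooth smooth_step"
proof -
  have "smooth (\<lambda>t. flat_exp 0 (1 + (- 1) * t))"
    by (intro smooth_compose[OF smooth_flat_exp] smooth_add smooth_mult smooth_const smooth_ident)
  then have "smooth (\<lambda>t. flat_exp 0 (1 - t))" by simp
  then have "smooth (\<lambda>t. inverse (flat_exp 0 t + flat_exp 0 (1 - t)))"
    by (intro smooth_inverse smooth_add smooth_flat_exp) (use flat_exp_0_sum_pos less_irrefl in metis)+
  then show ?thesis
    unfolding smooth_step_def[abs_def] by (intro smooth_mult smooth_flat_exp)
qed

lemma smooth_step_range: "0 \<le> smooth_step t" "smooth_step t \<le> 1"
  using flat_exp_0_sum_pos[of t] by (auto simp: smooth_step_def flat_exp_def field_simps)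

lemma smooth_step_le_0: "t \<le> 0 \<Longrightarrow> smooth_step t = 0"
  by (simp add: smooth_step_def flat_exp_def)

lemma smooth_step_ge_1: "t \<ge> 1 \<Longrightarrow> smooth_step t = 1"
  by (simp add: smooth_step_def flat_exp_def)

text \<open>Cosine and sine of one smooth angle yield two smooth cutoffs whose squares add up to
\<open>1\<close>, with no square root to be taken. The angle depends on \<open>x\<^sup>2\<close>, which makes it even and smooth at the
origin, and it passes from \<open>0\<close> to \<open>\<pi> / 2\<close> for \<open>1 \<le> \<bar>x\<bar> \<le> 2\<close>.\<close>

definition transition_angle :: "real \<Rightarrow> real" where
  "transition_angle x = pi / 2 * smooth_step ((x\<^sup>2 - 1) / 3)"

definition low_pass :: "real \<Rightarrow> real" where "low_pass x = cos (transition_angle x)"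
definition high_pass :: "real \<Rightarrow> real" where "high_pass x = sin (transition_angle x)"

lemma smooth_transition_angle: "smooth transition_angle"
proof -
  have "smooth (\<lambda>x. pi / 2 * smooth_step ((1 / 3) * (x * x + - 1)))"
    by (intro smooth_mult smooth_const smooth_compose[OF smooth_smooth_step] smooth_add smooth_ident)
  moreover have "(1 / 3) * (x * x + - 1) = (x\<^sup>2 - 1) / 3" for x :: real
    by (simp add: power2_eq_square)
  ultimately show ?thesis by (simp add: transition_angle_def[abs_def])
qed

lemma smooth_low_pass: "smooth low_pass" and smooth_high_pass: "smooth high_pass"
  unfolding low_pass_def[abs_def] high_pass_def[abs_def]
  by (rule smooth_compose[OF smooth_sin_cos(2) smooth_transition_angle] smooth_compose[OF smooth_sin_cos(1) smooth_transition_angle])+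

lemma transition_angle_range: "0 \<le> transition_angle x" "transition_angle x \<le> pi / 2"
  using smooth_step_range[of "(x\<^sup>2 - 1) / 3"] by (auto simp: transition_angle_def mult_left_le)

lemma low_pass_range: "0 \<le> low_pass x" "low_pass x \<le> 1" and high_pass_range: "0 \<le> high_pass x" "high_pass x \<le> 1"
  using transition_angle_range[of x] by (auto simp: low_pass_def high_pass_def intro!: cos_ge_zero sin_ge_zero)

lemma low_pass_high_pass: "(low_pass x)\<^sup>2 + (high_pass x)\<^sup>2 = 1"
  by (simp add: low_pass_def high_pass_def)

lemma transition_angle_inner: "\<bar>x\<bar> \<le> 1 \<Longrightarrow> transition_angle x = 0"
  by (simp add: transition_angle_def smooth_step_le_0 abs_square_le_1)

lemma transition_angle_outer: "\<bar>x\<bar> \<ge> 2 \<Longrightarrow> transition_angle x = pi / 2"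
  using power_mono[of 2 "\<bar>x\<bar>" 2] by (simp add: transition_angle_def smooth_step_ge_1)

lemma low_pass_inner: "\<bar>x\<bar> \<le> 1 \<Longrightarrow> low_pass x = 1" and high_pass_inner: "\<bar>x\<bar> \<le> 1 \<Longrightarrow> high_pass x = 0"
  and low_pass_outer: "\<bar>x\<bar> \<ge> 2 \<Longrightarrow> low_pass x = 0" and high_pass_outer: "\<bar>x\<bar> \<ge> 2 \<Longrightarrow> high_pass x = 1"
  by (simp_all add: low_pass_def high_pass_def transition_angle_inner transition_angle_outer)

lemma low_pass_even: "low_pass (- x) = low_pass x"
  by (simp add: low_pass_def transition_angle_def)

section \<open>Schwartz functions from smooth compactly supported spectra\<close>

definition rapid :: "(real \<Rightarrow> complex) \<Rightarrow> bool" where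
  "rapid f \<longleftrightarrow> (\<forall>m. bounded (range (\<lambda>x. x ^ m *\<^sub>R f x)))"

lemma rapid_add: "rapid f \<Longrightarrow> rapid g \<Longrightarrow> rapid (\<lambda>x. f x + g x)"
  unfolding rapid_def by (auto simp: scaleR_add_right intro!: bounded_plus_comp)

lemma rapid_mult: 
  assumes "rapid f" "rapid g" shows "rapid (\<lambda>x. f x * g x)"
  unfolding rapid_def
proof
  fix m
  obtain A where A: "\<And>x. norm (x ^ m *\<^sub>R f x) \<le> A"
    using assms(1) unfolding rapid_def bounded_iff by blast
  obtain B where B: "\<And>x. norm (x ^ 0 *\<^sub>R g x) \<le> B"
    using assms(2) unfolding rapid_def bounded_iff by blast
  have "norm (x ^ m *\<^sub>R (f x * g x)) \<le> A * B" for x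
  proof -
    have "norm (x ^ m *\<^sub>R (f x * g x)) = norm (x ^ m *\<^sub>R f x) * norm (g x)"
      by (simp add: norm_mult)
    also have "\<dots> \<le> A * B"
      using B[of x] by (intro mult_mono A order_trans[OF norm_ge_zero A]) auto
    finally show ?thesis .
  qed
  then show "bounded (range (\<lambda>x. x ^ m *\<^sub>R (f x * g x)))" by (auto simp: bounded_iff)
qed

definition rapid_smooth :: "(real \<Rightarrow> complex) \<Rightarrow> bool" where
  "rapid_smooth f \<longleftrightarrow> (\<forall>n. derivs_in rapid n f)"

lemma rapid_smooth_deriv:
  assumes "rapid_smooth f"
  obtains f' where "\<And>x. (f has_vector_derivative f' x) (at x)" "rapid_smooth f'"
proof -
  have ex: "\<exists>f'. (\<forall>x. (f has_vector_derivative f' x) (at x)) \<and> derivs_in rapid n f'" for n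
    using assms unfolding rapid_smooth_def by (metis derivs_in.simps(2))
  then obtain f' where f': "\<And>x. (f has_vector_derivative f' x) (at x)" by blast
  have "derivs_in rapid n f'" for n
  proof -
    obtain g where g: "\<forall>x. (f has_vector_derivative g x) (at x)" "derivs_in rapid n g"
      using ex by blast
    then have "g = f'" using f' by (auto intro!: ext intro: vector_derivative_unique_at)
    with g show ?thesis by simp
  qed
  with f' show ?thesis using that unfolding rapid_smooth_def by blast
qed

lemma rapid_smooth_rapid: "rapid_smooth f \<Longrightarrow> rapid f"
  unfolding rapid_smooth_def using derivs_in.simps(1) by blast

lemma rapid_smooth_mult: "rapid_smooth f \<Longrightarrow> rapid_smooth g \<Longrightarrow> rapid_smooth (\<lambda>x. f x * g x)"
  unfolding rapid_smooth_def by (auto intro: derivs_in_mult rapid_add rapid_mult)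

lemma rapid_smooth_schwartz:
  assumes "rapid_smooth f" shows "schwartz f"
proof -
  have *: "rapid_smooth f \<Longrightarrow> rapid_smooth (higher_vderiv n f)" for n
  proof (induction n arbitrary: f)
    case (Suc n)
    obtain f' where f': "\<And>x. (f has_vector_derivative f' x) (at x)" "rapid_smooth f'"
      using rapid_smooth_deriv[OF Suc.prems] by blast
    have "(\<lambda>x. vector_derivative f (at x)) = f'"
      using f'(1) by (auto intro!: ext vector_derivative_at)
    then have "higher_vderiv (Suc n) f = higher_vderiv n f'"
      unfolding higher_vderiv_def funpow_Suc_right by simp
    with Suc.IH f'(2) show ?case by simp
  qed (simp add: higher_vderiv_def)
  show ?thesis unfolding schwartz_def
  proof (intro conjI allI)
    fix n x
    show "higher_vderiv n f differentiable at x"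
      by (metis rapid_smooth_deriv[OF *[OF assms]] has_vector_derivative_def differentiableI)
  next
    fix m n
    show "bounded (range (\<lambda>x. x ^ m *\<^sub>R higher_vderiv n f x))"
      using rapid_smooth_rapid[OF *[OF assms]] unfolding rapid_def by blast
  qed
qed

lemma integrable_inverse_1_plus_square': "integrable lborel (\<lambda>x::real. inverse (1 + x\<^sup>2))"
  using integrable_inverse_1_plus_square by (simp add: set_integrable_def einterval_def)

lemma rapid_smooth_tame:
  assumes f: "rapid_smooth f" shows "tame f"
proof -
  have cont: "continuous_on UNIV f"
    by (metis rapid_smooth_deriv[OF f] has_vector_derivative_continuous continuous_at_imp_continuous_on)
  have r: "rapid f" using rapid_smooth_rapid[OF f] .
  obtain A where A: "\<And>x. norm (x ^ 0 *\<^sub>R f x) \<le> A"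
    using r unfolding rapid_def bounded_iff by blast
  obtain B where B: "\<And>x. norm (x ^ 2 *\<^sub>R f x) \<le> B"
    using r unfolding rapid_def bounded_iff by blast
  have le: "cmod (f x) \<le> (A + B) * inverse (1 + x\<^sup>2)" for x
  proof -
    have "cmod (f x) * (1 + x\<^sup>2) \<le> A + B"
      using A[of x] B[of x] by (simp add: algebra_simps)
    moreover have "1 + x\<^sup>2 > 0" by (simp add: add_pos_nonneg)
    ultimately show ?thesis by (simp add: field_simps)
  qed
  have [measurable]: "f \<in> borel_measurable borel" by (rule borel_measurable_continuous_onI[OF cont])
  have "integrable lborel f"
  proof (rule Bochner_Integration.integrable_bound)
    show "integrable lborel (\<lambda>x. (A + B) * inverse (1 + x\<^sup>2))"
      by (intro integrable_mult_right integrable_inverse_1_plus_square')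
    show "AE x in lborel. norm (f x) \<le> norm ((A + B) * inverse (1 + x\<^sup>2))"
      using le by (intro AE_I2) (auto intro: order_trans[OF _ abs_ge_self])
  qed measurable
  moreover have "bounded (range f)" using A by (auto simp: bounded_iff)
  ultimately show ?thesis using cont by (simp add: tame_def)
qed

definition bump :: "(real \<Rightarrow> complex) \<Rightarrow> bool" where
  "bump b \<longleftrightarrow> smooth b \<and> (\<exists>r. \<forall>x. \<bar>x\<bar> > r \<longrightarrow> b x = 0)"

lemma bump_tame:
  assumes b: "bump b" shows "tame b"
proof -
  have cont: "continuous_on UNIV b" using b by (simp add: bump_def smooth_continuous)
  obtain r where r: "\<And>x. \<bar>x\<bar> > r \<Longrightarrow> b x = 0" using b by (auto simp: bump_def)
  have eq: "b x = indicator {-r..r} x *\<^sub>R b x" for x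
    using r[of x] by (auto simp: indicator_def)
  have "integrable lborel (\<lambda>x. indicator {-r..r} x *\<^sub>R b x)"
    by (intro borel_integrable_compact continuous_on_subset[OF cont]) auto
  then have "integrable lborel b" using eq by simp
  moreover have "bounded (range b)"
  proof -
    have "bounded (insert 0 (b ` {-r..r}))"
      by (auto intro!: compact_imp_bounded compact_continuous_image continuous_on_subset[OF cont])
    moreover have "range b \<subseteq> insert 0 (b ` {-r..r})"
      using r by (force simp: not_less[symmetric])
    ultimately show ?thesis by (rule bounded_subset)
  qed
  ultimately show ?thesis using cont by (simp add: tame_def)
qed

lemma bump_smooth_mult: "bump b \<Longrightarrow> smooth p \<Longrightarrow> bump (\<lambda>x. p x * b x)"
  unfolding bump_def by (auto intro: smooth_mult)

lemma bump_deriv: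
  assumes b: "bump b"
  obtains b' where "\<And>x. (b has_vector_derivative b' x) (at x)" "bump b'"
    "\<And>r x. (\<And>y. \<bar>y\<bar> > r \<Longrightarrow> b y = 0) \<Longrightarrow> \<bar>x\<bar> > r \<Longrightarrow> b' x = 0"
proof -
  obtain b' where b': "\<And>x. (b has_vector_derivative b' x) (at x)" "smooth b'"
    using smooth_deriv b unfolding bump_def by blast
  have z: "b' x = 0" if r: "\<And>y. \<bar>y\<bar> > r \<Longrightarrow> b y = 0" and x: "\<bar>x\<bar> > r" for r x
  proof -
    have "open {y::real. \<bar>y\<bar> > r}" by (intro open_Collect_less continuous_intros)
    then have "(b has_vector_derivative 0) (at x)"
      by (intro has_vector_derivative_transform_within_open[where f="\<lambda>_. 0" and g=b and S="{y. \<bar>y\<bar> > r}"])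
        (use r x in auto)
    with b'(1)[of x] show ?thesis by (rule vector_derivative_unique_at)
  qed
  obtain r where "\<And>x. \<bar>x\<bar> > r \<Longrightarrow> b x = 0" using b by (auto simp: bump_def)
  with z b' have "bump b'" by (auto simp: bump_def)
  with b' z that show ?thesis by blast
qed

definition inverse_fourier :: "(real \<Rightarrow> complex) \<Rightarrow> real \<Rightarrow> complex" where
  "inverse_fourier b x = fourier b (- x)"

lemma inverse_fourier_eq: "inverse_fourier b x = (LINT \<xi>|lborel. b \<xi> * cis (2 * pi * x * \<xi>))"
  by (simp add: inverse_fourier_def fourier_def)

lemma inverse_fourier_eq_integral:
  assumes b: "bump b" and r: "\<And>x. \<bar>x\<bar> > r \<Longrightarrow> b x = 0"
  shows "inverse_fourier b x = integral (cbox (-r) r) (\<lambda>\<xi>. b \<xi> * cis (2 * pi * x * \<xi>))"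
proof -
  have "integrable lborel (\<lambda>\<xi>. b \<xi> * cis (2 * pi * x * \<xi>))"
    using integrable_times_cis[OF tame_integrable[OF bump_tame[OF b]], of "2 * pi * x" 0] by simp
  then have "inverse_fourier b x = integral UNIV (\<lambda>\<xi>. b \<xi> * cis (2 * pi * x * \<xi>))"
    unfolding inverse_fourier_eq by (rule integral_lborel[symmetric])
  also have "(\<lambda>\<xi>. b \<xi> * cis (2 * pi * x * \<xi>)) = (\<lambda>\<xi>. if \<xi> \<in> cbox (-r) r then b \<xi> * cis (2 * pi * x * \<xi>) else 0)"
    using r by (auto intro!: ext simp: not_le abs_if)
  finally show ?thesis by (simp only: integral_restrict_UNIV)
qed

lemma cis_has_vector_derivative:
  "((\<lambda>x. cis (a * x)) has_vector_derivative (\<i> * a * cis (a * x))) (at x)"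
proof -
  have "((\<lambda>z. exp (\<i> * (a * z))) has_field_derivative (\<i> * a * cis (a * x))) (at (complex_of_real x))"
    by (auto intro!: derivative_eq_intros simp: cis_conv_exp)
  from has_vector_derivative_real_field[OF this] show ?thesis by (simp add: cis_conv_exp)
qed

lemma inverse_fourier_has_derivative:
  assumes b: "bump b"
  shows "(inverse_fourier b has_vector_derivative inverse_fourier (\<lambda>\<xi>. complex_of_real (2 * pi * \<xi>) * \<i> * b \<xi>) x) (at x)"
proof -
  obtain r where r: "\<And>x. \<bar>x\<bar> > r \<Longrightarrow> b x = 0" using b by (auto simp: bump_def)
  let ?b = "\<lambda>\<xi>. complex_of_real (2 * pi * \<xi>) * \<i> * b \<xi>"
  have sm: "smooth (\<lambda>\<xi>. complex_of_real (2 * pi * \<xi>) * \<i>)"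
    by (intro smooth_mult smooth_of_real smooth_const smooth_ident)
  have b2: "bump ?b" by (rule bump_smooth_mult[OF b sm])
  have cont: "continuous_on UNIV b" using b by (simp add: bump_def smooth_continuous)
  have [continuous_intros]: "continuous_on S (\<lambda>x. b (snd x))" for S :: "(real \<times> real) set"
    by (rule continuous_on_compose2[OF cont continuous_on_snd[OF continuous_on_id]]) auto
  have "((\<lambda>x. integral (cbox (-r) r) (\<lambda>\<xi>. b \<xi> * cis (2 * pi * x * \<xi>))) has_vector_derivative
     integral (cbox (-r) r) (\<lambda>\<xi>. ?b \<xi> * cis (2 * pi * x * \<xi>))) (at x within UNIV)"
  proof (rule leibniz_rule_vector_derivative)
    fix x \<xi> :: real
    have "((\<lambda>x. b \<xi> * cis ((2 * pi * \<xi>) * x)) has_vector_derivative b \<xi> * (\<i> * (2 * pi * \<xi>) * cis ((2 * pi * \<xi>) * x))) (at x)"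
      using has_vector_derivative_mult_right[OF cis_has_vector_derivative[of "2 * pi * \<xi>" x], of "b \<xi>"]
      by simp
    then show "((\<lambda>x. b \<xi> * cis (2 * pi * x * \<xi>)) has_vector_derivative ?b \<xi> * cis (2 * pi * x * \<xi>)) (at x within UNIV)"
      by (simp add: mult_ac)
  next
    fix x show "(\<lambda>\<xi>. b \<xi> * cis (2 * pi * x * \<xi>)) integrable_on cbox (- r) r"
      by (intro integrable_continuous continuous_intros continuous_on_subset[OF cont]) auto
  next
    show "continuous_on (UNIV \<times> cbox (- r) r) (\<lambda>(x, \<xi>). ?b \<xi> * cis (2 * pi * x * \<xi>))"
      unfolding case_prod_unfold by (intro continuous_intros)
  qed auto
  moreover have "inverse_fourier b = (\<lambda>x. integral (cbox (-r) r) (\<lambda>\<xi>. b \<xi> * cis (2 * pi * x * \<xi>)))"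
    by (rule ext) (rule inverse_fourier_eq_integral[OF b r])
  moreover have "inverse_fourier ?b x = integral (cbox (-r) r) (\<lambda>\<xi>. ?b \<xi> * cis (2 * pi * x * \<xi>))"
    using r by (intro inverse_fourier_eq_integral b2) auto
  ultimately show ?thesis by simp
qed

text \<open>Integration by parts on an interval that contains the support of \<open>b\<close>.\<close>

lemma inverse_fourier_times:
  assumes b: "bump b" and b': "\<And>x. (b has_vector_derivative b' x) (at x)" "bump b'"
    "\<And>r x. (\<And>y. \<bar>y\<bar> > r \<Longrightarrow> b y = 0) \<Longrightarrow> \<bar>x\<bar> > r \<Longrightarrow> b' x = 0"
  shows "complex_of_real x * inverse_fourier b x = inverse_fourier (\<lambda>\<xi>. \<i> / (2 * pi) * b' \<xi>) x"
proof -
  obtain r where r: "\<And>x. \<bar>x\<bar> > r \<Longrightarrow> b x = 0" using b by (auto simp: bump_def)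
  \<comment> \<open>An interval with end points strictly outside the support, so that the boundary terms vanish.\<close>
  define R where "R = max r 0 + 1"
  have R: "R > 0" "\<And>x. \<bar>x\<bar> > R \<Longrightarrow> b x = 0" "b R = 0" "b (- R) = 0"
    unfolding R_def by (auto intro!: r)
  have R': "\<And>x. \<bar>x\<bar> > R \<Longrightarrow> b' x = 0" using b'(3)[OF R(2)] .
  let ?e = "\<lambda>\<xi>. cis (2 * pi * x * \<xi>)"
  have "((\<lambda>\<xi>. b \<xi> * ?e \<xi>) has_vector_derivative b \<xi> * (\<i> * (2 * pi * x) * ?e \<xi>) + b' \<xi> * ?e \<xi>) (at \<xi>)" for \<xi>
    using has_vector_derivative_mult[OF b'(1) cis_has_vector_derivative[of "2 * pi * x"], of \<xi>] by simp
  then have "((\<lambda>\<xi>. b \<xi> * (\<i> * (2 * pi * x) * ?e \<xi>) + b' \<xi> * ?e \<xi>) has_integral (b R * ?e R - b (- R) * ?e (- R))) {-R..R}"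
    using R(1) by (intro fundamental_theorem_of_calculus[of "-R" R "\<lambda>\<xi>. b \<xi> * ?e \<xi>"])
      (simp_all add: has_vector_derivative_at_within)
  then have 0: "integral {-R..R} (\<lambda>\<xi>. b \<xi> * (\<i> * (2 * pi * x) * ?e \<xi>) + b' \<xi> * ?e \<xi>) = 0"
    using R by (simp add: integral_unique)
  have ib: "(\<lambda>\<xi>. b \<xi> * ?e \<xi>) integrable_on {-R..R}" "(\<lambda>\<xi>. b' \<xi> * ?e \<xi>) integrable_on {-R..R}"
    using b b' by (auto intro!: integrable_continuous_interval continuous_on_mult continuous_on_cis
      continuous_on_subset[OF smooth_continuous subset_UNIV, of b]
      continuous_on_subset[OF smooth_continuous subset_UNIV, of b'] continuous_intros simp: bump_def)
  have "integral {-R..R} (\<lambda>\<xi>. b \<xi> * (\<i> * (2 * pi * x) * ?e \<xi>) + b' \<xi> * ?e \<xi>)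
    = integral {-R..R} (\<lambda>\<xi>. (\<i> * (2 * pi * x)) * (b \<xi> * ?e \<xi>) + b' \<xi> * ?e \<xi>)"
    by (simp add: mult_ac)
  also have "\<dots> = \<i> * (2 * pi * x) * inverse_fourier b x + inverse_fourier b' x"
    using ib
    by (subst Henstock_Kurzweil_Integration.integral_add)
      (auto intro!: integrable_on_mult_right simp: inverse_fourier_eq_integral[OF b R(2)] inverse_fourier_eq_integral[OF b'(2) R'])
  finally have "inverse_fourier b' x = - (\<i> * (2 * pi * x) * inverse_fourier b x)" using 0 by (simp add: add_eq_0_iff)
  moreover have "inverse_fourier (\<lambda>\<xi>. \<i> / (2 * pi) * b' \<xi>) x = \<i> / (2 * pi) * inverse_fourier b' x"
    unfolding inverse_fourier_def by (rule fourier_cmult)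
  ultimately show ?thesis by (simp add: field_simps)
qed

text \<open>Multiplication by \<open>x\<close> corresponds to differentiation of the spectrum, so
\<open>x\<^sup>m\<close> times the function is again the transform of a smooth compactly supported function and hence
bounded.\<close>

lemma rapid_inverse_fourier:
  assumes "bump b" shows "rapid (inverse_fourier b)"
  unfolding rapid_def
proof
  fix m
  have "\<exists>c. bump c \<and> (\<forall>x. x ^ m *\<^sub>R inverse_fourier b x = inverse_fourier c x)"
  proof (induction m)
    case (Suc m)
    then obtain c where c: "bump c" "\<And>x. x ^ m *\<^sub>R inverse_fourier b x = inverse_fourier c x" by auto
    from bump_deriv[OF c(1)] obtain c' where c': "\<And>x. (c has_vector_derivative c' x) (at x)" "bump c'"
       "\<And>r x. (\<And>y. \<bar>y\<bar> > r \<Longrightarrow> c y = 0) \<Longrightarrow> \<bar>x\<bar> > r \<Longrightarrow> c' x = 0" by blast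
    have "x ^ Suc m *\<^sub>R inverse_fourier b x = complex_of_real x * inverse_fourier c x" for x
      by (simp add: scaleR_conv_of_real mult.assoc flip: c(2))
    moreover have "complex_of_real x * inverse_fourier c x = inverse_fourier (\<lambda>\<xi>. \<i> / (2 * pi) * c' \<xi>) x" for x
      by (rule inverse_fourier_times[OF c(1) c'(1,2)]) (rule c'(3))
    ultimately show ?case using bump_smooth_mult[OF c'(2) smooth_const, of "\<i> / (2 * pi)"]
      by (intro exI[of _ "\<lambda>\<xi>. \<i> / (2 * pi) * c' \<xi>"]) simp
  qed (use assms in auto)
  then obtain c where c: "bump c" "\<And>x. x ^ m *\<^sub>R inverse_fourier b x = inverse_fourier c x" by auto
  show "bounded (range (\<lambda>x. x ^ m *\<^sub>R inverse_fourier b x))"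
    unfolding c(2) unfolding inverse_fourier_def bounded_iff using cmod_fourier_le[of c] by blast
qed

lemma rapid_smooth_inverse_fourier:
  assumes "bump b" shows "rapid_smooth (inverse_fourier b)"
proof -
  have "bump b \<Longrightarrow> derivs_in rapid n (inverse_fourier b)" for n b
  proof (induction n arbitrary: b)
    case (Suc n)
    have "smooth (\<lambda>\<xi>. complex_of_real (2 * pi * \<xi>) * \<i>)"
      by (intro smooth_mult smooth_of_real smooth_const smooth_ident)
    from bump_smooth_mult[OF Suc.prems this]
    show ?case
      by (intro derivs_in_SucI[where f="inverse_fourier b", OF rapid_inverse_fourier[OF Suc.prems] inverse_fourier_has_derivative[OF Suc.prems] Suc.IH])
  qed (simp add: rapid_inverse_fourier)
  with assms show ?thesis by (simp add: rapid_smooth_def)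
qed

lemma tame_inverse_fourier: "bump b \<Longrightarrow> tame (inverse_fourier b)"
  by (intro rapid_smooth_tame rapid_smooth_inverse_fourier)

lemma fourier_inverse_fourier:
  assumes b: "bump b" shows "fourier (inverse_fourier b) \<xi> = b \<xi>"
proof -
  have "integrable lborel (\<lambda>x. inverse_fourier b (0 + (-1) * x))"
    using tame_integrable[OF tame_inverse_fourier[OF b]] by (rule integrable_lborel_affine) simp
  then have i: "integrable lborel (fourier b)" by (simp add: inverse_fourier_def)
  have "fourier (inverse_fourier b) \<xi> = \<bar>-1\<bar> *\<^sub>R (LINT x|lborel. fourier b (- (0 + (-1) * x)) * cis (- 2 * pi * \<xi> * (0 + (-1) * x)))"
    unfolding fourier_def[of "inverse_fourier b"] inverse_fourier_def by (rule lborel_integral_real_affine) simp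
  also have "\<dots> = (LINT x|lborel. fourier b x * cis (2 * pi * \<xi> * x))" by simp
  also have "\<dots> = b \<xi>" by (rule fourier_inversion[OF bump_tame[OF b] i])
  finally show ?thesis .
qed

text \<open>The transform of a product is the convolution of the two spectra, whose
integrand vanishes identically under the hypothesis.\<close>

lemma fourier_inverse_fourier_mult_eq_0:
  assumes b: "bump b" "bump c" and 0: "\<And>t. b t = 0 \<or> c (\<xi> - t) = 0"
  shows "fourier (\<lambda>x. inverse_fourier b x * inverse_fourier c x) \<xi> = 0"
proof -
  let ?a = "\<lambda>t. b (0 + (-1) * t)"
  let ?e = "\<lambda>x. inverse_fourier c x * cis (- 2 * pi * \<xi> * x)"
  have a: "integrable lborel ?a"
    by (rule integrable_lborel_affine[OF tame_integrable[OF bump_tame[OF b(1)]]]) simp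
  have e: "integrable lborel ?e"
    by (intro tame_integrable tame_cis tame_inverse_fourier b)
  have ia: "inverse_fourier b x = fourier ?a x" for x
    using lborel_integral_real_affine[of "-1" "\<lambda>\<xi>. b \<xi> * cis (2 * pi * x * \<xi>)" 0]
    by (simp add: inverse_fourier_eq fourier_def)
  have fe: "fourier ?e t = c (\<xi> + t)" for t
  proof -
    have "fourier ?e t = fourier (inverse_fourier c) (\<xi> + t)"
      unfolding fourier_def mult.assoc cis_mult by (simp add: algebra_simps)
    then show ?thesis by (simp add: fourier_inverse_fourier[OF b(2)])
  qed
  have "fourier (\<lambda>x. inverse_fourier b x * inverse_fourier c x) \<xi> = (LINT x|lborel. fourier ?a x * ?e x)"
    unfolding fourier_def[of "\<lambda>x. inverse_fourier b x * inverse_fourier c x"] by (simp add: ia mult.assoc)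
  also have "\<dots> = (LINT t|lborel. ?a t * fourier ?e t)"
    by (rule multiplication_formula[OF a e])
  also have "(\<lambda>t. ?a t * fourier ?e t) = (\<lambda>_. 0)"
  proof
    show "?a t * fourier ?e t = 0" for t using 0[of "- t"] unfolding fe by auto
  qed
  finally show ?thesis by simp
qed

lemma inverse_fourier_affine:
  assumes "W > 0"
  shows "inverse_fourier (\<lambda>\<xi>. b ((\<xi> - S) / W)) x = W * cis (2 * pi * S * x) * inverse_fourier b (W * x)"
proof -
  have "inverse_fourier (\<lambda>\<xi>. b ((\<xi> - S) / W)) x = \<bar>W\<bar> *\<^sub>R (LINT t|lborel. b ((S + W * t - S) / W) * cis (2 * pi * x * (S + W * t)))"
    unfolding inverse_fourier_eq by (rule lborel_integral_real_affine) (use assms in simp)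
  also have "(\<lambda>t. b ((S + W * t - S) / W) * cis (2 * pi * x * (S + W * t))) = (\<lambda>t. cis (2 * pi * S * x) * (b t * cis (2 * pi * (W * x) * t)))"
  proof
    fix t
    have "cis (2 * pi * x * (S + W * t)) = cis (2 * pi * S * x) * cis (2 * pi * (W * x) * t)"
      unfolding cis_mult by (simp add: algebra_simps)
    then show "b ((S + W * t - S) / W) * cis (2 * pi * x * (S + W * t)) = cis (2 * pi * S * x) * (b t * cis (2 * pi * (W * x) * t))"
      using assms by simp
  qed
  also have "\<bar>W\<bar> *\<^sub>R (LINT t|lborel. cis (2 * pi * S * x) * (b t * cis (2 * pi * (W * x) * t))) = W * cis (2 * pi * S * x) * inverse_fourier b (W * x)"
    unfolding inverse_fourier_eq using assms by (simp add: scaleR_conv_of_real)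
  finally show ?thesis .
qed

section \<open>Fourier transform of a kink\<close>

lemma half_line_FTC:
  fixes G :: "real \<Rightarrow> complex"
  assumes G: "\<And>x. (G has_vector_derivative G' x) (at x)" and i: "integrable lborel G'"
    and c: "continuous_on UNIV G'" and lim: "(G \<longlongrightarrow> 0) at_top"
  shows "(LINT x|lborel. indicator {0..} x *\<^sub>R G' x) = - G 0"
proof -
  have [measurable]: "G' \<in> borel_measurable borel" by (rule borel_measurable_continuous_onI[OF c])
  have "integrable lborel (\<lambda>x. indicator {0..} x *\<^sub>R G' x)"
    by (rule Bochner_Integration.integrable_bound[OF i]) (auto simp: indicator_def)
  from tendsto_integral_at_top[OF _ this]
  have 1: "((\<lambda>y. LINT x|lborel. indicator {..y} x *\<^sub>R indicator {0..} x *\<^sub>R G' x) \<longlongrightarrow> (LINT x|lborel. indicator {0..} x *\<^sub>R G' x)) at_top"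
    by simp
  have "eventually (\<lambda>y. G y - G 0 = (LINT x|lborel. indicator {..y} x *\<^sub>R indicator {0..} x *\<^sub>R G' x)) at_top"
    using eventually_ge_at_top[of 0]
  proof eventually_elim
    case (elim y)
    have "(LINT x|lborel. indicator {..y} x *\<^sub>R indicator {0..} x *\<^sub>R G' x) = (LINT x|lborel. indicator {0..y} x *\<^sub>R G' x)"
      by (intro Bochner_Integration.integral_cong refl) (auto simp: indicator_def)
    also have "\<dots> = G y - G 0"
      by (rule integral_FTC_atLeastAtMost[OF elim]) (auto intro!: has_vector_derivative_at_within G continuous_on_subset[OF c])
    finally show ?case ..
  qed
  moreover have "((\<lambda>y. G y - G 0) \<longlongrightarrow> 0 - G 0) at_top" by (intro tendsto_intros lim)
  ultimately have "((\<lambda>y. LINT x|lborel. indicator {..y} x *\<^sub>R indicator {0..} x *\<^sub>R G' x) \<longlongrightarrow> - G 0) at_top"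
    using Lim_transform_eventually by fastforce
  with 1 show ?thesis by (intro tendsto_unique[of at_top]) auto
qed

definition half_ft :: "(real \<Rightarrow> complex) \<Rightarrow> real \<Rightarrow> complex" where
  "half_ft F \<omega> = (LINT x|lborel. indicator {0..} x *\<^sub>R (F x * cis (- \<omega> * x)))"

lemma rapid_tendsto_0:
  assumes "rapid f" shows "(f \<longlongrightarrow> 0) at_top"
proof -
  obtain B where B: "\<And>x. norm (x ^ 1 *\<^sub>R f x) \<le> B"
    using assms unfolding rapid_def bounded_iff by blast
  show ?thesis
  proof (rule tendsto_norm_zero_cancel, rule tendsto_sandwich[where f="\<lambda>_. 0" and h="\<lambda>x. B / x"])
    show "eventually (\<lambda>x. norm (f x) \<le> B / x) at_top"
      using eventually_gt_at_top[of 0]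
    proof eventually_elim
      case (elim x) then show ?case using B[of x] by (simp add: field_simps)
    qed
    show "((\<lambda>x. B / x) \<longlongrightarrow> 0) at_top" by (intro tendsto_divide_0[OF tendsto_const] filterlim_at_top_imp_at_infinity filterlim_ident)
  qed auto
qed

lemma half_ft_deriv:
  assumes F: "rapid_smooth F" and F': "\<And>x. (F has_vector_derivative F' x) (at x)" "rapid_smooth F'"
  shows "\<i> * \<omega> * half_ft F \<omega> = half_ft F' \<omega> + F 0"
proof -
  have tF: "tame F" "tame F'" using F F' rapid_smooth_tame by auto
  let ?e = "\<lambda>x. cis (- \<omega> * x)"
  have te: "tame (\<lambda>x. F x * ?e x)" "tame (\<lambda>x. F' x * ?e x)"
    by (rule tame_cis, rule tF)+
  have t: "tame (\<lambda>x. (\<i> * (- \<omega>)) * (F x * ?e x) + F' x * ?e x)"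
    by (intro tame_add tame_cmult te)
  have ind: "integrable lborel (\<lambda>x. indicator {0..} x *\<^sub>R h x)" if "tame h" for h :: "real \<Rightarrow> complex"
    using that tame_measurable[OF that] 
    by (intro Bochner_Integration.integrable_bound[OF tame_integrable[OF that]]) (auto simp: indicator_def)
  have "(LINT x|lborel. indicator {0..} x *\<^sub>R ((\<i> * (- \<omega>)) * (F x * ?e x) + F' x * ?e x)) = - (F 0 * ?e 0)"
  proof (rule half_line_FTC)
    show "((\<lambda>x. F x * ?e x) has_vector_derivative (\<i> * (- \<omega>)) * (F x * ?e x) + F' x * ?e x) (at x)" for x
      using has_vector_derivative_mult[OF F'(1) cis_has_vector_derivative[of "- \<omega>"], of x] by (simp add: mult_ac)
    have "((\<lambda>x. cmod (F x * ?e x)) \<longlongrightarrow> 0) at_top"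
      using tendsto_norm_zero[OF rapid_tendsto_0[OF rapid_smooth_rapid[OF F]]] by (simp add: norm_mult)
    then show "((\<lambda>x. F x * ?e x) \<longlongrightarrow> 0) at_top" by (rule tendsto_norm_zero_cancel)
  qed (use t in \<open>auto simp: tame_def\<close>)
  also have "(LINT x|lborel. indicator {0..} x *\<^sub>R ((\<i> * (- \<omega>)) * (F x * ?e x) + F' x * ?e x))
    = (LINT x|lborel. (\<i> * (- \<omega>)) * (indicator {0..} x *\<^sub>R (F x * ?e x)) + indicator {0..} x *\<^sub>R (F' x * ?e x))"
    by (intro Bochner_Integration.integral_cong refl) (simp add: indicator_def)
  also have "\<dots> = (\<i> * (- \<omega>)) * half_ft F \<omega> + half_ft F' \<omega>"
    unfolding half_ft_def integral_mult_right_zero[symmetric]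
    by (intro Bochner_Integration.integral_add integrable_mult_right ind te)
  finally show ?thesis by (simp add: algebra_simps add_eq_0_iff)
qed

lemma half_ft_bound:
  assumes "tame F" shows "cmod (half_ft F \<omega>) \<le> (LINT x|lborel. cmod (F x))"
  unfolding half_ft_def using assms
  by (intro order_trans[OF integral_norm_bound] integral_mono')
    (auto simp: norm_mult indicator_def tame_def)

text \<open>Three integrations by parts on the half-line. The boundary term of the first one vanishes
with \<open>F 0\<close>, that of the second one is the main term, and the third one bounds the remainder.\<close>

lemma half_ft_kink:
  assumes F: "rapid_smooth F" and F': "\<And>x. (F has_vector_derivative F' x) (at x)" and 0: "F 0 = 0"
  shows "\<exists>C\<ge>0. \<forall>\<omega>. \<omega> \<noteq> 0 \<longrightarrow> cmod (half_ft F \<omega> + F' 0 / \<omega>\<^sup>2) \<le> C / \<bar>\<omega>\<bar> ^ 3"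
proof -
  have sF': "rapid_smooth F'"
  proof -
    obtain G where "\<And>x. (F has_vector_derivative G x) (at x)" "rapid_smooth G" using rapid_smooth_deriv[OF F] by blast
    moreover from this F' have "G = F'" by (auto intro!: ext intro: vector_derivative_unique_at)
    ultimately show ?thesis by simp
  qed
  obtain F2 where F2: "\<And>x. (F' has_vector_derivative F2 x) (at x)" "rapid_smooth F2"
    using rapid_smooth_deriv[OF sF'] by blast
  obtain F3 where F3: "\<And>x. (F2 has_vector_derivative F3 x) (at x)" "rapid_smooth F3"
    using rapid_smooth_deriv[OF F2(2)] by blast
  define C where "C = (LINT x|lborel. cmod (F3 x)) + cmod (F2 0)"
  show ?thesis
  proof (intro exI[of _ C] conjI allI impI)
    show "C \<ge> 0" by (simp add: C_def add_nonneg_nonneg)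
    fix \<omega> :: real assume \<omega>: "\<omega> \<noteq> 0"
    have e1: "\<i> * \<omega> * half_ft F \<omega> = half_ft F' \<omega>"
      using half_ft_deriv[OF F F' sF', of \<omega>] 0 by simp
    have e2: "\<i> * \<omega> * half_ft F' \<omega> = half_ft F2 \<omega> + F' 0"
      using half_ft_deriv[OF sF' F2] .
    have e3: "\<i> * \<omega> * half_ft F2 \<omega> = half_ft F3 \<omega> + F2 0"
      using half_ft_deriv[OF F2(2) F3] .
    \<comment> \<open>Multiplying by \<open>(i \<omega>)\<^sup>3\<close> cancels the main term against the boundary term and leaves bounded terms.\<close>
    have "(\<i> * \<omega>) ^ 3 * (half_ft F \<omega> + F' 0 / \<omega>\<^sup>2) = (\<i> * \<omega>) * (\<i> * \<omega>) * (\<i> * \<omega> * half_ft F \<omega>) - \<i> * \<omega> * F' 0"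
      using \<omega> by (simp add: power3_eq_cube power2_eq_square field_simps)
    also have "\<dots> = \<i> * \<omega> * (\<i> * \<omega> * half_ft F' \<omega>) - \<i> * \<omega> * F' 0"
      unfolding e1 by (simp add: mult.assoc)
    also have "\<dots> = \<i> * \<omega> * half_ft F2 \<omega>" unfolding e2 by (simp add: algebra_simps)
    also have "\<dots> = half_ft F3 \<omega> + F2 0" by (rule e3)
    finally have eq: "(\<i> * \<omega>) ^ 3 * (half_ft F \<omega> + F' 0 / \<omega>\<^sup>2) = half_ft F3 \<omega> + F2 0" .
    have "\<bar>\<omega>\<bar> ^ 3 * cmod (half_ft F \<omega> + F' 0 / \<omega>\<^sup>2) = cmod (half_ft F3 \<omega> + F2 0)"
      unfolding eq[symmetric] by (simp add: norm_mult norm_power)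
    also have "\<dots> \<le> C"
      unfolding C_def using half_ft_bound[OF rapid_smooth_tame[OF F3(2)], of \<omega>]
      by (intro order_trans[OF norm_triangle_ineq]) auto
    finally show "cmod (half_ft F \<omega> + F' 0 / \<omega>\<^sup>2) \<le> C / \<bar>\<omega>\<bar> ^ 3"
      using \<omega> by (simp add: field_simps)
  qed
qed

section \<open>The kernel and the input signal\<close>

text \<open>It serves as the low-pass filter \<open>\<chi>\<close>, as the envelope of the input signal and as the shape of
the bumps that travel through the filter bank.\<close>

definition lp_kernel :: "real \<Rightarrow> complex" where
  "lp_kernel = inverse_fourier (\<lambda>\<xi>. complex_of_real (low_pass \<xi>))"

lemma bump_low_pass: "bump (\<lambda>\<xi>. complex_of_real (low_pass \<xi>))"
  unfolding bump_def using low_pass_outer by (auto intro!: smooth_of_real smooth_low_pass exI[of _ 2])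

lemma lp_kernel_even: "lp_kernel (- x) = lp_kernel x"
proof -
  have "lp_kernel x = (LINT \<xi>|lborel. complex_of_real (low_pass (0 + (-1) * \<xi>)) * cis (2 * pi * x * (0 + (-1) * \<xi>)))"
    unfolding lp_kernel_def inverse_fourier_eq
    using lborel_integral_real_affine[of "-1" "\<lambda>\<xi>. complex_of_real (low_pass \<xi>) * cis (2 * pi * x * \<xi>)" 0] by simp
  then show ?thesis unfolding lp_kernel_def inverse_fourier_eq by (simp add: low_pass_even)
qed

lemma lp_kernel_real: "complex_of_real (Re (lp_kernel x)) = lp_kernel x"
proof -
  have "cnj (lp_kernel x) = (LINT \<xi>|lborel. cnj (complex_of_real (low_pass \<xi>) * cis (2 * pi * x * \<xi>)))"
    unfolding lp_kernel_def inverse_fourier_eq by (rule Bochner_Integration.integral_cnj[symmetric])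
  also have "\<dots> = lp_kernel (- x)" unfolding lp_kernel_def inverse_fourier_eq by (simp add: cis_cnj)
  finally show ?thesis by (simp add: lp_kernel_even complex_cnj_cancel_iff complex_eq_iff)
qed

lemma lp_kernel_square: "lp_kernel x * lp_kernel x = complex_of_real ((cmod (lp_kernel x))\<^sup>2)"
  by (metis lp_kernel_real Re_complex_of_real norm_of_real of_real_mult power2_abs power2_eq_square)

lemma tame_lp_kernel: "tame lp_kernel" and rapid_smooth_lp_kernel: "rapid_smooth lp_kernel"
  unfolding lp_kernel_def by (intro tame_inverse_fourier rapid_smooth_inverse_fourier bump_low_pass)+

lemma fourier_lp_kernel: "fourier lp_kernel \<xi> = complex_of_real (low_pass \<xi>)"
  unfolding lp_kernel_def by (rule fourier_inverse_fourier[OF bump_low_pass])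

lemma lp_kernel_0_pos: "Re (lp_kernel 0) > 0"
proof -
  have i: "integrable lborel low_pass"
    using tame_integrable[OF bump_tame[OF bump_low_pass]] by (simp add: complex_of_real_integrable_eq)
  have "2 = (LINT \<xi>|lborel. indicator {-1..1::real} \<xi> :: real)" by simp
  also have "\<dots> \<le> (LINT \<xi>|lborel. low_pass \<xi>)"
  proof (rule integral_mono)
    show "integrable lborel (indicator {-1..1::real} :: real \<Rightarrow> real)" by simp
  qed (auto simp: i low_pass_inner low_pass_range indicator_def)
  also have "\<dots> = Re (lp_kernel 0)" by (simp add: lp_kernel_def inverse_fourier_eq)
  finally show ?thesis by simp
qed

lemma l2_lp_kernel_pos: "l2 lp_kernel > 0"
proof -
  have "(\<integral>\<^sup>+\<xi>. indicator {-1..1::real} \<xi> \<partial>lborel) \<le> (\<integral>\<^sup>+\<xi>. ennreal ((cmod (fourier lp_kernel \<xi>))\<^sup>2) \<partial>lborel)"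
    by (intro nn_integral_mono) (auto simp: fourier_lp_kernel low_pass_inner indicator_def)
  then have "2 \<le> ennreal ((l2 lp_kernel)\<^sup>2)" by (simp add: plancherel_l2 tame_lp_kernel)
  then have "l2 lp_kernel \<noteq> 0" by auto
  with l2_nonneg[of lp_kernel] show ?thesis by linarith
qed

text \<open>The factor \<open>\<kappa>\<^sup>2\<close> is nonnegative, so that the modulus has its only kink at the origin. The
frequency shift by \<open>6\<close> puts the spectrum into \<open>[2, 10]\<close>, where filter number \<open>1\<close> is transparent. The
shift is a complex modulation because a real function without low frequencies changes sign infinitely
often, so that its modulus would have many interfering kinks.\<close>

definition signal :: "real \<Rightarrow> complex" where
  "signal x = complex_of_real x * lp_kernel x * (lp_kernel x * cis (12 * pi * x))"

lemma times_lp_kernel_eq_inverse_fourier: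
  "\<exists>b. bump b \<and> (\<forall>x. complex_of_real x * lp_kernel x = inverse_fourier b x) \<and> (\<forall>x. \<bar>x\<bar> > 2 \<longrightarrow> b x = 0)"
proof -
  from bump_deriv[OF bump_low_pass] obtain b' where b': 
    "\<And>x. ((\<lambda>\<xi>. complex_of_real (low_pass \<xi>)) has_vector_derivative b' x) (at x)" "bump b'"
    "\<And>r x. (\<And>y. \<bar>y\<bar> > r \<Longrightarrow> complex_of_real (low_pass y) = 0) \<Longrightarrow> \<bar>x\<bar> > r \<Longrightarrow> b' x = 0" by blast
  show ?thesis
  proof (intro exI[of _ "\<lambda>\<xi>. \<i> / (2 * pi) * b' \<xi>"] conjI allI impI)
    show "bump (\<lambda>\<xi>. \<i> / (2 * pi) * b' \<xi>)" by (intro bump_smooth_mult b' smooth_const)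
    show "complex_of_real x * lp_kernel x = inverse_fourier (\<lambda>\<xi>. \<i> / (2 * pi) * b' \<xi>) x" for x
      unfolding lp_kernel_def by (rule inverse_fourier_times[OF bump_low_pass b'(1,2)]) (rule b'(3))
    show "\<i> / (2 * pi) * b' x = 0" if "\<bar>x\<bar> > 2" for x
      using b'(3)[of 2 x] that low_pass_outer by auto
  qed
qed

lemma lp_kernel_modulated: "lp_kernel x * cis (12 * pi * x) = inverse_fourier (\<lambda>\<xi>. complex_of_real (low_pass ((\<xi> - 6) / 1))) x"
  by (subst inverse_fourier_affine) (simp_all add: lp_kernel_def mult.commute)

lemma bump_low_pass_shift: "bump (\<lambda>\<xi>. complex_of_real (low_pass ((\<xi> - 6) / 1)))"
  unfolding bump_def
proof (intro conjI exI[of _ 8] allI impI)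
  show "smooth (\<lambda>\<xi>. complex_of_real (low_pass ((\<xi> - 6) / 1)))"
    by (rule smooth_of_real[OF smooth_affine[OF smooth_low_pass]])
  show "complex_of_real (low_pass ((\<xi> - 6) / 1)) = 0" if "\<bar>\<xi>\<bar> > 8" for \<xi>
    using that low_pass_outer[of "\<xi> - 6"] by simp
qed

lemma rapid_smooth_signal: "rapid_smooth signal"
proof -
  obtain b where b: "bump b" "\<And>x. complex_of_real x * lp_kernel x = inverse_fourier b x"
      using times_lp_kernel_eq_inverse_fourier by blast
  show ?thesis unfolding signal_def[abs_def] b(2) lp_kernel_modulated
    by (intro rapid_smooth_mult rapid_smooth_inverse_fourier b bump_low_pass_shift)
qed

lemma tame_signal: "tame signal" by (intro rapid_smooth_tame rapid_smooth_signal)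

lemma fourier_signal_eq_0:
  assumes "\<xi> < 2 \<or> \<xi> > 10" shows "fourier signal \<xi> = 0"
proof -
  obtain b where b: "bump b" "\<And>x. complex_of_real x * lp_kernel x = inverse_fourier b x" "\<And>x. \<bar>x\<bar> > 2 \<Longrightarrow> b x = 0"
    using times_lp_kernel_eq_inverse_fourier by blast
  show ?thesis unfolding signal_def[abs_def] b(2) lp_kernel_modulated
  proof (rule fourier_inverse_fourier_mult_eq_0[OF b(1) bump_low_pass_shift])
    fix t
    show "b t = 0 \<or> complex_of_real (low_pass ((\<xi> - t - 6) / 1)) = 0"
    proof (cases "\<bar>t\<bar> > 2")
      case False
      then have "\<bar>\<xi> - t - 6\<bar> \<ge> 2" using assms by linarith
      from low_pass_outer[OF this] show ?thesis by simp
    qed (simp add: b)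
  qed
qed

lemma cmod_signal: "cmod (signal x) = \<bar>x\<bar> * (cmod (lp_kernel x))\<^sup>2"
  by (simp add: signal_def norm_mult power2_eq_square)

definition kink_const :: real where "kink_const = (Re (lp_kernel 0))\<^sup>2 / (2 * pi\<^sup>2)"

lemma kink_const_pos: "kink_const > 0"
  using lp_kernel_0_pos by (simp add: kink_const_def)

text \<open>The modulus is \<open>\<bar>x\<bar> \<kappa>(x)\<^sup>2\<close>, an even function; each half-line contributes the
value of the derivative of \<open>x \<kappa>(x)\<^sup>2\<close> at \<open>0\<close> to the leading coefficient.\<close>

lemma fourier_modulus_signal:
  "\<exists>C\<ge>0. \<forall>\<xi>>0. cmod (fourier (\<lambda>x. complex_of_real (cmod (signal x))) \<xi> + kink_const / \<xi>\<^sup>2) \<le> C / \<xi> ^ 3"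
proof -
  let ?g = "\<lambda>x. complex_of_real (cmod (signal x))"
  define F where "F x = complex_of_real x * (lp_kernel x * lp_kernel x)" for x
  have F: "rapid_smooth F"
  proof -
    obtain b where b: "bump b" "\<And>x. complex_of_real x * lp_kernel x = inverse_fourier b x"
      using times_lp_kernel_eq_inverse_fourier by blast
    then have "F = (\<lambda>x. inverse_fourier b x * lp_kernel x)" by (auto simp: F_def fun_eq_iff simp flip: mult.assoc)
    with b show ?thesis by (auto intro: rapid_smooth_mult rapid_smooth_inverse_fourier rapid_smooth_lp_kernel)
  qed
  obtain F' where F': "\<And>x. (F has_vector_derivative F' x) (at x)" using rapid_smooth_deriv[OF F] by blast
  have "F' 0 = lp_kernel 0 * lp_kernel 0"
  proof -
    obtain K' where K: "\<And>x. ((\<lambda>x. lp_kernel x * lp_kernel x) has_vector_derivative K' x) (at x)"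
      using rapid_smooth_deriv[OF rapid_smooth_mult[OF rapid_smooth_lp_kernel rapid_smooth_lp_kernel]] by blast
    have "(complex_of_real has_vector_derivative of_real 1) (at 0)"
      by (rule has_vector_derivative_of_real) simp
    from has_vector_derivative_mult[OF this K] have "(F has_vector_derivative lp_kernel 0 * lp_kernel 0) (at 0)"
      unfolding F_def by simp
    with F'[of 0] show ?thesis by (rule vector_derivative_unique_at)
  qed
  then have F'0: "F' 0 = complex_of_real ((Re (lp_kernel 0))\<^sup>2)"
    by (metis lp_kernel_real of_real_mult power2_eq_square)
  have "F 0 = 0" by (simp add: F_def)
  from half_ft_kink[OF F F' this] obtain C where C: "C \<ge> 0"
    "\<And>\<omega>. \<omega> \<noteq> 0 \<Longrightarrow> cmod (half_ft F \<omega> + F' 0 / \<omega>\<^sup>2) \<le> C / \<bar>\<omega>\<bar> ^ 3" by blast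
  have split: "fourier ?g \<xi> = half_ft F (2 * pi * \<xi>) + half_ft F (- (2 * pi * \<xi>))" for \<xi>
  proof -
    let ?h = "\<lambda>x. ?g x * cis (- (2 * pi * \<xi>) * x)"
    have h: "tame ?h" by (intro tame_cis tame_modulus tame_signal)
    have ind: "integrable lborel (\<lambda>x. indicator S x *\<^sub>R ?h x)" if "S \<in> sets borel" for S
      using that tame_measurable[OF h]
      by (intro Bochner_Integration.integrable_bound[OF tame_integrable[OF h]]) (auto simp: indicator_def)
    have "fourier ?g \<xi> = (LINT x|lborel. indicator {0..} x *\<^sub>R ?h x + indicator {..<0} x *\<^sub>R ?h x)"
      unfolding fourier_def by (intro Bochner_Integration.integral_cong refl) (auto simp: indicator_def)
    also have "\<dots> = (LINT x|lborel. indicator {0..} x *\<^sub>R ?h x) + (LINT x|lborel. indicator {..<0} x *\<^sub>R ?h x)"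
      by (intro Bochner_Integration.integral_add ind) auto
    also have "(LINT x|lborel. indicator {0..} x *\<^sub>R ?h x) = half_ft F (2 * pi * \<xi>)"
      unfolding half_ft_def F_def
      by (intro Bochner_Integration.integral_cong refl) (auto simp: indicator_def cmod_signal lp_kernel_square)
    also have "(LINT x|lborel. indicator {..<0} x *\<^sub>R ?h x)
      = (LINT x|lborel. indicator {..<0} (0 + (-1) * x) *\<^sub>R ?h (0 + (-1) * x))"
      using lborel_integral_real_affine[of "-1" "\<lambda>x. indicator {..<0} x *\<^sub>R ?h x" 0] by simp
    also have "\<dots> = half_ft F (- (2 * pi * \<xi>))"
      unfolding half_ft_def F_def
      by (intro Bochner_Integration.integral_cong refl) (auto simp: indicator_def cmod_signal lp_kernel_square lp_kernel_even)
    finally show ?thesis .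
  qed
  show ?thesis
  proof (intro exI[of _ "C"] conjI allI impI C(1))
    fix \<xi> :: real assume \<xi>: "\<xi> > 0"
    define w where "w = 2 * pi * \<xi>"
    have w: "w > 0" "w \<ge> 2 * \<xi>" using \<xi> pi_gt3 by (auto simp: w_def)
    have k: "kink_const / \<xi>\<^sup>2 = 2 * ((Re (lp_kernel 0))\<^sup>2 / w\<^sup>2)"
      using \<xi> by (simp add: kink_const_def w_def power_mult_distrib)
    have eq: "fourier ?g \<xi> + kink_const / \<xi>\<^sup>2 = (half_ft F w + F' 0 / w\<^sup>2) + (half_ft F (- w) + F' 0 / complex_of_real ((- w)\<^sup>2))"
      unfolding split w_def[symmetric] F'0 using arg_cong[OF k, of complex_of_real] by simp
    have "cmod (fourier ?g \<xi> + kink_const / \<xi>\<^sup>2) \<le> C / \<bar>w\<bar> ^ 3 + C / \<bar>- w\<bar> ^ 3"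
      unfolding eq by (rule order_trans[OF norm_triangle_ineq add_mono[OF C(2) C(2)]]) (use w in auto)
    also have "\<dots> = 2 * C / w ^ 3" using w by simp
    also have "\<dots> \<le> 2 * C / (2 * \<xi>) ^ 3" using w \<xi> C(1) by (intro divide_left_mono power_mono) auto
    also have "\<dots> \<le> C / \<xi> ^ 3" using \<xi> C(1) by (simp add: field_simps power_mult_distrib)
    finally show "cmod (fourier ?g \<xi> + kink_const / \<xi>\<^sup>2) \<le> C / \<xi> ^ 3" .
  qed
qed

section \<open>The modulus does not increase the derivative\<close>

lemma fourier_translate:
  "fourier (\<lambda>x. h (t + x)) \<xi> = cis (2 * pi * \<xi> * t) * fourier h \<xi>"
proof -
  have "fourier (\<lambda>x. h (t + x)) \<xi> = (LINT x|lborel. h (t + (- t + 1 * x)) * cis (- 2 * pi * \<xi> * (- t + 1 * x)))"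
    unfolding fourier_def
    using lborel_integral_real_affine[of 1 "\<lambda>x. h (t + x) * cis (- 2 * pi * \<xi> * x)" "- t"] by simp
  also have "\<dots> = (LINT x|lborel. cis (2 * pi * \<xi> * t) * (h x * cis (- 2 * pi * \<xi> * x)))"
  proof (intro Bochner_Integration.integral_cong refl)
    fix x
    have "cis (- 2 * pi * \<xi> * (- t + 1 * x)) = cis (2 * pi * \<xi> * t) * cis (- 2 * pi * \<xi> * x)"
      unfolding cis_mult by (simp add: algebra_simps)
    then show "h (t + (- t + 1 * x)) * cis (- 2 * pi * \<xi> * (- t + 1 * x)) = cis (2 * pi * \<xi> * t) * (h x * cis (- 2 * pi * \<xi> * x))"
      by simp
  qed
  finally show ?thesis unfolding fourier_def by simp
qed

lemma cmod_cis_minus_1: "(cmod (cis s - 1))\<^sup>2 = 4 * (sin (s / 2))\<^sup>2"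
proof -
  have "(cmod (cis s - 1))\<^sup>2 = 2 - 2 * cos s"
    using sin_cos_squared_add[of s] by (simp add: cmod_power2 power2_diff algebra_simps)
  then show ?thesis using cos_double_sin[of "s / 2"] by simp
qed

lemma plancherel_increment:
  assumes a: "tame a"
  shows "(\<integral>\<^sup>+\<xi>. ennreal ((2 * sin (pi * \<xi> * t))\<^sup>2 * (cmod (fourier a \<xi>))\<^sup>2) \<partial>lborel) = ennreal ((l2 (\<lambda>x. a (t + x) - a x))\<^sup>2)"
proof -
  have at: "tame (\<lambda>x. a (t + x))" using tame_affine[OF a, of 1 t] by simp
  have "(cmod (fourier (\<lambda>x. a (t + x) - a x) \<xi>))\<^sup>2 = (2 * sin (pi * \<xi> * t))\<^sup>2 * (cmod (fourier a \<xi>))\<^sup>2" for \<xi>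
  proof -
    have "fourier (\<lambda>x. a (t + x) - a x) \<xi> = (cis (2 * pi * \<xi> * t) - 1) * fourier a \<xi>"
      unfolding fourier_diff[OF tame_integrable[OF at] tame_integrable[OF a]] fourier_translate
      by (simp add: left_diff_distrib)
    then show ?thesis by (simp add: norm_mult power_mult_distrib cmod_cis_minus_1 mult_ac)
  qed
  then show ?thesis using plancherel_l2[OF tame_diff[OF at a]] by simp
qed

text \<open>The derivative of \<open>\<bar>a\<bar>\<close> is at most as large in \<open>L\<^sup>2\<close> as that of \<open>a\<close>, which the bandwidth
\<open>V\<close> controls: an increment of \<open>\<bar>a\<bar>\<close> is pointwise at most the corresponding increment of \<open>a\<close>; by the Plancherel identity
both are weighted integrals of squared transforms with weight \<open>4 sin\<^sup>2(\<pi> \<xi> t)\<close>. Divide by \<open>t\<^sup>2\<close> and let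
\<open>t\<close> tend to \<open>0\<close> with Fatou's lemma.\<close>

lemma modulus_derivative_bound:
  assumes a: "tame a" and V: "V \<ge> 0" and supp: "\<And>\<xi>. \<bar>\<xi>\<bar> > V \<Longrightarrow> fourier a \<xi> = 0"
  shows "(\<integral>\<^sup>+\<xi>. ennreal (\<xi>\<^sup>2 * (cmod (fourier (\<lambda>x. complex_of_real (cmod (a x))) \<xi>))\<^sup>2) \<partial>lborel) \<le> ennreal ((V * l2 a)\<^sup>2)"
proof -
  let ?g = "\<lambda>x. complex_of_real (cmod (a x))"
  have [measurable]: "a \<in> borel_measurable borel" using tame_measurable[OF a] .
  let ?t = "\<lambda>n. inverse (real (Suc n))"
  let ?s = "\<lambda>n \<xi>. (sin (pi * \<xi> * ?t n) / (pi * ?t n))\<^sup>2"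
  let ?G = "\<lambda>\<xi>. (cmod (fourier ?g \<xi>))\<^sup>2"
  have bound: "(\<integral>\<^sup>+\<xi>. ennreal (?s n \<xi> * ?G \<xi>) \<partial>lborel) \<le> ennreal ((V * l2 a)\<^sup>2)" for n
  proof -
    define t where "t = ?t n"
    have t: "t > 0" by (simp add: t_def)
    have at: "tame (\<lambda>x. a (t + x))" using tame_affine[OF a, of 1 t] by simp
    have "l2 (\<lambda>x. ?g (t + x) - ?g x) \<le> l2 (\<lambda>x. a (t + x) - a x)"
    proof (rule l2_mono)
      show "cmod (?g (t + x) - ?g x) \<le> cmod (a (t + x) - a x)" for x
        unfolding of_real_diff[symmetric] norm_of_real by (rule norm_triangle_ineq3)
    qed (intro tame_diff tame_modulus at a)+
    then have "(l2 (\<lambda>x. ?g (t + x) - ?g x))\<^sup>2 \<le> (l2 (\<lambda>x. a (t + x) - a x))\<^sup>2"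
      by (intro power_mono) auto
    then have "(\<integral>\<^sup>+\<xi>. ennreal ((2 * sin (pi * \<xi> * t))\<^sup>2 * ?G \<xi>) \<partial>lborel) \<le> (\<integral>\<^sup>+\<xi>. ennreal ((2 * sin (pi * \<xi> * t))\<^sup>2 * (cmod (fourier a \<xi>))\<^sup>2) \<partial>lborel)"
      unfolding plancherel_increment[OF tame_modulus[OF a]] plancherel_increment[OF a] by (rule ennreal_leI)
    also have "\<dots> \<le> (\<integral>\<^sup>+\<xi>. ennreal ((2 * pi * V * t)\<^sup>2) * ennreal ((cmod (fourier a \<xi>))\<^sup>2) \<partial>lborel)"
    proof (rule nn_integral_mono)
      fix \<xi>
      show "ennreal ((2 * sin (pi * \<xi> * t))\<^sup>2 * (cmod (fourier a \<xi>))\<^sup>2) \<le> ennreal ((2 * pi * V * t)\<^sup>2) * ennreal ((cmod (fourier a \<xi>))\<^sup>2)"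
      proof (cases "\<bar>\<xi>\<bar> > V")
        case False
        have "\<bar>sin (pi * \<xi> * t)\<bar> \<le> \<bar>pi * \<xi> * t\<bar>" by (rule abs_sin_x_le_abs_x)
        also have "\<dots> \<le> pi * V * t" using False t V by (auto simp: abs_mult intro!: mult_right_mono mult_left_mono)
        finally have "(2 * sin (pi * \<xi> * t))\<^sup>2 \<le> (2 * pi * V * t)\<^sup>2"
          using V t by (intro abs_le_square_iff[THEN iffD1]) (auto simp: abs_mult)
        then show ?thesis by (simp add: mult_right_mono flip: ennreal_mult)
      qed (simp add: supp)
    qed
    also have "\<dots> = ennreal ((2 * pi * V * t)\<^sup>2) * ennreal ((l2 a)\<^sup>2)"
      by (subst nn_integral_cmult) (auto simp: plancherel_l2[OF a])
    finally have 1: "(\<integral>\<^sup>+\<xi>. ennreal ((2 * sin (pi * \<xi> * t))\<^sup>2 * ?G \<xi>) \<partial>lborel) \<le> ennreal ((2 * pi * V * t)\<^sup>2 * (l2 a)\<^sup>2)"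
      by (simp add: ennreal_mult)
    have "(\<integral>\<^sup>+\<xi>. ennreal ((sin (pi * \<xi> * t) / (pi * t))\<^sup>2 * ?G \<xi>) \<partial>lborel)
        = (\<integral>\<^sup>+\<xi>. ennreal (1 / (2 * pi * t)\<^sup>2) * ennreal ((2 * sin (pi * \<xi> * t))\<^sup>2 * ?G \<xi>) \<partial>lborel)"
      by (intro nn_integral_cong) (simp add: power_mult_distrib power_divide flip: ennreal_mult)
    also have "\<dots> = ennreal (1 / (2 * pi * t)\<^sup>2) * (\<integral>\<^sup>+\<xi>. ennreal ((2 * sin (pi * \<xi> * t))\<^sup>2 * ?G \<xi>) \<partial>lborel)"
      by (rule nn_integral_cmult) measurable
    also have "\<dots> \<le> ennreal (1 / (2 * pi * t)\<^sup>2) * ennreal ((2 * pi * V * t)\<^sup>2 * (l2 a)\<^sup>2)"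
      by (intro mult_left_mono 1) auto
    also have "\<dots> = ennreal ((V * l2 a)\<^sup>2)"
      using t by (simp add: power_mult_distrib flip: ennreal_mult)
    finally show ?thesis by (simp add: t_def)
  qed
  have lim: "(\<lambda>n. ennreal (?s n \<xi> * ?G \<xi>)) \<longlonglongrightarrow> ennreal (\<xi>\<^sup>2 * ?G \<xi>)" for \<xi>
  proof (intro tendsto_ennrealI tendsto_mult tendsto_const)
    have "((\<lambda>t. sin (pi * \<xi> * t)) has_real_derivative pi * \<xi>) (at 0)"
      by (auto intro!: derivative_eq_intros)
    then have "((\<lambda>h. sin (pi * \<xi> * h) / h) \<longlongrightarrow> pi * \<xi>) (at 0)"
      by (simp add: DERIV_def)
    moreover have "filterlim ?t (at 0) sequentially"
      by (intro filterlim_atI LIMSEQ_inverse_real_of_nat) auto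
    ultimately have "(\<lambda>n. sin (pi * \<xi> * ?t n) / ?t n) \<longlonglongrightarrow> pi * \<xi>" by (rule filterlim_compose)
    then have "(\<lambda>n. (sin (pi * \<xi> * ?t n) / ?t n / pi)\<^sup>2) \<longlonglongrightarrow> (pi * \<xi> / pi)\<^sup>2" by (intro tendsto_intros) auto
    then show "(\<lambda>n. ?s n \<xi>) \<longlonglongrightarrow> \<xi>\<^sup>2" by (simp add: mult.commute)
  qed
  have "(\<integral>\<^sup>+\<xi>. ennreal (\<xi>\<^sup>2 * ?G \<xi>) \<partial>lborel) = (\<integral>\<^sup>+\<xi>. liminf (\<lambda>n. ennreal (?s n \<xi> * ?G \<xi>)) \<partial>lborel)"
    by (intro nn_integral_cong lim_imp_Liminf[symmetric] lim) simp
  also have "\<dots> \<le> liminf (\<lambda>n. \<integral>\<^sup>+\<xi>. ennreal (?s n \<xi> * ?G \<xi>) \<partial>lborel)"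
    by (rule nn_integral_liminf) measurable
  also have "\<dots> \<le> liminf (\<lambda>n::nat. ennreal ((V * l2 a)\<^sup>2))"
    by (intro Liminf_mono always_eventually allI bound)
  also have "\<dots> = ennreal ((V * l2 a)\<^sup>2)" by (simp add: Liminf_const)
  finally show ?thesis .
qed

section \<open>The filter bank\<close>

text \<open>In band \<open>j\<close> the lower edge, the width of the bump spectrum and the centre of the narrow filter
are separated by factors of order \<open>4\<^sup>j\<close>. This beats a polynomial number of repetitions, while all three
remain \<open>2\<close> to a power of order \<open>j\<^sup>2\<close>, which a root of order \<open>j\<^sup>3\<close> makes harmless. The linear
terms in the exponents are chosen such that the next band starts at exactly twice the centre.\<close>

definition band_edge :: "nat \<Rightarrow> real" where "band_edge j = 2 ^ (2 * j\<^sup>2 + 4 * j)"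
definition packet_width :: "nat \<Rightarrow> real" where "packet_width j = band_edge j * 2 ^ (2 * j + 2)"
definition packet_center :: "nat \<Rightarrow> real" where "packet_center j = packet_width j * 2 ^ (2 * j + 3)"

lemma band_edge_0: "band_edge 0 = 1" by (simp add: band_edge_def)

lemma band_edge_Suc: "band_edge (Suc j) = 2 * packet_center j"
  by (simp add: band_edge_def packet_center_def packet_width_def power_add[symmetric] power2_eq_square algebra_simps flip: power_Suc)

lemma band_edge_ge_1: "band_edge j \<ge> 1" by (simp add: band_edge_def)

lemma packet_width_ge: "packet_width j \<ge> 4 * band_edge j"
proof -
  have "(2::real) ^ (2 * j + 2) = 4 * 4 ^ j" by (simp add: power_add power_mult)
  moreover have "(4::real) ^ j \<ge> 1" by simp
  ultimately have "(2::real) ^ (2 * j + 2) \<ge> 4" by linarith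
  then have "band_edge j * 4 \<le> band_edge j * 2 ^ (2 * j + 2)" using band_edge_ge_1[of j] by (intro mult_left_mono) auto
  then show ?thesis by (simp add: packet_width_def mult.commute)
qed

lemma packet_width_ge_1: "packet_width j \<ge> 1" using packet_width_ge[of j] band_edge_ge_1[of j] by linarith

lemma packet_center_ge: "packet_center j \<ge> 8 * packet_width j"
proof -
  have "(2::real) ^ (2 * j + 3) = 8 * 4 ^ j" by (simp add: power_add power_mult)
  moreover have "(4::real) ^ j \<ge> 1" by simp
  ultimately have "(2::real) ^ (2 * j + 3) \<ge> 8" by linarith
  then have "packet_width j * 8 \<le> packet_width j * 2 ^ (2 * j + 3)" using packet_width_ge_1[of j] by (intro mult_left_mono) auto
  then show ?thesis by (simp add: packet_center_def mult.commute)
qed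

lemma band_edge_le_packet_width: "band_edge j \<le> packet_width j / 4 ^ j"
proof -
  have "(2::real) ^ (2 * j + 2) = 4 * 4 ^ j" by (simp add: power_add power_mult)
  then show ?thesis using band_edge_ge_1[of j] by (simp add: packet_width_def)
qed

lemma packet_width_le_packet_center: "packet_width j \<le> packet_center j / 4 ^ j"
proof -
  have "(2::real) ^ (2 * j + 3) = 8 * 4 ^ j" by (simp add: power_add power_mult)
  then show ?thesis using packet_width_ge_1[of j] by (simp add: packet_center_def)
qed

lemma band_edge_Suc_ge: "band_edge (Suc j) \<ge> 2 * band_edge j"
  using band_edge_Suc[of j] packet_center_ge[of j] packet_width_ge[of j] band_edge_ge_1[of j] by linarith

lemma band_edge_ge_index: "band_edge j \<ge> real j"
proof -
  have "real j \<le> 2 ^ j" by (simp add: less_imp_le)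
  also have "\<dots> \<le> band_edge j" unfolding band_edge_def by (intro power_increasing) auto
  finally show ?thesis .
qed

definition band :: "nat \<Rightarrow> real \<Rightarrow> real" where
  "band j \<xi> = high_pass (\<xi> / band_edge j) * low_pass (\<xi> / band_edge (Suc j))"

text \<open>Each band is split into a narrow filter (even index), one-sided and centred at
\<open>packet_center\<close>, and a wide filter (odd index) consisting of the rest of the band.\<close>

definition response :: "nat \<Rightarrow> real \<Rightarrow> real" where
  "response l \<xi> = (let j = l div 2 in
     band j \<xi> * (if even l then low_pass ((\<xi> - packet_center j) / packet_width j) else high_pass ((\<xi> - packet_center j) / packet_width j)))"

definition filt :: "nat \<Rightarrow> real \<Rightarrow> complex" where
  "filt l = inverse_fourier (\<lambda>\<xi>. complex_of_real (response l \<xi>))"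

lemma band_range: "0 \<le> band j \<xi>" "band j \<xi> \<le> 1"
  using low_pass_range[of "\<xi> / band_edge (Suc j)"] high_pass_range[of "\<xi> / band_edge j"] by (auto simp: band_def mult_le_one)

lemma response_range: "0 \<le> response l \<xi>" "response l \<xi> \<le> 1"
  using band_range[of "l div 2" \<xi>] low_pass_range high_pass_range by (auto simp: response_def Let_def intro: mult_le_one)

lemma bump_response: "bump (\<lambda>\<xi>. complex_of_real (response l \<xi>))"
  unfolding bump_def
proof (intro conjI exI[of _ "2 * band_edge (Suc (l div 2))"] allI impI)
  have low0: "smooth (\<lambda>x. low_pass (x / w))" and high0: "smooth (\<lambda>x. high_pass (x / w))" for w
    using smooth_affine[OF smooth_low_pass, of 0 w] smooth_affine[OF smooth_high_pass, of 0 w] by auto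
  have "smooth (\<lambda>\<xi>. if even l then low_pass ((\<xi> - packet_center (l div 2)) / packet_width (l div 2)) else high_pass ((\<xi> - packet_center (l div 2)) / packet_width (l div 2)))"
    by (cases "even l") (simp_all add: smooth_affine smooth_low_pass smooth_high_pass)
  then show "smooth (\<lambda>\<xi>. complex_of_real (response l \<xi>))"
    unfolding response_def Let_def band_def
    by (intro smooth_of_real) (rule smooth_mult[OF smooth_mult[OF high0 low0]])
  fix \<xi> assume x: "\<bar>\<xi>\<bar> > 2 * band_edge (Suc (l div 2))"
  then have "\<bar>\<xi> / band_edge (Suc (l div 2))\<bar> \<ge> 2" using band_edge_ge_1[of "Suc (l div 2)"] by (simp add: field_simps abs_divide)
  from low_pass_outer[OF this] show "complex_of_real (response l \<xi>) = 0" by (simp add: response_def Let_def band_def)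
qed

lemma fourier_filt: "fourier (filt l) \<xi> = complex_of_real (response l \<xi>)"
  unfolding filt_def by (rule fourier_inverse_fourier[OF bump_response])

lemma tame_filt: "tame (filt l)" unfolding filt_def by (rule tame_inverse_fourier[OF bump_response])

lemma cmod_fourier_filt: "cmod (fourier (filt l) \<xi>) \<le> 1"
  using response_range by (simp add: fourier_filt)

text \<open>The sum telescopes: wherever the upper cutoff of a band is active, its lower cutoff is already
\<open>1\<close>, because consecutive edges differ by a factor of at least \<open>2\<close>.\<close>

lemma sum_band: "(low_pass \<xi>)\<^sup>2 + (\<Sum>j<n. (band j \<xi>)\<^sup>2) = 1 - (high_pass (\<xi> / band_edge n))\<^sup>2"
proof (induction n)
  case 0
  then show ?case using low_pass_high_pass[of \<xi>] by (simp add: band_edge_0)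
next
  case (Suc n)
  have "(band n \<xi>)\<^sup>2 = (high_pass (\<xi> / band_edge n))\<^sup>2 - (high_pass (\<xi> / band_edge (Suc n)))\<^sup>2"
  proof (cases "\<bar>\<xi>\<bar> \<le> band_edge (Suc n)")
    case True
    then have "\<bar>\<xi> / band_edge (Suc n)\<bar> \<le> 1" using band_edge_ge_1[of "Suc n"] by (simp add: abs_divide)
    from low_pass_inner[OF this] high_pass_inner[OF this] show ?thesis by (simp add: band_def)
  next
    case False
    then have "\<bar>\<xi> / band_edge n\<bar> \<ge> 2" using band_edge_ge_1[of n] band_edge_Suc_ge[of n] by (simp add: abs_divide field_simps)
    from high_pass_outer[OF this] show ?thesis using low_pass_high_pass[of "\<xi> / band_edge (Suc n)"] by (simp add: band_def power_mult_distrib)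
  qed
  with Suc show ?case by simp
qed

lemma sum_response: "(\<Sum>l<2 * n. (response l \<xi>)\<^sup>2) = (\<Sum>j<n. (band j \<xi>)\<^sup>2)"
proof (induction n)
  case (Suc n)
  have "(response (2 * n) \<xi>)\<^sup>2 + (response (Suc (2 * n)) \<xi>)\<^sup>2 = (band n \<xi>)\<^sup>2 * ((low_pass ((\<xi> - packet_center n) / packet_width n))\<^sup>2 + (high_pass ((\<xi> - packet_center n) / packet_width n))\<^sup>2)"
    by (simp add: response_def Let_def power_mult_distrib distrib_left)
  also have "\<dots> = (band n \<xi>)\<^sup>2" by (simp add: low_pass_high_pass)
  finally show ?case using Suc by simp
qed simp

lemma sum_response_le_1: "(\<Sum>l<n. (response l \<xi>)\<^sup>2) \<le> 1"
proof -
  have "(\<Sum>l<n. (response l \<xi>)\<^sup>2) \<le> (\<Sum>l<2 * n. (response l \<xi>)\<^sup>2)" by (intro sum_mono2) auto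
  also have "\<dots> \<le> 1"
    using sum_band[of \<xi> n] zero_le_power2[of "low_pass \<xi>"] zero_le_power2[of "high_pass (\<xi> / band_edge n)"]
    unfolding sum_response by linarith
  finally show ?thesis .
qed

text \<open>At each frequency only finitely many bands are active.\<close>

lemma has_sum_response: "((\<lambda>l. (response l \<xi>)\<^sup>2) has_sum (1 - (low_pass \<xi>)\<^sup>2)) UNIV"
proof -
  obtain n :: nat where n: "\<bar>\<xi>\<bar> \<le> real n" using real_arch_simple by blast
  have z: "high_pass (\<xi> / band_edge j) = 0" if "j \<ge> n" for j
  proof (rule high_pass_inner)
    have "\<bar>\<xi>\<bar> \<le> band_edge j" using n that band_edge_ge_index[of j] by (meson of_nat_le_iff order_trans)
    then show "\<bar>\<xi> / band_edge j\<bar> \<le> 1" using band_edge_ge_1[of j] by (simp add: abs_divide)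
  qed
  have "((\<lambda>l. (response l \<xi>)\<^sup>2) has_sum (\<Sum>l<2 * n. (response l \<xi>)\<^sup>2)) UNIV"
    by (rule has_sum_finite_neutralI) (auto simp: response_def Let_def band_def z)
  moreover have "(\<Sum>l<2 * n. (response l \<xi>)\<^sup>2) = 1 - (low_pass \<xi>)\<^sup>2"
    using sum_band[of \<xi> n] z[of n] unfolding sum_response by simp
  ultimately show ?thesis by simp
qed

lemma in_L1_L2_tame: "tame h \<Longrightarrow> in_L1 h \<and> in_L2 h"
  using tame_measurable[of h] by (simp add: in_L1_def in_L2_def tame_integrable tame_square_integrable)

lemma scattering_filter_bank_filt: "scattering_filter_bank lp_kernel UNIV filt"
  unfolding scattering_filter_bank_def
proof (intro conjI ballI AE_I2)
  show "in_L1 lp_kernel" "in_L2 lp_kernel" using in_L1_L2_tame[OF tame_lp_kernel] by auto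
  show "in_L1 (filt l)" "in_L2 (filt l)" for l using in_L1_L2_tame[OF tame_filt] by auto
  show "(\<lambda>l. (cmod (fourier (filt l) \<xi>))\<^sup>2) summable_on UNIV" for \<xi>
    using has_sum_response[of \<xi>] by (auto simp: fourier_filt summable_on_def)
  show "(cmod (fourier lp_kernel \<xi>))\<^sup>2 + (\<Sum>\<^sub>\<infinity>l\<in>UNIV. (cmod (fourier (filt l) \<xi>))\<^sup>2) = 1" for \<xi>
    using infsumI[OF has_sum_response[of \<xi>]] by (simp add: fourier_filt fourier_lp_kernel)
qed (auto simp: fourier_lp_kernel low_pass_inner)

lemma band_limitedI: "(\<And>\<xi>. \<bar>\<xi>\<bar> > r \<Longrightarrow> fourier h \<xi> = 0) \<Longrightarrow> band_limited h"
  unfolding band_limited_def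
  by (intro compact_closure[THEN iffD2] bounded_subset[OF bounded_closed_interval[of "-r" r]])
    (force simp: not_less[symmetric])

lemma band_limited_inverse_fourier: "bump b \<Longrightarrow> band_limited (inverse_fourier b)"
  using fourier_inverse_fourier[of b] unfolding bump_def by (metis band_limitedI bump_def)

section \<open>A path that loses almost no energy\<close>

lemma nn_integral_le_const_on_interval:
  assumes "\<And>\<xi>. f \<xi> \<le> c" "\<And>\<xi>. \<xi> \<notin> {a..b} \<Longrightarrow> f \<xi> = 0" "c \<ge> 0" "a \<le> (b::real)"
  shows "(\<integral>\<^sup>+\<xi>. ennreal (f \<xi>) \<partial>lborel) \<le> ennreal (c * (b - a))"
proof -
  have "(\<integral>\<^sup>+\<xi>. ennreal (f \<xi>) \<partial>lborel) \<le> (\<integral>\<^sup>+\<xi>. ennreal c * indicator {a..b} \<xi> \<partial>lborel)"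
    using assms(1,2) by (intro nn_integral_mono) (auto simp: indicator_def intro: ennreal_leI)
  also have "\<dots> = ennreal (c * (b - a))"
    using assms(3,4) by (simp add: nn_integral_cmult_indicator ennreal_mult)
  finally show ?thesis .
qed

lemma wide_eq_1:
  assumes "2 * band_edge j \<le> \<bar>\<xi>\<bar>" "\<bar>\<xi>\<bar> \<le> packet_center j / 2"
  shows "response (2 * j + 1) \<xi> = 1"
proof -
  have r: "band_edge j \<ge> 1" "packet_width j \<ge> 1" "packet_center j \<ge> 8 * packet_width j" "band_edge (Suc j) = 2 * packet_center j"
    using band_edge_ge_1 packet_width_ge_1 packet_center_ge band_edge_Suc by auto
  have 1: "\<bar>\<xi> / band_edge j\<bar> \<ge> 2" using assms r by (simp add: abs_divide field_simps)
  have 2: "\<bar>\<xi> / band_edge (Suc j)\<bar> \<le> 1" using assms r by (simp add: abs_divide field_simps)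
  have "\<bar>\<xi> - packet_center j\<bar> \<ge> 2 * packet_width j" using assms r by linarith
  then have 3: "\<bar>(\<xi> - packet_center j) / packet_width j\<bar> \<ge> 2" using r by (simp add: abs_divide field_simps)
  show ?thesis unfolding response_def band_def Let_def
    using high_pass_outer[OF 1] low_pass_inner[OF 2] high_pass_outer[OF 3] by simp
qed

text \<open>The narrow filter lives where its band is identically \<open>1\<close>.\<close>

lemma narrow_eq: "response (2 * j) \<xi> = low_pass ((\<xi> - packet_center j) / packet_width j)"
proof (cases "\<bar>\<xi> - packet_center j\<bar> \<ge> 2 * packet_width j")
  case True
  then have "\<bar>(\<xi> - packet_center j) / packet_width j\<bar> \<ge> 2" using packet_width_ge_1[of j] by (simp add: abs_divide field_simps)
  from low_pass_outer[OF this] show ?thesis by (simp add: response_def Let_def)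
next
  case False
  have r: "band_edge j \<ge> 1" "packet_width j \<ge> 4 * band_edge j" "packet_center j \<ge> 8 * packet_width j" "band_edge (Suc j) = 2 * packet_center j"
    using band_edge_ge_1 packet_width_ge packet_center_ge band_edge_Suc by auto
  have 1: "\<bar>\<xi> / band_edge j\<bar> \<ge> 2" using False r by (simp add: abs_divide field_simps)
  have 2: "\<bar>\<xi> / band_edge (Suc j)\<bar> \<le> 1" using False r by (simp add: abs_divide field_simps)
  show ?thesis unfolding response_def band_def Let_def
    using high_pass_outer[OF 1] low_pass_inner[OF 2] by simp
qed

text \<open>The modulus of the inverse transform of \<open>- c / S\<^sup>2\<close> times the cutoff of width \<open>W\<close> centred at
\<open>S\<close>; replacing the centre \<open>S\<close> of the cutoff by \<open>0\<close> does not change it.\<close>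

definition profile :: "nat \<Rightarrow> real \<Rightarrow> complex" where
  "profile j x = complex_of_real (kink_const / (packet_center j)\<^sup>2 * packet_width j * cmod (lp_kernel (packet_width j * x)))"

text \<open>The order of magnitude of the \<open>L\<^sup>2\<close> norm of \<open>profile j\<close>.\<close>

definition amplitude :: "nat \<Rightarrow> real" where "amplitude j = sqrt (packet_width j) / (packet_center j)\<^sup>2"

lemma bump_low_pass_affine: "w > 0 \<Longrightarrow> bump (\<lambda>\<xi>. c * complex_of_real (low_pass ((\<xi> - s) / w)))"
proof -
  assume w: "w > 0"
  have "bump (\<lambda>\<xi>. complex_of_real (low_pass ((\<xi> - s) / w)))"
    unfolding bump_def
  proof (intro conjI exI[of _ "\<bar>s\<bar> + 2 * w"] allI impI)
    show "smooth (\<lambda>\<xi>. complex_of_real (low_pass ((\<xi> - s) / w)))"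
      by (rule smooth_of_real[OF smooth_affine[OF smooth_low_pass]])
    fix \<xi> assume "\<bar>\<xi>\<bar> > \<bar>s\<bar> + 2 * w"
    then have "\<bar>(\<xi> - s) / w\<bar> \<ge> 2" using w by (simp add: abs_divide field_simps)
    from low_pass_outer[OF this] show "complex_of_real (low_pass ((\<xi> - s) / w)) = 0" by simp
  qed
  then show ?thesis by (rule bump_smooth_mult[OF _ smooth_const])
qed

lemma inverse_fourier_low_pass_affine:
  "w > 0 \<Longrightarrow> inverse_fourier (\<lambda>\<xi>. c * complex_of_real (low_pass ((\<xi> - s) / w))) x = c * (w * cis (2 * pi * s * x) * lp_kernel (w * x))"
  using inverse_fourier_affine[of w "\<lambda>\<xi>. complex_of_real (low_pass \<xi>)" s x] fourier_cmult[of c]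
  by (simp add: inverse_fourier_def lp_kernel_def)

lemma profile_eq_cmod:
  "profile j x = complex_of_real (cmod (inverse_fourier (\<lambda>\<xi>. complex_of_real (- (kink_const / (packet_center j)\<^sup>2)) * complex_of_real (low_pass ((\<xi> - packet_center j) / packet_width j))) x))"
  "profile j x = complex_of_real (cmod (inverse_fourier (\<lambda>\<xi>. complex_of_real (kink_const / (packet_center j)\<^sup>2) * complex_of_real (low_pass ((\<xi> - 0) / packet_width j))) x))"
proof -
  have w: "packet_width j > 0" using packet_width_ge_1[of j] by linarith
  have k: "\<bar>- (kink_const / (packet_center j)\<^sup>2)\<bar> = kink_const / (packet_center j)\<^sup>2" "\<bar>kink_const / (packet_center j)\<^sup>2\<bar> = kink_const / (packet_center j)\<^sup>2"
    "\<bar>packet_width j\<bar> = packet_width j" using kink_const_pos w by auto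
  show "profile j x = complex_of_real (cmod (inverse_fourier (\<lambda>\<xi>. complex_of_real (- (kink_const / (packet_center j)\<^sup>2)) * complex_of_real (low_pass ((\<xi> - packet_center j) / packet_width j))) x))"
    "profile j x = complex_of_real (cmod (inverse_fourier (\<lambda>\<xi>. complex_of_real (kink_const / (packet_center j)\<^sup>2) * complex_of_real (low_pass ((\<xi> - 0) / packet_width j))) x))"
    unfolding inverse_fourier_low_pass_affine[OF w] norm_mult norm_of_real norm_cis profile_def k
    by (simp_all only: mult_1_right mult.assoc)
qed

lemma cmod_profile: "cmod (profile j x) = kink_const / (packet_center j)\<^sup>2 * packet_width j * cmod (lp_kernel (packet_width j * x))"
  unfolding profile_def norm_of_real
  using kink_const_pos packet_width_ge_1[of j] by (intro abs_of_nonneg mult_nonneg_nonneg divide_nonneg_nonneg) auto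

lemma tame_profile: "tame (profile j)"
  unfolding profile_eq_cmod(1)[abs_def]
  using packet_width_ge_1[of j] by (intro tame_modulus tame_inverse_fourier bump_low_pass_affine) auto

lemma l2_profile: "l2 (profile j) = kink_const * l2 lp_kernel * amplitude j"
proof -
  have w: "packet_width j > 0" "packet_center j > 0" using packet_width_ge_1[of j] packet_center_ge[of j] by auto
  have "(LINT x|lborel. (cmod (lp_kernel x))\<^sup>2) = packet_width j * (LINT x|lborel. (cmod (lp_kernel (packet_width j * x)))\<^sup>2)"
    using lborel_integral_real_affine[of "packet_width j" "\<lambda>x. (cmod (lp_kernel x))\<^sup>2" 0] w by simp
  then have "(l2 lp_kernel)\<^sup>2 = packet_width j * (LINT x|lborel. (cmod (lp_kernel (packet_width j * x)))\<^sup>2)" by (simp add: l2_sq)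
  moreover have "(l2 (profile j))\<^sup>2 = (kink_const / (packet_center j)\<^sup>2 * packet_width j)\<^sup>2 * (LINT x|lborel. (cmod (lp_kernel (packet_width j * x)))\<^sup>2)"
    unfolding l2_sq cmod_profile power_mult_distrib by simp
  ultimately have "(l2 (profile j))\<^sup>2 = (kink_const * l2 lp_kernel * amplitude j)\<^sup>2"
    using w by (simp add: amplitude_def power_mult_distrib power_divide power2_eq_square[of "packet_width j"])
  moreover have "amplitude j \<ge> 0" using w by (simp add: amplitude_def)
  ultimately show ?thesis using kink_const_pos by (simp add: power2_eq_iff_nonneg)
qed

lemma profile_L1: "(LINT x|lborel. cmod (profile j x)) = kink_const / (packet_center j)\<^sup>2 * (LINT x|lborel. cmod (lp_kernel x))"
proof -
  have w: "packet_width j > 0" using packet_width_ge_1[of j] by auto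
  have "(LINT x|lborel. cmod (lp_kernel x)) = packet_width j * (LINT x|lborel. cmod (lp_kernel (packet_width j * x)))"
    using lborel_integral_real_affine[of "packet_width j" "\<lambda>x. cmod (lp_kernel x)" 0] w by simp
  then show ?thesis
    unfolding cmod_profile by simp
qed

text \<open>The spectrum of the signal lies in \<open>[2, 10]\<close>, where filter \<open>1\<close> has the value \<open>1\<close>.\<close>

lemma l2_first_step: "l2 (\<lambda>x. U1 filt 1 signal x - complex_of_real (cmod (signal x))) = 0"
proof -
  have c: "tame (convolution signal (filt 1))" by (intro tame_convolution tame_signal tame_filt)
  have "l2 (\<lambda>x. convolution signal (filt 1) x - signal x) \<le> 0"
  proof (rule l2_le_fourierI)
    have "fourier (\<lambda>x. convolution signal (filt 1) x - signal x) \<xi> = 0" for \<xi>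
    proof -
      have "fourier (\<lambda>x. convolution signal (filt 1) x - signal x) \<xi> = fourier signal \<xi> * complex_of_real (response 1 \<xi>) - fourier signal \<xi>"
        unfolding fourier_convolution_diff[OF tame_signal tame_filt tame_signal] fourier_filt ..
      also have "\<dots> = 0"
      proof (cases "\<xi> < 2 \<or> \<xi> > 10")
        case False
        then have "response 1 \<xi> = 1"
          using wide_eq_1[of 0 \<xi>] by (simp add: band_edge_def packet_width_def packet_center_def)
        then show ?thesis by simp
      qed (simp add: fourier_signal_eq_0)
      finally show ?thesis .
    qed
    then show "(\<integral>\<^sup>+\<xi>. ennreal ((cmod (fourier (\<lambda>x. convolution signal (filt 1) x - signal x) \<xi>))\<^sup>2) \<partial>lborel) \<le> ennreal (0\<^sup>2)"
      by simp
  qed (use c tame_signal in \<open>auto intro: tame_diff\<close>)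
  moreover have "l2 (\<lambda>x. U1 filt 1 signal x - complex_of_real (cmod (signal x))) \<le> l2 (\<lambda>x. convolution signal (filt 1) x - signal x)"
  proof (rule l2_mono)
    show "cmod (U1 filt 1 signal x - complex_of_real (cmod (signal x))) \<le> cmod (convolution signal (filt 1) x - signal x)" for x
      unfolding U1_def of_real_diff[symmetric] norm_of_real by (rule norm_triangle_ineq3)
  qed (intro tame_diff tame_U1 tame_modulus tame_signal tame_filt c)+
  ultimately show ?thesis using l2_nonneg[of "\<lambda>x. U1 filt 1 signal x - complex_of_real (cmod (signal x))"] by linarith
qed

text \<open>On the support of the narrow filter, the transform of the modulus of the signal differs
from the constant \<open>- c / S\<^sup>2\<close> by \<open>O(W / S\<^sup>3)\<close>: the kink asymptotics contribute \<open>O(1 / S\<^sup>3)\<close> and the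
variation of \<open>1 / \<xi>\<^sup>2\<close> the rest. Relative to \<open>profile j\<close> this is an error of order \<open>W / S\<close>.\<close>

lemma l2_narrow_step:
  "\<exists>D\<ge>0. \<forall>j. l2 (\<lambda>x. U1 filt (2 * j) (\<lambda>x. complex_of_real (cmod (signal x))) x - profile j x) \<le> D * amplitude j / 2 ^ j"
proof -
  let ?g = "\<lambda>x. complex_of_real (cmod (signal x))"
  obtain C where C: "C \<ge> 0" "\<And>\<xi>. \<xi> > 0 \<Longrightarrow> cmod (fourier ?g \<xi> + kink_const / \<xi>\<^sup>2) \<le> C / \<xi> ^ 3"
    using fourier_modulus_signal by blast
  \<comment> \<open>Both constants come from \<open>\<xi> \<ge> S / 2\<close> on the support of the narrow filter.\<close>
  define E where "E = 8 * C + 24 * kink_const"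
  have E: "E \<ge> 0" using C kink_const_pos by (simp add: E_def)
  have g: "tame ?g" by (intro tame_modulus tame_signal)
  show ?thesis
  proof (intro exI[of _ "2 * E"] conjI allI)
    show "2 * E \<ge> 0" using E by simp
    fix j
    define R W S where "R = band_edge j" and "W = packet_width j" and "S = packet_center j"
    have W: "W \<ge> 1" "S \<ge> 8 * W" "W \<le> S / 4 ^ j" using packet_width_ge_1 packet_center_ge packet_width_le_packet_center by (auto simp: W_def S_def)
    then have S: "S > 0" by linarith
    let ?b = "\<lambda>\<xi>. complex_of_real (- (kink_const / S\<^sup>2)) * complex_of_real (low_pass ((\<xi> - S) / W))"
    have b: "bump ?b" using W by (intro bump_low_pass_affine) auto
    let ?h = "convolution ?g (filt (2 * j))"
    have h: "tame ?h" by (intro tame_convolution g tame_filt)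
    have err: "(cmod (fourier (\<lambda>x. ?h x - inverse_fourier ?b x) \<xi>))\<^sup>2 \<le> (E * W / S ^ 3)\<^sup>2"
        "\<xi> \<notin> {S - 2 * W..S + 2 * W} \<Longrightarrow> (cmod (fourier (\<lambda>x. ?h x - inverse_fourier ?b x) \<xi>))\<^sup>2 = 0" for \<xi>
    proof -
      have eq: "fourier (\<lambda>x. ?h x - inverse_fourier ?b x) \<xi> = (fourier ?g \<xi> + kink_const / S\<^sup>2) * complex_of_real (low_pass ((\<xi> - S) / W))"
        unfolding fourier_convolution_diff[OF g tame_filt tame_inverse_fourier[OF b]] fourier_filt narrow_eq
          fourier_inverse_fourier[OF b] W_def[symmetric] S_def[symmetric] by (simp add: algebra_simps)
      have z: "fourier (\<lambda>x. ?h x - inverse_fourier ?b x) \<xi> = 0" if "\<xi> \<notin> {S - 2 * W..S + 2 * W}"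
      proof -
        have "\<bar>(\<xi> - S) / W\<bar> \<ge> 2" using that W by (auto simp: abs_divide field_simps)
        from low_pass_outer[OF this] show ?thesis unfolding eq by simp
      qed
      show "\<xi> \<notin> {S - 2 * W..S + 2 * W} \<Longrightarrow> (cmod (fourier (\<lambda>x. ?h x - inverse_fourier ?b x) \<xi>))\<^sup>2 = 0"
        using z by simp
      show "(cmod (fourier (\<lambda>x. ?h x - inverse_fourier ?b x) \<xi>))\<^sup>2 \<le> (E * W / S ^ 3)\<^sup>2"
      proof (cases "\<xi> \<in> {S - 2 * W..S + 2 * W}")
        case True
        then have x: "\<xi> \<ge> S / 2" "\<xi> \<le> 2 * S" "\<bar>S - \<xi>\<bar> \<le> 2 * W" using W by auto
        then have xp: "\<xi> > 0" using S by linarith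
        have t1: "cmod (fourier ?g \<xi> + kink_const / \<xi>\<^sup>2) \<le> 8 * C / S ^ 3"
        proof -
          have "C / \<xi> ^ 3 \<le> C / (S / 2) ^ 3"
            using x xp S C by (intro divide_left_mono power_mono) auto
          also have "\<dots> = 8 * C / S ^ 3" by (simp add: power_divide)
          finally show ?thesis using C(2)[OF xp] by linarith
        qed
        have t2: "\<bar>1 / S\<^sup>2 - 1 / \<xi>\<^sup>2\<bar> \<le> 24 * W / S ^ 3"
        proof -
          have "\<bar>1 / S\<^sup>2 - 1 / \<xi>\<^sup>2\<bar> = \<bar>S - \<xi>\<bar> * (S + \<xi>) / (S\<^sup>2 * \<xi>\<^sup>2)"
          proof -
            have "1 / S\<^sup>2 - 1 / \<xi>\<^sup>2 = (\<xi> - S) * (S + \<xi>) / (S\<^sup>2 * \<xi>\<^sup>2)"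
              using S xp by (simp add: field_simps power2_eq_square)
            then show ?thesis using S xp by (simp add: abs_mult abs_divide abs_minus_commute)
          qed
          also have "\<dots> \<le> (2 * W) * (3 * S) / (S\<^sup>2 * (S / 2)\<^sup>2)"
            using x xp S W by (intro frac_le mult_mono power_mono mult_left_mono) auto
          also have "\<dots> = 24 * W / S ^ 3" using S by (simp add: field_simps power2_eq_square power3_eq_cube)
          finally show ?thesis .
        qed
        have split: "fourier ?g \<xi> + kink_const / S\<^sup>2 = (fourier ?g \<xi> + kink_const / \<xi>\<^sup>2) + complex_of_real (kink_const * (1 / S\<^sup>2 - 1 / \<xi>\<^sup>2))"
          by (simp add: algebra_simps)
        have t3: "cmod (complex_of_real (kink_const * (1 / S\<^sup>2 - 1 / \<xi>\<^sup>2))) \<le> kink_const * (24 * W / S ^ 3)"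
          unfolding norm_of_real abs_mult using kink_const_pos
          by (intro mult_mono t2) auto
        have "cmod (fourier ?g \<xi> + kink_const / S\<^sup>2) \<le> 8 * C / S ^ 3 + kink_const * (24 * W / S ^ 3)"
          unfolding split by (rule order_trans[OF norm_triangle_ineq add_mono[OF t1 t3]])
        also have "\<dots> \<le> 8 * C * W / S ^ 3 + kink_const * (24 * W / S ^ 3)"
          using S C W by (intro add_mono divide_right_mono) (auto simp: mult_le_cancel_left1)
        also have "\<dots> = E * W / S ^ 3" by (simp add: E_def add_divide_distrib distrib_right)
        finally have "cmod (fourier ?g \<xi> + kink_const / S\<^sup>2) * \<bar>low_pass ((\<xi> - S) / W)\<bar> \<le> E * W / S ^ 3 * 1"
          using low_pass_range[of "(\<xi> - S) / W"] E W S by (intro mult_mono) auto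
        then show ?thesis unfolding eq by (intro power_mono) (auto simp: norm_mult)
      next
        case False
        show ?thesis unfolding z[OF False] by simp
      qed
    qed
    have "(\<integral>\<^sup>+\<xi>. ennreal ((cmod (fourier (\<lambda>x. ?h x - inverse_fourier ?b x) \<xi>))\<^sup>2) \<partial>lborel) \<le> ennreal ((E * W / S ^ 3)\<^sup>2 * ((S + 2 * W) - (S - 2 * W)))"
      using W by (intro nn_integral_le_const_on_interval err) auto
    also have "(E * W / S ^ 3)\<^sup>2 * ((S + 2 * W) - (S - 2 * W)) = (2 * E * (W / S) * amplitude j)\<^sup>2"
      using S W unfolding amplitude_def W_def[symmetric] S_def[symmetric]
      by (simp add: power_mult_distrib power_divide power2_eq_square power3_eq_cube field_simps)
    finally have "l2 (\<lambda>x. ?h x - inverse_fourier ?b x) \<le> 2 * E * (W / S) * amplitude j"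
      using E W S by (intro l2_le_fourierI tame_diff h tame_inverse_fourier b) (auto simp: amplitude_def W_def)
    also have "\<dots> \<le> 2 * E * (1 / 2 ^ j) * amplitude j"
    proof -
      have "W / S \<le> 1 / 4 ^ j" using W S by (simp add: field_simps)
      also have "\<dots> \<le> 1 / 2 ^ j" by (intro divide_left_mono power_mono) auto
      finally show ?thesis using E packet_width_ge_1[of j] by (intro mult_right_mono mult_left_mono) (auto simp: amplitude_def)
    qed
    also have "\<dots> = 2 * E * amplitude j / 2 ^ j" by simp
    finally have 1: "l2 (\<lambda>x. ?h x - inverse_fourier ?b x) \<le> 2 * E * amplitude j / 2 ^ j" .
    have "l2 (\<lambda>x. U1 filt (2 * j) ?g x - profile j x) \<le> l2 (\<lambda>x. ?h x - inverse_fourier ?b x)"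
    proof (rule l2_mono)
      show "cmod (U1 filt (2 * j) ?g x - profile j x) \<le> cmod (?h x - inverse_fourier ?b x)" for x
        unfolding U1_def profile_eq_cmod(1) of_real_diff[symmetric] norm_of_real S_def W_def by (rule norm_triangle_ineq3)
    qed (intro tame_diff tame_U1 g tame_filt tame_profile h tame_inverse_fourier b)+
    with 1 show "l2 (\<lambda>x. U1 filt (2 * j) ?g x - profile j x) \<le> 2 * E * amplitude j / 2 ^ j" by linarith
  qed
qed

text \<open>The wide filter is \<open>1\<close> for \<open>2 R \<le> \<bar>\<xi>\<bar> \<le> S / 2\<close>, so only the energy of the bump outside this
range counts. Below it, the transform is bounded by the \<open>L\<^sup>1\<close> norm, and the energy in an interval of
length \<open>4 R\<close> is a fraction of order \<open>R / W\<close>. Above it, the derivative bound leaves a fraction of order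
\<open>(W / S)\<^sup>2\<close>.\<close>

lemma l2_wide_step:
  "\<exists>D\<ge>0. \<forall>j. l2 (\<lambda>x. U1 filt (2 * j + 1) (profile j) x - profile j x) \<le> D * amplitude j / 2 ^ j"
proof -
  define I where "I = (LINT x|lborel. cmod (lp_kernel x))"
  define D where "D = kink_const * sqrt (4 * I\<^sup>2 + 16 * (l2 lp_kernel)\<^sup>2)"
  have D: "D \<ge> 0" using kink_const_pos by (simp add: D_def)
  show ?thesis
  proof (intro exI[of _ D] conjI allI D)
    fix j
    define R W S where "R = band_edge j" and "W = packet_width j" and "S = packet_center j"
    have W: "R \<ge> 1" "W \<ge> 1" "S \<ge> 8 * W" "W \<le> S / 4 ^ j" "R \<le> W / 4 ^ j"
      using band_edge_ge_1 packet_width_ge_1 packet_center_ge packet_width_le_packet_center band_edge_le_packet_width by (auto simp: R_def W_def S_def)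
    then have S: "S > 0" by linarith
    let ?K = "profile j" and ?q = "filt (2 * j + 1)"
    let ?b = "\<lambda>\<xi>. complex_of_real (kink_const / S\<^sup>2) * complex_of_real (low_pass ((\<xi> - 0) / W))"
    have b: "bump ?b" using W by (intro bump_low_pass_affine) auto
    have K: "tame ?K" by (rule tame_profile)
    have [measurable]: "?K \<in> borel_measurable borel" using tame_measurable[OF K] .
    have h: "tame (convolution ?K ?q)" by (intro tame_convolution K tame_filt)
    have Kb: "?K = (\<lambda>x. complex_of_real (cmod (inverse_fourier ?b x)))"
      unfolding S_def W_def by (rule ext) (rule profile_eq_cmod(2))
    have l2b: "l2 (inverse_fourier ?b) = kink_const * l2 lp_kernel * amplitude j"
      unfolding l2_profile[symmetric] Kb by (rule l2_cong_norm) simp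
    have supp: "fourier (inverse_fourier ?b) \<xi> = 0" if "\<bar>\<xi>\<bar> > 2 * W" for \<xi>
    proof -
      have "\<bar>(\<xi> - 0) / W\<bar> \<ge> 2" using that W by (simp add: abs_divide field_simps)
      from low_pass_outer[OF this] show ?thesis unfolding fourier_inverse_fourier[OF b] by simp
    qed
    have dev: "(\<integral>\<^sup>+\<xi>. ennreal (\<xi>\<^sup>2 * (cmod (fourier ?K \<xi>))\<^sup>2) \<partial>lborel) \<le> ennreal ((2 * W * (kink_const * l2 lp_kernel * amplitude j))\<^sup>2)"
      using modulus_derivative_bound[OF tame_inverse_fourier[OF b] _ supp] W unfolding Kb[symmetric] l2b by simp
    define M where "M = (kink_const / S\<^sup>2 * I)\<^sup>2"
    have M: "(cmod (fourier ?K \<xi>))\<^sup>2 \<le> M" for \<xi>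
      using cmod_fourier_le[of ?K \<xi>] unfolding M_def profile_L1 I_def S_def by (intro power_mono) auto
    have pw: "(cmod (fourier (\<lambda>x. convolution ?K ?q x - ?K x) \<xi>))\<^sup>2
       \<le> M * indicator {- (2 * R)..2 * R} \<xi> + (2 / S)\<^sup>2 * (\<xi>\<^sup>2 * (cmod (fourier ?K \<xi>))\<^sup>2)" for \<xi>
    proof -
      have eq: "fourier (\<lambda>x. convolution ?K ?q x - ?K x) \<xi> = fourier ?K \<xi> * complex_of_real (response (2 * j + 1) \<xi> - 1)"
        unfolding fourier_convolution_diff[OF K tame_filt K] fourier_filt by (simp add: right_diff_distrib)
      have le: "(cmod (fourier (\<lambda>x. convolution ?K ?q x - ?K x) \<xi>))\<^sup>2 \<le> (cmod (fourier ?K \<xi>))\<^sup>2"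
      proof (intro power_mono)
        have "\<bar>response (2 * j + 1) \<xi> - 1\<bar> \<le> 1" using response_range[of "2 * j + 1" \<xi>] by linarith
        then show "cmod (fourier (\<lambda>x. convolution ?K ?q x - ?K x) \<xi>) \<le> cmod (fourier ?K \<xi>)"
          unfolding eq norm_mult norm_of_real by (simp add: mult_left_le)
      qed simp
      \<comment> \<open>Low frequencies, high frequencies, and the range in which the filter is transparent.\<close>
      consider "\<bar>\<xi>\<bar> \<le> 2 * R" | "\<bar>\<xi>\<bar> \<ge> S / 2" | "2 * R \<le> \<bar>\<xi>\<bar>" "\<bar>\<xi>\<bar> \<le> S / 2" by linarith
      then show ?thesis
      proof cases
        case 1
        then have ind: "indicator {- (2 * R)..2 * R} \<xi> = (1::real)" by (auto simp: indicator_def)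
        have "0 \<le> (2 / S)\<^sup>2 * (\<xi>\<^sup>2 * (cmod (fourier ?K \<xi>))\<^sup>2)" by simp
        then show ?thesis unfolding ind using le M[of \<xi>] by linarith
      next
        case 2
        have "1 \<le> (2 / S)\<^sup>2 * \<xi>\<^sup>2"
        proof -
          have "1 \<le> (2 / S * \<bar>\<xi>\<bar>)\<^sup>2" using 2 S by (intro one_le_power) (simp add: field_simps)
          then show ?thesis unfolding power_mult_distrib by simp
        qed
        then have "1 * (cmod (fourier ?K \<xi>))\<^sup>2 \<le> ((2 / S)\<^sup>2 * \<xi>\<^sup>2) * (cmod (fourier ?K \<xi>))\<^sup>2"
          by (intro mult_right_mono) auto
        moreover have "0 \<le> M * indicator {- (2 * R)..2 * R} \<xi>" by (simp add: M_def)
        ultimately show ?thesis using le unfolding mult.assoc by linarith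
      next
        case 3
        then have "response (2 * j + 1) \<xi> = 1" by (intro wide_eq_1) (auto simp: R_def S_def)
        then have "fourier (\<lambda>x. convolution ?K ?q x - ?K x) \<xi> = 0" unfolding eq by simp
        then show ?thesis by (simp add: M_def)
      qed
    qed
    have "(\<integral>\<^sup>+\<xi>. ennreal ((cmod (fourier (\<lambda>x. convolution ?K ?q x - ?K x) \<xi>))\<^sup>2) \<partial>lborel)
      \<le> (\<integral>\<^sup>+\<xi>. ennreal M * indicator {- (2 * R)..2 * R} \<xi> + ennreal ((2 / S)\<^sup>2) * ennreal (\<xi>\<^sup>2 * (cmod (fourier ?K \<xi>))\<^sup>2) \<partial>lborel)"
    proof (rule nn_integral_mono)
      fix \<xi>
      have "ennreal ((cmod (fourier (\<lambda>x. convolution ?K ?q x - ?K x) \<xi>))\<^sup>2) \<le> ennreal (M * indicator {- (2 * R)..2 * R} \<xi> + (2 / S)\<^sup>2 * (\<xi>\<^sup>2 * (cmod (fourier ?K \<xi>))\<^sup>2))"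
        by (rule ennreal_leI[OF pw])
      also have "\<dots> = ennreal M * indicator {- (2 * R)..2 * R} \<xi> + ennreal ((2 / S)\<^sup>2) * ennreal (\<xi>\<^sup>2 * (cmod (fourier ?K \<xi>))\<^sup>2)"
        by (auto simp: M_def indicator_def ennreal_mult)
      finally show "ennreal ((cmod (fourier (\<lambda>x. convolution ?K ?q x - ?K x) \<xi>))\<^sup>2) \<le> \<dots>" .
    qed
    also have "\<dots> = ennreal M * (\<integral>\<^sup>+\<xi>. indicator {- (2 * R)..2 * R} \<xi> \<partial>lborel) + ennreal ((2 / S)\<^sup>2) * (\<integral>\<^sup>+\<xi>. ennreal (\<xi>\<^sup>2 * (cmod (fourier ?K \<xi>))\<^sup>2) \<partial>lborel)"
      by (subst nn_integral_add) (auto simp: nn_integral_cmult nn_integral_cmult_indicator)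
    also have "\<dots> \<le> ennreal M * ennreal (4 * R) + ennreal ((2 / S)\<^sup>2) * ennreal ((2 * W * (kink_const * l2 lp_kernel * amplitude j))\<^sup>2)"
      using W by (intro add_mono mult_left_mono dev) auto
    also have "\<dots> = ennreal (M * (4 * R) + (2 / S)\<^sup>2 * (2 * W * (kink_const * l2 lp_kernel * amplitude j))\<^sup>2)"
      using W by (simp add: M_def flip: ennreal_mult ennreal_plus)
    also have "\<dots> \<le> ennreal ((D * amplitude j / 2 ^ j)\<^sup>2)"
    proof (rule ennreal_leI)
      have a: "(amplitude j)\<^sup>2 = W / S ^ 4" using W by (simp add: amplitude_def W_def S_def power_divide flip: power_mult)
      have "M * (4 * R) \<le> M * (4 * (W / 4 ^ j))" using W by (intro mult_left_mono) (auto simp: M_def)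
      also have "\<dots> = kink_const\<^sup>2 * (4 * I\<^sup>2) * (amplitude j)\<^sup>2 / 4 ^ j"
        unfolding a M_def by (simp add: power_mult_distrib power_divide flip: power_mult)
      finally have 1: "M * (4 * R) \<le> kink_const\<^sup>2 * (4 * I\<^sup>2) * (amplitude j)\<^sup>2 / 4 ^ j" .
      have "(W / S)\<^sup>2 \<le> (1 / 4 ^ j)\<^sup>2" using W S by (intro power_mono) (auto simp: field_simps)
      also have "\<dots> \<le> 1 / 4 ^ j" by (simp add: power2_eq_square field_simps)
      finally have ws: "(W / S)\<^sup>2 \<le> 1 / 4 ^ j" .
      have "(2 / S)\<^sup>2 * (2 * W * (kink_const * l2 lp_kernel * amplitude j))\<^sup>2 = 16 * (kink_const * l2 lp_kernel * amplitude j)\<^sup>2 * (W / S)\<^sup>2"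
        by (simp add: power_mult_distrib power_divide)
      also have "\<dots> \<le> 16 * (kink_const * l2 lp_kernel * amplitude j)\<^sup>2 * (1 / 4 ^ j)"
        by (intro mult_left_mono ws) auto
      finally have 2: "(2 / S)\<^sup>2 * (2 * W * (kink_const * l2 lp_kernel * amplitude j))\<^sup>2 \<le> 16 * (kink_const * l2 lp_kernel * amplitude j)\<^sup>2 * (1 / 4 ^ j)" .
      have four: "((2::real) ^ j)\<^sup>2 = 4 ^ j" by (simp add: power2_eq_square flip: power_mult_distrib)
      have "(D * amplitude j / 2 ^ j)\<^sup>2 = kink_const\<^sup>2 * (4 * I\<^sup>2 + 16 * (l2 lp_kernel)\<^sup>2) * (amplitude j)\<^sup>2 / 4 ^ j"
        by (simp add: D_def power_mult_distrib power_divide four)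
      also have "\<dots> = kink_const\<^sup>2 * (4 * I\<^sup>2) * (amplitude j)\<^sup>2 / 4 ^ j + 16 * (kink_const * l2 lp_kernel * amplitude j)\<^sup>2 * (1 / 4 ^ j)"
        by (simp add: power_mult_distrib algebra_simps add_divide_distrib)
      finally show "M * (4 * R) + (2 / S)\<^sup>2 * (2 * W * (kink_const * l2 lp_kernel * amplitude j))\<^sup>2 \<le> (D * amplitude j / 2 ^ j)\<^sup>2"
        using 1 2 by linarith
    qed
    finally have 1: "l2 (\<lambda>x. convolution ?K ?q x - ?K x) \<le> D * amplitude j / 2 ^ j"
      using D W by (intro l2_le_fourierI tame_diff h K) (auto simp: amplitude_def W_def)
    have "l2 (\<lambda>x. U1 filt (2 * j + 1) ?K x - ?K x) \<le> l2 (\<lambda>x. convolution ?K ?q x - ?K x)"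
    proof (rule l2_mono)
      fix x
      have "?K x = complex_of_real (cmod (?K x))" unfolding cmod_profile by (rule profile_def)
      then show "cmod (U1 filt (2 * j + 1) ?K x - ?K x) \<le> cmod (convolution ?K ?q x - ?K x)"
        using norm_triangle_ineq3[of "convolution ?K ?q x" "?K x"] unfolding U1_def
        by (metis norm_of_real of_real_diff)
    qed (intro tame_diff tame_U1 K tame_filt h)+
    with 1 show "l2 (\<lambda>x. U1 filt (2 * j + 1) ?K x - ?K x) \<le> D * amplitude j / 2 ^ j" by linarith
  qed
qed

lemma U_path_append: "U_path \<psi> (p @ q) f = U_path \<psi> q (U_path \<psi> p f)"
  by (induction p arbitrary: f) auto

text \<open>By nonexpansiveness the errors of the single steps add up and are not amplified.\<close>

lemma l2_iterate:
  assumes K: "tame K" and p: "\<And>l. tame (\<psi> l)" and 1: "\<And>\<xi>. cmod (fourier (\<psi> l) \<xi>) \<le> 1"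
    and \<eta>: "l2 (\<lambda>x. U1 \<psi> l K x - K x) \<le> \<eta>"
  shows "tame u \<Longrightarrow> l2 (\<lambda>x. U_path \<psi> (replicate N l) u x - K x) \<le> l2 (\<lambda>x. u x - K x) + N * \<eta>"
proof (induction N arbitrary: u)
  case (Suc N)
  have "l2 (\<lambda>x. U_path \<psi> (replicate (Suc N) l) u x - K x) \<le> l2 (\<lambda>x. U1 \<psi> l u x - K x) + N * \<eta>"
    using Suc.IH[OF tame_U1[OF Suc.prems p]] by simp
  also have "l2 (\<lambda>x. U1 \<psi> l u x - K x) \<le> l2 (\<lambda>x. U1 \<psi> l u x - U1 \<psi> l K x) + l2 (\<lambda>x. U1 \<psi> l K x - K x)"
    by (intro l2_diff_triangle tame_U1 K p Suc.prems)
  also have "\<dots> \<le> l2 (\<lambda>x. u x - K x) + \<eta>"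
    by (intro add_mono \<eta> l2_U1_nonexpansive Suc.prems K p 1)
  finally show ?case by (simp add: algebra_simps)
qed simp

text \<open>Filter \<open>1\<close> and its modulus create the kink, the narrow filter \<open>2 j\<close> turns the kink into a
bump, and the wide filter \<open>2 j + 1\<close> then preserves the bump.\<close>

lemma l2_path_lower:
  "\<exists>D\<ge>0. \<forall>j N. l2 (U_path filt ([1, 2 * j] @ replicate N (2 * j + 1)) signal) \<ge> (kink_const * l2 lp_kernel - D * (1 + real N) / 2 ^ j) * amplitude j"
proof -
  let ?g = "\<lambda>x. complex_of_real (cmod (signal x))"
  obtain A where A: "A \<ge> 0" "\<And>j. l2 (\<lambda>x. U1 filt (2 * j) ?g x - profile j x) \<le> A * amplitude j / 2 ^ j"
    using l2_narrow_step by blast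
  obtain B where B: "B \<ge> 0" "\<And>j. l2 (\<lambda>x. U1 filt (2 * j + 1) (profile j) x - profile j x) \<le> B * amplitude j / 2 ^ j"
    using l2_wide_step by blast
  show ?thesis
  proof (intro exI[of _ "A + B"] conjI allI)
    show "A + B \<ge> 0" using A B by simp
    fix j N
    have amplitude: "amplitude j \<ge> 0" using packet_width_ge_1[of j] by (simp add: amplitude_def)
    have g: "tame ?g" by (intro tame_modulus tame_signal)
    let ?u1 = "U1 filt 1 signal"
    have u1: "tame ?u1" by (intro tame_U1 tame_signal tame_filt)
    let ?u2 = "U1 filt (2 * j) ?u1"
    have u2: "tame ?u2" by (intro tame_U1 u1 tame_filt)
    let ?u = "U_path filt ([1, 2 * j] @ replicate N (2 * j + 1)) signal"
    have u: "?u = U_path filt (replicate N (2 * j + 1)) ?u2" by (simp add: U_path_append)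
    have "l2 (\<lambda>x. ?u2 x - profile j x) \<le> l2 (\<lambda>x. ?u2 x - U1 filt (2 * j) ?g x) + l2 (\<lambda>x. U1 filt (2 * j) ?g x - profile j x)"
      by (intro l2_diff_triangle u2 tame_U1 g tame_filt tame_profile)
    also have "\<dots> \<le> 0 + A * amplitude j / 2 ^ j"
      using l2_U1_nonexpansive[OF u1 g, of filt "2 * j", OF tame_filt cmod_fourier_filt] l2_first_step
      by (intro add_mono A(2)) simp
    finally have s2: "l2 (\<lambda>x. ?u2 x - profile j x) \<le> A * amplitude j / 2 ^ j" by simp
    have "l2 (\<lambda>x. ?u x - profile j x) \<le> l2 (\<lambda>x. ?u2 x - profile j x) + N * (B * amplitude j / 2 ^ j)"
      unfolding u by (rule l2_iterate[OF tame_profile tame_filt cmod_fourier_filt B(2) u2])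
    also have "\<dots> \<le> A * amplitude j / 2 ^ j + N * (B * amplitude j / 2 ^ j)" using s2 by simp
    also have "\<dots> \<le> (A + B) * (1 + real N) / 2 ^ j * amplitude j"
    proof -
      have "A + N * B \<le> (A + B) * (1 + real N)" using A(1) B(1) by (simp add: algebra_simps)
      then have "(A + N * B) * (amplitude j / 2 ^ j) \<le> (A + B) * (1 + real N) * (amplitude j / 2 ^ j)"
        using amplitude by (intro mult_right_mono) auto
      then show ?thesis by (simp add: field_simps)
    qed
    finally have "l2 (\<lambda>x. ?u x - profile j x) \<le> (A + B) * (1 + real N) / 2 ^ j * amplitude j" .
    moreover have "l2 (profile j) - l2 (\<lambda>x. ?u x - profile j x) \<le> l2 ?u"
      unfolding u by (intro l2_ge_diff tame_profile tame_U_path u2 tame_filt)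
    ultimately show "l2 ?u \<ge> (kink_const * l2 lp_kernel - (A + B) * (1 + real N) / 2 ^ j) * amplitude j"
      unfolding l2_profile by (simp add: left_diff_distrib)
  qed
qed

section \<open>The growth rate\<close>

lemma amplitude_ge: "amplitude j \<ge> exp (- (ln 2 * (4 * real j ^ 2 + 16 * real j + 10)))"
proof -
  have c: "packet_center j = 2 ^ (2 * j\<^sup>2 + 8 * j + 5)"
    unfolding packet_center_def packet_width_def band_edge_def power_add[symmetric] by (rule arg_cong[of _ _ "\<lambda>n. 2 ^ n"]) simp
  have "(packet_center j)\<^sup>2 = 2 ^ (4 * j\<^sup>2 + 16 * j + 10)"
    unfolding c power_mult[symmetric] by (rule arg_cong[of _ _ "\<lambda>n. 2 ^ n"]) simp
  also have "\<dots> = 2 powr real (4 * j\<^sup>2 + 16 * j + 10)" by (rule powr_realpow[symmetric]) simp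
  also have "\<dots> = 2 powr (4 * real j ^ 2 + 16 * real j + 10)" by simp
  also have "\<dots> = exp (ln 2 * (4 * real j ^ 2 + 16 * real j + 10))" by (simp add: powr_def mult.commute)
  finally have "exp (- (ln 2 * (4 * real j ^ 2 + 16 * real j + 10))) = 1 / (packet_center j)\<^sup>2"
    by (simp add: exp_minus inverse_eq_divide)
  also have "\<dots> \<le> amplitude j" unfolding amplitude_def using packet_width_ge_1[of j] by (intro divide_right_mono) auto
  finally show ?thesis .
qed

lemma root_lower_bound:
  assumes c: "c > 0"
  shows "(\<lambda>j. (c * exp (- (ln 2 * (4 * real j ^ 2 + 16 * real j + 10)))) powr (1 / real (j ^ 3 + 2))) \<longlonglongrightarrow> 1"
proof -
  have 1: "(\<lambda>j::nat. ln c * (1 / (real j ^ 3 + 2))) \<longlonglongrightarrow> ln c * 0"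
    by (intro tendsto_mult tendsto_const) real_asymp
  have 2: "(\<lambda>j::nat. ln 2 * ((4 * real j ^ 2 + 16 * real j + 10) / (real j ^ 3 + 2))) \<longlonglongrightarrow> ln 2 * 0"
    by (intro tendsto_mult tendsto_const) real_asymp
  have "(\<lambda>j::nat. exp (ln c * (1 / (real j ^ 3 + 2)) - ln 2 * ((4 * real j ^ 2 + 16 * real j + 10) / (real j ^ 3 + 2)))) \<longlonglongrightarrow> exp (ln c * 0 - ln 2 * 0)"
    by (intro tendsto_exp tendsto_diff 1 2)
  moreover have "(c * exp (- (ln 2 * (4 * real j ^ 2 + 16 * real j + 10)))) powr (1 / real (j ^ 3 + 2))
     = exp (ln c * (1 / (real j ^ 3 + 2)) - ln 2 * ((4 * real j ^ 2 + 16 * real j + 10) / (real j ^ 3 + 2)))" for j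
    using c by (simp add: powr_def ln_mult diff_divide_distrib add.commute)
  ultimately show ?thesis by simp
qed

text \<open>The energy bound gives the upper estimate. For the lower one, take in band \<open>j\<close> the path with
\<open>j\<^sup>3\<close> repetitions of the wide filter: the accumulated error \<open>j\<^sup>3 / 2\<^sup>j\<close> vanishes in the limit, and so
does the influence of the size \<open>2\<close> to the power \<open>- O(j\<^sup>2)\<close> of the bump.\<close>

lemma limsup_U_norm: "limsup (\<lambda>N. ennreal_powr (U_norm UNIV filt N signal) (1 / real N)) = 1"
proof (rule antisym)
  let ?X = "\<lambda>N. ennreal_powr (U_norm UNIV filt N signal) (1 / real N)"
  define M where "M = l2 signal + 1"
  have M: "M > 0" "l2 signal \<le> M" using add_nonneg_pos[OF l2_nonneg[of signal], of 1] by (auto simp: M_def)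
  have up: "?X N \<le> ennreal (M powr (1 / real N))" for N
  proof -
    have "U_norm UNIV filt N signal \<le> ennreal (l2 signal)"
      by (rule U_norm_le[OF tame_signal tame_filt]) (simp add: fourier_filt sum_response_le_1)
    also have "\<dots> \<le> ennreal M" using M by (intro ennreal_leI)
    finally have "?X N \<le> ennreal_powr (ennreal M) (1 / real N)" by (intro ennreal_powr_mono) auto
    then show ?thesis using M by (simp add: ennreal_powr_ennreal)
  qed
  have "(\<lambda>N. M powr (1 / real N)) \<longlonglongrightarrow> M powr 0"
    using M by (intro tendsto_powr tendsto_const lim_1_over_n) auto
  then have "(\<lambda>N. ennreal (M powr (1 / real N))) \<longlonglongrightarrow> ennreal 1" using M by (intro tendsto_ennrealI) simp
  then have "limsup (\<lambda>N. ennreal (M powr (1 / real N))) = 1" by (simp add: lim_imp_Limsup)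
  moreover have "limsup ?X \<le> limsup (\<lambda>N. ennreal (M powr (1 / real N)))"
    by (intro Limsup_mono always_eventually allI up)
  ultimately show "limsup ?X \<le> 1" by simp
  obtain D where D: "D \<ge> 0" "\<And>j N. l2 (U_path filt ([1, 2 * j] @ replicate N (2 * j + 1)) signal) \<ge> (kink_const * l2 lp_kernel - D * (1 + real N) / 2 ^ j) * amplitude j"
    using l2_path_lower by blast
  define c where "c = kink_const * l2 lp_kernel / 2"
  have c: "c > 0" using kink_const_pos l2_lp_kernel_pos by (simp add: c_def)
  \<comment> \<open>The two additional steps are the first filter and the narrow filter.\<close>
  define r where "r j = j ^ 3 + 2" for j :: nat
  have r: "strict_mono r" unfolding r_def strict_mono_def by (auto intro: power_strict_mono)
  let ?y = "\<lambda>j. (c * exp (- (ln 2 * (4 * real j ^ 2 + 16 * real j + 10)))) powr (1 / real (r j))"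
  have "(\<lambda>j::nat. D * ((1 + real j ^ 3) / 2 ^ j)) \<longlonglongrightarrow> D * 0"
    by (intro tendsto_mult tendsto_const) real_asymp
  then have "eventually (\<lambda>j. D * ((1 + real j ^ 3) / 2 ^ j) < c) sequentially"
    using c by (auto dest: order_tendstoD(2))
  then have "eventually (\<lambda>j. ennreal (?y j) \<le> (?X \<circ> r) j) sequentially"
  proof eventually_elim
    case (elim j)
    let ?p = "[1, 2 * j] @ replicate (j ^ 3) (2 * j + 1)"
    have len: "length ?p = r j" by (simp add: r_def)
    have "c * exp (- (ln 2 * (4 * real j ^ 2 + 16 * real j + 10))) \<le> c * amplitude j"
      using c by (intro mult_left_mono amplitude_ge) auto
    also have "\<dots> \<le> (kink_const * l2 lp_kernel - D * (1 + real (j ^ 3)) / 2 ^ j) * amplitude j"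
      using elim packet_width_ge_1[of j] by (intro mult_right_mono) (auto simp: c_def amplitude_def)
    also have "\<dots> \<le> l2 (U_path filt ?p signal)" by (rule D(2))
    finally have "ennreal (c * exp (- (ln 2 * (4 * real j ^ 2 + 16 * real j + 10)))) \<le> ennreal (l2 (U_path filt ?p signal))"
      by (rule ennreal_leI)
    also have "\<dots> \<le> U_norm UNIV filt (r j) signal" by (rule U_norm_ge[OF tame_signal tame_filt len])
    finally have "ennreal_powr (ennreal (c * exp (- (ln 2 * (4 * real j ^ 2 + 16 * real j + 10))))) (1 / real (r j)) \<le> ?X (r j)"
      by (intro ennreal_powr_mono) auto
    then show ?case using c by (simp add: ennreal_powr_ennreal)
  qed
  then have "limsup (\<lambda>j. ennreal (?y j)) \<le> limsup (?X \<circ> r)" by (rule Limsup_mono)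
  also have "\<dots> \<le> limsup ?X" by (rule limsup_subseq_mono[OF r])
  finally have le: "limsup (\<lambda>j. ennreal (?y j)) \<le> limsup ?X" .
  have "(\<lambda>j. ennreal (?y j)) \<longlonglongrightarrow> ennreal 1"
    using root_lower_bound[OF c] unfolding r_def by (intro tendsto_ennrealI)
  then have "limsup (\<lambda>j. ennreal (?y j)) = 1" by (simp add: lim_imp_Limsup)
  with le show "1 \<le> limsup ?X" by simp
qed

theorem theorem1p6:
  shows "\<exists>(chi :: real \<Rightarrow> complex) (\<Lambda> :: nat set) (\<psi> :: nat \<Rightarrow> real \<Rightarrow> complex) (f :: real \<Rightarrow> complex).
           scattering_filter_bank chi \<Lambda> \<psi> \<and>
           schwartz chi \<and> band_limited chi \<and>
           (\<forall>l\<in>\<Lambda>. schwartz (\<psi> l) \<and> band_limited (\<psi> l)) \<and>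
           schwartz f \<and> band_limited f \<and>
           (\<forall>\<^sub>F \<xi> in nhds 0. fourier chi \<xi> = 1) \<and>
           limsup (\<lambda>N. ennreal_powr (U_norm \<Lambda> \<psi> N f) (1 / real N)) = 1"
proof (intro exI conjI ballI)
  show "scattering_filter_bank lp_kernel UNIV filt" by (rule scattering_filter_bank_filt)
  show "schwartz lp_kernel" by (rule rapid_smooth_schwartz[OF rapid_smooth_lp_kernel])
  show "band_limited lp_kernel" unfolding lp_kernel_def by (rule band_limited_inverse_fourier[OF bump_low_pass])
  show "schwartz (filt l)" "band_limited (filt l)" for l
    unfolding filt_def by (intro rapid_smooth_schwartz rapid_smooth_inverse_fourier band_limited_inverse_fourier bump_response)+
  show "schwartz signal" by (rule rapid_smooth_schwartz[OF rapid_smooth_signal])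
  show "band_limited signal" by (rule band_limitedI[of 10]) (auto intro: fourier_signal_eq_0)
  have "eventually (\<lambda>\<xi>::real. \<xi> \<in> {-1<..<1}) (nhds 0)" by (rule eventually_nhds_in_open) auto
  then show "\<forall>\<^sub>F \<xi> in nhds 0. fourier lp_kernel \<xi> = 1"
    by eventually_elim (auto simp: fourier_lp_kernel intro!: low_pass_inner)
  show "limsup (\<lambda>N. ennreal_powr (U_norm UNIV filt N signal) (1 / real N)) = 1" by (rule limsup_U_norm)
qed

end
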